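(* Assume that $\mathcal A$ has constant rank, and let $\varpi\ge1$ be a constant such that $\omega(V)\le\varpi\,d(V,\Lambda_{\mathcal A})^{-(\lfloor d/2\rfloor+2)}$ for every linear subspace $V\subset\mathbb V$ with $V\cap\Lambda_{\mathcal A}=\{0\}$. Let $\nu^\infty\in\mathrm{Prob}(S_{\mathbb V})$ be supported on $\mathbb V_{\mathcal A}$, with barycenter $X_0=\int_{S_{\mathbb V}}X\,d\nu^\infty(X)\notin\Lambda_{\mathcal A}$, and suppose that $f(X_0)\le f(0)+\int_{S_{\mathbb V}}f^\infty\,d\nu^\infty$ for all $f\in\mathbf E_{\mathcal A}(\mathbb V)$. Write $\ell_{X_0}=\{tX_0:t\in\mathbb R\}$ and $\mathrm{Var}(\nu^\infty)=\int_{S_{\mathbb V}}|X-X_0|^2\,d\nu^\infty(X)=1-|X_0|^2$. Then $$\mathrm{Var}(\nu^\infty)\ \ge\ \frac{1}{1+\omega(\ell_{X_0})^2}>0\qquad\text{and}\qquad \mathrm{Var}(\nu^\infty)\ \ge\ \frac{d(\ell_{X_0},\Lambda_{\mathcal A})^{2(\lfloor d/2\rfloor+2)}}{1+\varpi^2}.$$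
   Context: $\mathbb V,\mathbb W$ are finite-dimensional real inner product spaces, $d,k\ge 1$ are integers, and $\mathcal A=\sum_{|\gamma|=k}A_\gamma\partial^\gamma$ with $A_\gamma\in\mathrm{Hom}(\mathbb V,\mathbb W)$. Its symbol is $\mathbb A(\xi)=\sum_{|\gamma|=k}A_\gamma\xi^\gamma$. Constant rank: $\operatorname{rank}\mathbb A(\xi)$ is constant over $\xi\in\mathbb R^d\setminus\{0\}$. The wave cone is $\Lambda_{\mathcal A}=\bigcup_{|\xi|=1}\ker\mathbb A(\xi)\subset\mathbb V$ and $\mathbb V_{\mathcal A}=\operatorname{span}\Lambda_{\mathcal A}$. $S_{\mathbb V},B_{\mathbb V}$ are the unit sphere and the open unit ball of $\mathbb V$. $d(V,\Lambda_{\mathcal A})=\inf_{X\in V\cap S_{\mathbb V}}\operatorname{dist}(X,\Lambda_{\mathcal A})$, infimum taken in $[0,1]$. $\mathbf E(\mathbb V)$: continuous $f:\mathbb V\to\mathbb R$ such that $\hat f(X)=(1-|X|)f\big(\tfrac{X}{1-|X|}\big)$, $X\in B_{\mathbb V}$, extends continuously to $\overline B_{\mathbb V}$. Recession function: $f^\infty(X)=\lim_{t\to\infty}f(tX)/t$. A continuous $f:\mathbb V\to\mathbb R$ is $\mathcal A$-quasiconvex if $f(X)\le\int_{[0,1]^d}f(X+u(y))\,dy$ for every $X\in\mathbb V$ and every $u\in C^\infty(\mathbb T^d;\mathbb V)$ ($\mathbb T^d=\mathbb R^d/\mathbb Z^d$) with $\mathcal Au=0$ and $\int_{[0,1]^d}u\,dy=0$.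 $\mathbf E_{\mathcal A}(\mathbb V)$ is the set of $\mathcal A$-quasiconvex functions in $\mathbf E(\mathbb V)$. $\omega(V)=\sup\Big\{\frac{\|u\|_{L^{1,\infty}}}{\|\operatorname{dist}(u,V)\|_{L^1}}: u\in C^\infty_c(\mathbb R^d;\mathbb V),\ \mathcal Au=0,\ u\not\equiv0\Big\}$ (supremum in $[0,\infty]$; finite when $V\cap\Lambda_{\mathcal A}=\{0\}$), with $\|u\|_{L^{1,\infty}}=\sup_{t>0}t\,\mathscr L^d(\{|u|>t\})$. A constant $\varpi$ as in the claim, depending only on $\mathcal A$ and $d$, exists. *)

theory Defs
  imports "HOL-Probability.Probability"
begin

definition partial_deriv ::
    "'d::finite \<Rightarrow> (real^'d \<Rightarrow> 'v::euclidean_space) \<Rightarrow> real^'d \<Rightarrow> 'v" where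
  "partial_deriv i u x = frechet_derivative u (at x) (axis i 1)"

primrec Cn :: "nat \<Rightarrow> (real^'d::finite \<Rightarrow> 'v::euclidean_space) \<Rightarrow> bool" where
  "Cn 0 u \<longleftrightarrow> continuous_on UNIV u"
| "Cn (Suc n) u \<longleftrightarrow> (\<forall>x. u differentiable (at x)) \<and> (\<forall>i. Cn n (partial_deriv i u))"

definition smooth :: "(real^'d::finite \<Rightarrow> 'v::euclidean_space) \<Rightarrow> bool" where
  "smooth u \<longleftrightarrow> (\<forall>n. Cn n u)"

text \<open>The index type carries no order, so the partial derivatives are applied along an arbitrary
  enumeration of it; on smooth functions, the only ones used below, they commute.\<close>

definition multi_deriv ::
    "('d::finite \<Rightarrow> nat) \<Rightarrow> (real^'d \<Rightarrow> 'v::euclidean_space) \<Rightarrow> real^'d \<Rightarrow> 'v" where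
  "multi_deriv \<gamma> u =
     foldr (\<lambda>i. partial_deriv i ^^ \<gamma> i) (SOME is. distinct is \<and> set is = UNIV) u"

definition multi_indices :: "nat \<Rightarrow> ('d::finite \<Rightarrow> nat) set" where
  "multi_indices k = {\<gamma>. (\<Sum>i\<in>UNIV. \<gamma> i) = k}"

text \<open>Finiteness matters: the sums over \<^term>\<open>multi_indices k\<close> below would otherwise be 0 by
  convention.\<close>

lemma finite_multi_indices: "finite (multi_indices k :: ('d::finite \<Rightarrow> nat) set)"
proof (rule finite_subset)
  show "multi_indices k \<subseteq> (UNIV :: 'd set) \<rightarrow>\<^sub>E {..k}"
    by (auto simp: multi_indices_def PiE_def intro: member_le_sum)
  show "finite ((UNIV :: 'd set) \<rightarrow>\<^sub>E {..k})"
    by (intro finite_PiE) auto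
qed

text \<open>An operator is given by its order k and its coefficients; only the coefficients at
  multi-indices of length k matter.  In finite dimensions bounded linear maps are all linear maps.\<close>

definition diff_op ::
    "(('d::finite \<Rightarrow> nat) \<Rightarrow> ('v::euclidean_space \<Rightarrow>\<^sub>L 'w::euclidean_space)) \<Rightarrow> nat \<Rightarrow>
     (real^'d \<Rightarrow> 'v) \<Rightarrow> real^'d \<Rightarrow> 'w" where
  "diff_op A k u x = (\<Sum>\<gamma>\<in>multi_indices k. blinfun_apply (A \<gamma>) (multi_deriv \<gamma> u x))"

definition symbol ::
    "(('d::finite \<Rightarrow> nat) \<Rightarrow> ('v::euclidean_space \<Rightarrow>\<^sub>L 'w::euclidean_space)) \<Rightarrow> nat \<Rightarrow>
     real^'d \<Rightarrow> ('v \<Rightarrow>\<^sub>L 'w)" where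
  "symbol A k \<xi> = (\<Sum>\<gamma>\<in>multi_indices k. (\<Prod>i\<in>UNIV. (\<xi> $ i) ^ \<gamma> i) *\<^sub>R A \<gamma>)"

definition constant_rank ::
    "(('d::finite \<Rightarrow> nat) \<Rightarrow> ('v::euclidean_space \<Rightarrow>\<^sub>L 'w::euclidean_space)) \<Rightarrow> nat \<Rightarrow> bool" where
  "constant_rank A k \<longleftrightarrow>
     (\<exists>r. \<forall>\<xi>. \<xi> \<noteq> 0 \<longrightarrow> dim (range (blinfun_apply (symbol A k \<xi>))) = r)"

definition wave_cone ::
    "(('d::finite \<Rightarrow> nat) \<Rightarrow> ('v::euclidean_space \<Rightarrow>\<^sub>L 'w::euclidean_space)) \<Rightarrow> nat \<Rightarrow> 'v set" where
  "wave_cone A k = (\<Union>\<xi>\<in>sphere 0 1. {X. blinfun_apply (symbol A k \<xi>) X = 0})"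

text \<open>Inserting 1 makes this the infimum in \<open>[0,1]\<close>, with value 1 for the zero subspace.\<close>

definition cone_dist :: "'v::euclidean_space set \<Rightarrow> 'v set \<Rightarrow> real" where
  "cone_dist V \<Lambda> = Inf (insert 1 ((\<lambda>X. infdist X \<Lambda>) ` (V \<inter> sphere 0 1)))"

definition E_space :: "('v::euclidean_space \<Rightarrow> real) set" where
  "E_space = {f. continuous_on UNIV f \<and>
     (\<exists>g. continuous_on (cball 0 1) g \<and>
        (\<forall>X\<in>ball 0 1. g X = (1 - norm X) * f (X /\<^sub>R (1 - norm X))))}"

definition recession :: "('v::euclidean_space \<Rightarrow> real) \<Rightarrow> 'v \<Rightarrow> real" where
  "recession f X = Lim at_top (\<lambda>t::real. f (t *\<^sub>R X) / t)"

definition torus_periodic :: "(real^'d::finite \<Rightarrow> 'v) \<Rightarrow> bool" where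
  "torus_periodic u \<longleftrightarrow> (\<forall>i x. u (x + axis i 1) = u x)"

definition quasiconvex ::
    "(('d::finite \<Rightarrow> nat) \<Rightarrow> ('v::euclidean_space \<Rightarrow>\<^sub>L 'w::euclidean_space)) \<Rightarrow> nat \<Rightarrow>
     ('v \<Rightarrow> real) \<Rightarrow> bool" where
  "quasiconvex A k f \<longleftrightarrow> continuous_on UNIV f \<and>
     (\<forall>X u. smooth u \<and> torus_periodic u \<and> (\<forall>y. diff_op A k u y = 0) \<and>
        (LINT y:cbox 0 (\<chi> i. 1)|lborel. u y) = 0 \<longrightarrow>
        f X \<le> (LINT y:cbox 0 (\<chi> i. 1)|lborel. f (X + u y)))"

definition E_qc ::
    "(('d::finite \<Rightarrow> nat) \<Rightarrow> ('v::euclidean_space \<Rightarrow>\<^sub>L 'w::euclidean_space)) \<Rightarrow> nat \<Rightarrow>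
     ('v \<Rightarrow> real) set" where
  "E_qc A k = {f \<in> E_space. quasiconvex A k f}"

definition weak_L1 :: "(real^'d::finite \<Rightarrow> 'v::euclidean_space) \<Rightarrow> ennreal" where
  "weak_L1 u = (SUP t\<in>{0<..}. ennreal t * emeasure lborel {x. t < norm (u x)})"

definition L1_dist :: "(real^'d::finite \<Rightarrow> 'v::euclidean_space) \<Rightarrow> 'v set \<Rightarrow> ennreal" where
  "L1_dist u V = (\<integral>\<^sup>+x. ennreal (infdist (u x) V) \<partial>lborel)"

definition test_fields ::
    "(('d::finite \<Rightarrow> nat) \<Rightarrow> ('v::euclidean_space \<Rightarrow>\<^sub>L 'w::euclidean_space)) \<Rightarrow> nat \<Rightarrow>
     (real^'d \<Rightarrow> 'v) set" where
  "test_fields A k = {u. smooth u \<and> compact (closure {x. u x \<noteq> 0}) \<and>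
     (\<forall>x. diff_op A k u x = 0) \<and> (\<exists>x. u x \<noteq> 0)}"

text \<open>The numerator is positive and finite for every test field, so a vanishing denominator
  makes the quotient infinite.\<close>

definition omega ::
    "(('d::finite \<Rightarrow> nat) \<Rightarrow> ('v::euclidean_space \<Rightarrow>\<^sub>L 'w::euclidean_space)) \<Rightarrow> nat \<Rightarrow>
     'v set \<Rightarrow> ennreal" where
  "omega A k V = (SUP u\<in>test_fields A k. weak_L1 u / L1_dist u V)"

definition sphere_prob :: "'v::euclidean_space measure \<Rightarrow> bool" where
  "sphere_prob \<nu> \<longleftrightarrow> prob_space \<nu> \<and> sets \<nu> = sets (restrict_space borel (sphere 0 1))"

definition barycenter :: "'v::euclidean_space measure \<Rightarrow> 'v" where
  "barycenter \<nu> = (LINT X|\<nu>. X)"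

definition Var :: "'v::euclidean_space measure \<Rightarrow> real" where
  "Var \<nu> = (LINT X|\<nu>. (norm (X - barycenter \<nu>))\<^sup>2)"

end

theory Submission
  imports Defs
begin

text \<open>
  Write \<open>\<omega>\<close> for the weak-type constant of the line \<open>l\<close> through the barycenter \<open>X\<^sub>0\<close>.  The heart of the
  matter is the inequality \<open>|X\<^sub>0| \<le> \<omega> \<integral> dist(X, l) d\<nu>\<close>.  Since \<open>dist(X, l)\<^sup>2 = 1 - (X \<bullet> e)\<^sup>2\<close> on the sphere,
  with \<open>e\<close> the direction of \<open>X\<^sub>0\<close>, Jensen's inequality turns it into \<open>|X\<^sub>0|\<^sup>2 \<le> \<omega>\<^sup>2 (1 - |X\<^sub>0|\<^sup>2)\<close>, which is the
  first bound because the variance is \<open>1 - |X\<^sub>0|\<^sup>2\<close>; the second follows from the assumed estimate of \<open>\<omega>\<close>.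

  To get that inequality (\<open>barycenter_bound\<close>), the hypothesis on \<open>\<nu>\<close> is tested with a single kind of
  function: for \<open>0 < t < |X\<^sub>0|\<close>, the quasiconvex envelope \<open>f\<close> of \<open>h = \<omega> dist(\<cdot>, l) + b\<close>, where \<open>b\<close> is a bump of
  height \<open>t\<close> that equals \<open>t\<close> on the ball of radius \<open>t\<close> around \<open>X\<^sub>0\<close> and vanishes at 0.  Then \<open>f(0) \<le> 0\<close>, the
  recession function of \<open>f\<close> is at most \<open>\<omega> dist(\<cdot>, l)\<close>, and \<open>f(X\<^sub>0) \<ge> t\<close> (\<open>env_lower_bound\<close>): for a competitor
  \<open>w\<close>, the weak-type inequality says that \<open>\<omega> \<integral> dist(w, l)\<close> is at least \<open>t\<close> times the measure of
  \<open>{|w| > t}\<close>, and off that set the bump contributes \<open>t\<close>.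

  The envelope is the infimum of \<open>\<integral> h(X + w)\<close> over fields \<open>w\<close> in the kernel of the operator that are
  compactly supported in the open unit cube.  Pasting rescaled competitors into small cells shows
  that it satisfies the quasiconvexity inequality for such fields (\<open>env_quasiconvex_core\<close>).  The passage
  to periodic fields is where constant rank enters.  A periodic field of mean zero in the kernel is
  uniformly close to a finite sum of waves with amplitudes in the kernel of the symbol
  (\<open>trig_poly_approx\<close>, \<open>wave_sum_conv\<close>).  By elimination, such an amplitude is the value at its
  frequency of a homogeneous polynomial \<open>P\<close> with values in the kernel of the symbol everywhere
  (\<open>polynomial_kernel\<close>), so the wave is \<open>P(D)\<close> of a scalar wave, and cutting off the scalar wave before
  applying \<open>P(D)\<close> gives a compactly supported field in the kernel that differs from the cut-off wave
  by an error vanishing at high frequency (\<open>localise_wave_sum\<close>, \<open>core_field_recovery\<close>).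
\<close>

section \<open>Smooth functions and iterated partial derivatives\<close>

lemma partial_deriv_eqI:
  assumes "\<And>x. (u has_derivative u' x) (at x)"
  shows "partial_deriv i u = (\<lambda>x. u' x (axis i 1))"
proof
  fix x
  have "u' x = frechet_derivative u (at x)"
    using frechet_derivative_at[OF assms] .
  then show "partial_deriv i u x = u' x (axis i 1)"
    by (simp add: partial_deriv_def)
qed

lemma has_derivative_partial_deriv:
  fixes u :: "real^'d::finite \<Rightarrow> 'v::euclidean_space"
  assumes "u differentiable (at x)"
  shows "(u has_derivative (\<lambda>h. \<Sum>i\<in>UNIV. h$i *\<^sub>R partial_deriv i u x)) (at x)"
proof -
  have d: "(u has_derivative frechet_derivative u (at x)) (at x)"
    using assms frechet_derivative_works by blast
  then interpret L: bounded_linear "frechet_derivative u (at x)"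
    by (rule has_derivative_bounded_linear)
  have "frechet_derivative u (at x) h = (\<Sum>i\<in>UNIV. h$i *\<^sub>R partial_deriv i u x)" for h :: "real^'d"
  proof -
    have "frechet_derivative u (at x) h
        = frechet_derivative u (at x) (\<Sum>i\<in>UNIV. h$i *\<^sub>R axis i 1)"
      using basis_expansion[of h] by (simp only: scalar_mult_eq_scaleR)
    then show ?thesis
      by (simp add: L.sum L.scaleR partial_deriv_def)
  qed
  then have "frechet_derivative u (at x) = (\<lambda>h. \<Sum>i\<in>UNIV. h$i *\<^sub>R partial_deriv i u x)"
    by (rule ext)
  with d show ?thesis by simp
qed

lemma smooth_differentiable: "smooth u \<Longrightarrow> u differentiable (at x)"
  unfolding smooth_def by (metis Cn.simps(2))

lemma smooth_partial_deriv: "smooth u \<Longrightarrow> smooth (partial_deriv i u)"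
  unfolding smooth_def by (metis Cn.simps(2))

lemma smooth_continuous_on: "smooth u \<Longrightarrow> continuous_on S u"
  unfolding smooth_def by (metis Cn.simps(1) continuous_on_subset subset_UNIV)

lemma smooth_has_derivative:
  "smooth u \<Longrightarrow> (u has_derivative (\<lambda>h. \<Sum>i\<in>UNIV. h$i *\<^sub>R partial_deriv i u x)) (at x)"
  by (intro has_derivative_partial_deriv smooth_differentiable)

text \<open>Smoothness is coinductive: a family of differentiable functions that is stable under
  partial derivatives consists of smooth functions.  Every closure property below is an instance,
  with the family closed up under sums where the product rule produces them.\<close>

lemma smooth_coinduct:
  assumes "u \<in> S"
    and "\<And>v x. v \<in> S \<Longrightarrow> v differentiable (at x)"
    and "\<And>v i. v \<in> S \<Longrightarrow> partial_deriv i v \<in> S"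
  shows "smooth u"
proof -
  have "Cn n v" if "v \<in> S" for n v
    using that
  proof (induction n arbitrary: v)
    case 0
    then show ?case
      using assms(2) by (auto simp: continuous_on_eq_continuous_at intro: differentiable_imp_continuous_within)
  next
    case (Suc n)
    then show ?case using assms(2,3) by auto
  qed
  then show ?thesis using assms(1) by (simp add: smooth_def)
qed

lemma partial_deriv_add_differentiable:
  assumes "\<And>x. u differentiable (at x)" "\<And>x. v differentiable (at x)"
  shows "partial_deriv i (\<lambda>x. u x + v x) = (\<lambda>x. partial_deriv i u x + partial_deriv i v x)"
  by (subst partial_deriv_eqI[OF has_derivative_add[OF has_derivative_partial_deriv[OF assms(1)]
        has_derivative_partial_deriv[OF assms(2)]]])
     (simp add: axis_def if_distrib[of "\<lambda>c. c *\<^sub>R _"] cong: if_cong)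

lemma partial_deriv_add:
  assumes "smooth u" "smooth v"
  shows "partial_deriv i (\<lambda>x. u x + v x) = (\<lambda>x. partial_deriv i u x + partial_deriv i v x)"
  using assms by (intro partial_deriv_add_differentiable smooth_differentiable)

lemma smooth_add:
  assumes "smooth u" "smooth v"
  shows "smooth (\<lambda>x. u x + v x)"
proof (rule smooth_coinduct[where S = "{\<lambda>x. u x + v x | u v. smooth u \<and> smooth v}"])
  show "(\<lambda>x. u x + v x) \<in> {\<lambda>x. u x + v x | u v. smooth u \<and> smooth v}" using assms by blast
next
  fix w x assume "w \<in> {\<lambda>x. u x + v x | u v. smooth u \<and> smooth v}"
  then obtain u v where "w = (\<lambda>x. u x + v x)" "smooth u" "smooth v" by blast
  then show "w differentiable at x" by (simp add: differentiable_add smooth_differentiable)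
next
  fix w i assume "w \<in> {\<lambda>x. u x + v x | u v. smooth u \<and> smooth v}"
  then obtain u v where "w = (\<lambda>x. u x + v x)" "smooth u" "smooth v" by blast
  then show "partial_deriv i w \<in> {\<lambda>x. u x + v x | u v. smooth u \<and> smooth v}"
    using partial_deriv_add smooth_partial_deriv by blast
qed

lemma partial_deriv_linear:
  assumes "bounded_linear L" "smooth u"
  shows "partial_deriv i (\<lambda>x. L (u x)) = (\<lambda>x. L (partial_deriv i u x))"
  by (subst partial_deriv_eqI[OF bounded_linear.has_derivative[OF assms(1) smooth_has_derivative[OF assms(2)]]])
     (simp add: axis_def if_distrib[of "\<lambda>c. c *\<^sub>R _"] cong: if_cong)

lemma smooth_linear:
  assumes L: "bounded_linear L" and "smooth u"
  shows "smooth (\<lambda>x. L (u x))"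
proof (rule smooth_coinduct[where S = "{\<lambda>x. L (u x) | u. smooth u}"])
  show "(\<lambda>x. L (u x)) \<in> {\<lambda>x. L (u x) | u. smooth u}" using assms by blast
next
  fix v x assume "v \<in> {\<lambda>x. L (u x) | u. smooth u}"
  then obtain u where "v = (\<lambda>x. L (u x))" "smooth u" by blast
  then show "v differentiable at x"
    using bounded_linear.has_derivative[OF L smooth_has_derivative] unfolding differentiable_def by blast
next
  fix v i assume "v \<in> {\<lambda>x. L (u x) | u. smooth u}"
  then show "partial_deriv i v \<in> {\<lambda>x. L (u x) | u. smooth u}"
    using partial_deriv_linear[OF L] smooth_partial_deriv by blast
qed

lemmas smooth_scaleR = smooth_linear[OF bounded_linear_scaleR_right]

lemma partial_deriv_const: "partial_deriv i (\<lambda>x. c) = (\<lambda>x. 0)"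
  by (subst partial_deriv_eqI[OF has_derivative_const]) simp

lemma smooth_const: "smooth (\<lambda>x :: real^'d::finite. c :: 'v::euclidean_space)"
proof (rule smooth_coinduct[where S = "range (\<lambda>c x. c)"])
  fix v :: "real^'d \<Rightarrow> 'v" and i :: 'd assume "v \<in> range (\<lambda>c x. c)"
  then show "partial_deriv i v \<in> range (\<lambda>c x. c)"
    by (auto simp: partial_deriv_const)
qed auto

lemma smooth_sum:
  assumes "\<And>j. j \<in> J \<Longrightarrow> smooth (u j)"
  shows "smooth (\<lambda>x. \<Sum>j\<in>J. u j x)"
  using assms by (induction J rule: infinite_finite_induct) (auto intro: smooth_const smooth_add)

lemma partial_deriv_scaleR_fun:
  fixes a :: "real^'d::finite \<Rightarrow> real" and b :: "real^'d \<Rightarrow> 'v::euclidean_space"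
  assumes "smooth a" "smooth b"
  shows "partial_deriv i (\<lambda>x. a x *\<^sub>R b x)
    = (\<lambda>x. a x *\<^sub>R partial_deriv i b x + partial_deriv i a x *\<^sub>R b x)"
  by (subst partial_deriv_eqI[OF has_derivative_scaleR[OF smooth_has_derivative[OF assms(1)]
        smooth_has_derivative[OF assms(2)]]])
     (simp add: axis_def if_distrib[of "\<lambda>c. c *\<^sub>R _"] if_distrib[of "\<lambda>c. c * _"] cong: if_cong)

inductive_set scaleR_sums :: "(real^'d::finite \<Rightarrow> 'v::euclidean_space) set" where
  prod: "smooth a \<Longrightarrow> smooth b \<Longrightarrow> (\<lambda>x. a x *\<^sub>R b x) \<in> scaleR_sums"
| add: "u \<in> scaleR_sums \<Longrightarrow> v \<in> scaleR_sums \<Longrightarrow> (\<lambda>x. u x + v x) \<in> scaleR_sums"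

lemma smooth_scaleR_fun:
  fixes a :: "real^'d::finite \<Rightarrow> real" and b :: "real^'d \<Rightarrow> 'v::euclidean_space"
  assumes "smooth a" "smooth b"
  shows "smooth (\<lambda>x. a x *\<^sub>R b x)"
proof (rule smooth_coinduct[where S = scaleR_sums])
  have *: "(\<forall>x. v differentiable (at x)) \<and> (\<forall>i. partial_deriv i v \<in> scaleR_sums)"
    if "v \<in> scaleR_sums" for v :: "real^'d \<Rightarrow> 'v"
    using that
  proof induction
    case (prod a b)
    then show ?case
      using has_derivative_scaleR[OF smooth_has_derivative smooth_has_derivative, of a b]
      by (auto simp: partial_deriv_scaleR_fun differentiable_def smooth_partial_deriv
          intro!: scaleR_sums.intros)
  next
    case (add u v)
    then show ?case by (auto simp: partial_deriv_add_differentiable intro: scaleR_sums.intros)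
  qed
  show "v differentiable at x" "partial_deriv i v \<in> scaleR_sums"
    if "v \<in> scaleR_sums" for v :: "real^'d \<Rightarrow> 'v" and x i
    using *[OF that] by auto
qed (use assms in \<open>auto intro: scaleR_sums.intros\<close>)

lemma smooth_mult:
  fixes a b :: "real^'d::finite \<Rightarrow> real"
  shows "smooth a \<Longrightarrow> smooth b \<Longrightarrow> smooth (\<lambda>x. a x * b x)"
  using smooth_scaleR_fun[of a b] by simp

lemma smooth_prod:
  fixes a :: "'j \<Rightarrow> real^'d::finite \<Rightarrow> real"
  assumes "\<And>j. j \<in> J \<Longrightarrow> smooth (a j)"
  shows "smooth (\<lambda>x. \<Prod>j\<in>J. a j x)"
  using assms by (induction J rule: infinite_finite_induct) (auto intro: smooth_const smooth_mult)

lemma partial_deriv_affine: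
  assumes "smooth u"
  shows "partial_deriv i (\<lambda>x. u (c *\<^sub>R x + b)) = (\<lambda>x. c *\<^sub>R partial_deriv i u (c *\<^sub>R x + b))"
proof -
  have "((\<lambda>x. u (c *\<^sub>R x + b)) has_derivative (\<lambda>h. \<Sum>j\<in>UNIV. (c *\<^sub>R h)$j *\<^sub>R partial_deriv j u (c *\<^sub>R x + b))) (at x)" for x
    by (rule has_derivative_compose[of "\<lambda>x. c *\<^sub>R x + b" _ _ UNIV u, OF _ smooth_has_derivative[OF assms]])
       (auto intro!: derivative_eq_intros)
  then show ?thesis
    by (subst partial_deriv_eqI) (assumption, simp add: axis_def if_distrib[of "\<lambda>c. c *\<^sub>R _"] if_distrib[of "\<lambda>x. c * x"] cong: if_cong)
qed

lemma smooth_affine: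
  fixes u :: "real^'d::finite \<Rightarrow> 'v::euclidean_space"
  assumes "smooth u"
  shows "smooth (\<lambda>x. u (c *\<^sub>R x + b))"
proof -
  define S where "S = (\<lambda>u :: real^'d \<Rightarrow> 'v. \<lambda>x. u (c *\<^sub>R x + b)) ` {u. smooth u}"
  have "((\<lambda>x. w (c *\<^sub>R x + b)) has_derivative (\<lambda>h. \<Sum>j\<in>UNIV. (c *\<^sub>R h)$j *\<^sub>R partial_deriv j w (c *\<^sub>R x + b))) (at x)"
    if "smooth w" for w :: "real^'d \<Rightarrow> 'v" and x
    by (rule has_derivative_compose[of "\<lambda>x. c *\<^sub>R x + b" _ _ UNIV w, OF _ smooth_has_derivative[OF that]])
       (auto intro!: derivative_eq_intros)
  then have diff: "v differentiable (at x)" if "v \<in> S" for v x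
    using that unfolding S_def by (auto simp: differentiable_def)
  have pd: "partial_deriv i v \<in> S" if "v \<in> S" for v i
  proof -
    obtain w where w: "smooth w" "v = (\<lambda>x. w (c *\<^sub>R x + b))"
      using \<open>v \<in> S\<close> unfolding S_def by auto
    have "partial_deriv i v = (\<lambda>x. (\<lambda>y. c *\<^sub>R partial_deriv i w y) (c *\<^sub>R x + b))"
      unfolding w(2) by (simp add: partial_deriv_affine[OF w(1)])
    moreover have "smooth (\<lambda>y. c *\<^sub>R partial_deriv i w y)"
      by (intro smooth_scaleR smooth_partial_deriv w)
    ultimately show ?thesis
      unfolding S_def by (intro image_eqI[of _ _ "\<lambda>y. c *\<^sub>R partial_deriv i w y"]) simp_all
  qed
  have "(\<lambda>x. u (c *\<^sub>R x + b)) \<in> S"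
    unfolding S_def by (intro image_eqI[of _ _ u]) (simp_all add: assms)
  then show ?thesis using diff pd by (rule smooth_coinduct)
qed

definition D :: "'d list \<Rightarrow> (real^'d::finite \<Rightarrow> 'v::euclidean_space) \<Rightarrow> real^'d \<Rightarrow> 'v" where
  "D js u = foldr partial_deriv js u"

lemma D_Nil [simp]: "D [] u = u"
  and D_Cons [simp]: "D (j # js) u = partial_deriv j (D js u)"
  and D_append: "D (is @ js) u = D is (D js u)"
  by (simp_all add: D_def)

lemma smooth_D: "smooth u \<Longrightarrow> smooth (D js u)"
  by (induction js) (auto intro: smooth_partial_deriv)

lemma D_add:
  assumes "smooth u" "smooth v"
  shows "D js (\<lambda>x. u x + v x) = (\<lambda>x. D js u x + D js v x)"
  by (induction js) (simp_all add: partial_deriv_add smooth_D assms)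

lemma D_linear:
  assumes "bounded_linear L" "smooth u"
  shows "D js (\<lambda>x. L (u x)) = (\<lambda>x. L (D js u x))"
  by (induction js) (simp_all add: partial_deriv_linear smooth_D assms)

lemma D_zero: "D js (\<lambda>x. 0) = (\<lambda>x. 0)"
  by (induction js) (simp_all add: partial_deriv_const)

lemma D_sum:
  assumes "\<And>j. j \<in> J \<Longrightarrow> smooth (u j)"
  shows "D js (\<lambda>x. \<Sum>j\<in>J. u j x) = (\<lambda>x. \<Sum>j\<in>J. D js (u j) x)"
  using assms
  by (induction J rule: infinite_finite_induct) (auto simp: D_zero D_add smooth_sum)

lemma D_affine:
  assumes "smooth u"
  shows "D js (\<lambda>x. u (c *\<^sub>R x + b)) = (\<lambda>x. c ^ length js *\<^sub>R D js u (c *\<^sub>R x + b))"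
proof (induction js)
  case (Cons j js)
  have "partial_deriv j (\<lambda>x. c ^ length js *\<^sub>R D js u (c *\<^sub>R x + b))
     = (\<lambda>x. c ^ length js *\<^sub>R partial_deriv j (\<lambda>x. D js u (c *\<^sub>R x + b)) x)"
    by (rule partial_deriv_linear[OF bounded_linear_scaleR_right]) (intro smooth_affine smooth_D assms)
  then show ?case
    using Cons by (simp add: partial_deriv_affine smooth_D assms mult.commute[of c])
qed simp

text \<open>Multi-indices are written out as lists of coordinates, so that composing operators is
  appending lists; since no step below permutes a list, symmetry of second derivatives is never
  an issue.\<close>

definition indices_of :: "('d::finite \<Rightarrow> nat) \<Rightarrow> 'd list" where
  "indices_of \<gamma> = concat (map (\<lambda>i. replicate (\<gamma> i) i) (SOME is. distinct is \<and> set is = UNIV))"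

definition mpow :: "real^'d::finite \<Rightarrow> 'd list \<Rightarrow> real" where
  "mpow \<xi> js = (\<Prod>j\<leftarrow>js. \<xi> $ j)"

lemma mpow_simps [simp]: "mpow \<xi> [] = 1" "mpow \<xi> (j # js) = \<xi> $ j * mpow \<xi> js"
  and mpow_append: "mpow \<xi> (is @ js) = mpow \<xi> is * mpow \<xi> js"
  by (simp_all add: mpow_def)

lemma enumeration_of_indices: 
  defines "L \<equiv> (SOME is :: 'd::finite list. distinct is \<and> set is = UNIV)"
  shows "distinct L" "set L = UNIV"
proof -
  have "\<exists>is :: 'd list. distinct is \<and> set is = UNIV"
    using finite_distinct_list[OF finite_class.finite_UNIV] by blast
  from someI_ex[OF this] show "distinct L" "set L = UNIV"
    unfolding L_def by auto
qed

lemma multi_deriv_eq_D: "multi_deriv \<gamma> u = D (indices_of \<gamma>) u"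
proof -
  have rep: "D (replicate n i) v = (partial_deriv i ^^ n) v" for n i and v :: "real^'a \<Rightarrow> 'b"
    by (induction n) auto
  have "foldr (\<lambda>i. partial_deriv i ^^ \<gamma> i) L u = D (concat (map (\<lambda>i. replicate (\<gamma> i) i) L)) u" for L
    by (induction L) (auto simp: D_append rep)
  then show ?thesis unfolding multi_deriv_def indices_of_def by blast
qed

lemma length_indices_of: "length (indices_of \<gamma>) = (\<Sum>i\<in>UNIV. \<gamma> i)"
proof -
  have "length (concat (map (\<lambda>i. replicate (\<gamma> i) i) L)) = sum \<gamma> (set L)" if "distinct L" for L
    using that by (induction L) auto
  from this[OF enumeration_of_indices(1)] show ?thesis
    unfolding indices_of_def enumeration_of_indices(2) .
qed

lemma mpow_indices_of: "mpow \<xi> (indices_of \<gamma>) = (\<Prod>i\<in>UNIV. (\<xi> $ i) ^ \<gamma> i)"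
proof -
  have rep: "mpow \<xi> (replicate n i) = (\<xi> $ i) ^ n" for n i
    by (induction n) auto
  have "mpow \<xi> (concat (map (\<lambda>i. replicate (\<gamma> i) i) L)) = (\<Prod>i\<in>set L. (\<xi> $ i) ^ \<gamma> i)" if "distinct L" for L
    using that by (induction L) (auto simp: mpow_append rep)
  from this[OF enumeration_of_indices(1)] show ?thesis
    unfolding indices_of_def enumeration_of_indices(2) .
qed

lemma diff_op_eq_D:
  "diff_op A k u x = (\<Sum>\<gamma>\<in>multi_indices k. A \<gamma> (D (indices_of \<gamma>) u x))"
  by (simp add: diff_op_def multi_deriv_eq_D)

lemma symbol_eq_mpow:
  "symbol A k \<xi> = (\<Sum>\<gamma>\<in>multi_indices k. mpow \<xi> (indices_of \<gamma>) *\<^sub>R A \<gamma>)"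
  by (simp add: symbol_def mpow_indices_of)

lemma diff_op_add:
  assumes "smooth u" "smooth v"
  shows "diff_op A k (\<lambda>x. u x + v x) x = diff_op A k u x + diff_op A k v x"
  by (simp add: diff_op_eq_D D_add[OF assms] blinfun.add_right sum.distrib)

lemma diff_op_scaleR:
  assumes "smooth u"
  shows "diff_op A k (\<lambda>x. c *\<^sub>R u x) x = c *\<^sub>R diff_op A k u x"
  by (simp add: diff_op_eq_D D_linear[OF bounded_linear_scaleR_right assms] blinfun.scaleR_right
      scaleR_sum_right)

lemma diff_op_zero: "diff_op A k (\<lambda>x. 0) x = 0"
  by (simp add: diff_op_eq_D D_zero blinfun.zero_right)

lemma diff_op_sum:
  assumes "\<And>j. j \<in> J \<Longrightarrow> smooth (u j)"
  shows "diff_op A k (\<lambda>x. \<Sum>j\<in>J. u j x) x = (\<Sum>j\<in>J. diff_op A k (u j) x)"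
  using assms
  by (induction J rule: infinite_finite_induct) (auto simp: diff_op_zero diff_op_add smooth_sum)

lemma diff_op_affine:
  assumes "smooth u"
  shows "diff_op A k (\<lambda>x. u (c *\<^sub>R x + b)) x = c ^ k *\<^sub>R diff_op A k u (c *\<^sub>R x + b)"
  unfolding diff_op_eq_D scaleR_sum_right
  by (rule sum.cong)
     (auto simp: D_affine[OF assms] blinfun.scaleR_right length_indices_of multi_indices_def)

subsection \<open>Plane waves, cutoffs and truncation\<close>

lemma inner_axis_one [simp]: "(\<eta> :: real^'d::finite) \<bullet> axis i 1 = \<eta> $ i"
  by (simp add: inner_axis)

text \<open>With a phase in place of separate sines and cosines, each derivative of a plane wave
  only shifts the phase by a quarter turn.\<close>

lemma partial_deriv_cos:
  "partial_deriv i (\<lambda>x. c * cos (\<eta> \<bullet> x + \<theta>)) = (\<lambda>x. (c * \<eta> $ i) * cos (\<eta> \<bullet> x + (\<theta> + pi/2)))"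
proof -
  have "((\<lambda>x. c * cos (\<eta> \<bullet> x + \<theta>)) has_derivative (\<lambda>h. - c * sin (\<eta> \<bullet> x + \<theta>) * (\<eta> \<bullet> h))) (at x)" for x
    by (auto intro!: derivative_eq_intros)
  from partial_deriv_eqI[OF this] show ?thesis
    by (simp add: cos_add sin_add fun_eq_iff algebra_simps)
qed

lemma smooth_cos: "smooth (\<lambda>x. c * cos (\<eta> \<bullet> x + \<theta>))"
proof (rule smooth_coinduct[where S = "{\<lambda>x. c * cos (\<eta> \<bullet> x + \<theta>) | c \<theta>. True}"])
  fix v x assume "v \<in> {\<lambda>x. c * cos (\<eta> \<bullet> x + \<theta>) | c \<theta>. True}"
  then obtain c \<theta> where "v = (\<lambda>x. c * cos (\<eta> \<bullet> x + \<theta>))" by blast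
  moreover have "((\<lambda>x. c * cos (\<eta> \<bullet> x + \<theta>)) has_derivative (\<lambda>h. - c * sin (\<eta> \<bullet> x + \<theta>) * (\<eta> \<bullet> h))) (at x)"
    by (auto intro!: derivative_eq_intros)
  ultimately show "v differentiable at x"
    unfolding differentiable_def by blast
next
  fix v i assume "v \<in> {\<lambda>x. c * cos (\<eta> \<bullet> x + \<theta>) | c \<theta>. True}"
  then obtain c \<theta> where "v = (\<lambda>x. c * cos (\<eta> \<bullet> x + \<theta>))" by blast
  then show "partial_deriv i v \<in> {\<lambda>x. c * cos (\<eta> \<bullet> x + \<theta>) | c \<theta>. True}"
    by (simp only: partial_deriv_cos) blast
qed blast

lemma D_cos:
  "D js (\<lambda>x. cos (\<eta> \<bullet> x + \<theta>)) = (\<lambda>x. mpow \<eta> js * cos (\<eta> \<bullet> x + (\<theta> + length js * (pi/2))))"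
proof (induction js)
  case (Cons j js)
  have "\<theta> + real (length js) * (pi/2) + pi/2 = \<theta> + real (length (j # js)) * (pi/2)"
    by (simp add: algebra_simps add_divide_distrib)
  then show ?case
    by (simp only: D_Cons Cons.IH partial_deriv_cos mpow_simps mult.commute)
qed simp

lemma smooth_cos_scaleR: "smooth (\<lambda>x. cos (\<eta> \<bullet> x + \<theta>) *\<^sub>R a)"
  using smooth_scaleR_fun[OF smooth_cos[of 1 \<eta> \<theta>] smooth_const] by simp

lemma D_cos_scaleR:
  "D js (\<lambda>x. cos (\<eta> \<bullet> x + \<theta>) *\<^sub>R a)
    = (\<lambda>x. (mpow \<eta> js * cos (\<eta> \<bullet> x + (\<theta> + length js * (pi/2)))) *\<^sub>R a)"
  using D_linear[OF bounded_linear_scaleR_left smooth_cos[of 1 \<eta> \<theta>], of js a] by (simp add: D_cos)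

lemma diff_op_cos:
  "diff_op A k (\<lambda>x. cos (\<eta> \<bullet> x + \<theta>) *\<^sub>R a) x
    = cos (\<eta> \<bullet> x + (\<theta> + real k * (pi/2))) *\<^sub>R blinfun_apply (symbol A k \<eta>) a"
  unfolding diff_op_eq_D symbol_eq_mpow blinfun.sum_left scaleR_sum_right
  by (rule sum.cong)
     (auto simp: D_cos_scaleR blinfun.scaleR_right blinfun.scaleR_left length_indices_of multi_indices_def)

text \<open>The functions \<open>q(1/s) exp(-1/s)\<close>, extended by 0 to the left half-line, with \<open>q\<close> a polynomial: a
  family of flat functions that is stable under differentiation.\<close>

definition flat :: "real poly \<Rightarrow> real \<Rightarrow> real" where
  "flat q s = (if s \<le> 0 then 0 else poly q (1/s) * exp (- (1/s)))"

lemma tendsto_poly_exp: "((\<lambda>y. poly q y * exp (- y)) \<longlongrightarrow> (0::real)) at_top"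
proof (induction q)
  case (pCons a q)
  have "((\<lambda>y. poly q y * y * exp (- y)) \<longlongrightarrow> (0::real)) at_top"
  proof -
    have "((\<lambda>y. y ^ n / exp y) \<longlongrightarrow> (0::real)) at_top" for n
      by (rule tendsto_power_div_exp_0)
    then have "((\<lambda>y. \<Sum>i\<le>degree q. coeff q i * (y ^ (Suc i) / exp y)) \<longlongrightarrow> (\<Sum>i\<le>degree q. coeff q i * 0)) at_top"
      by (intro tendsto_intros)
    then show ?thesis
      by (simp add: poly_altdef sum_distrib_right sum_distrib_left exp_minus field_simps)
  qed
  moreover have "((\<lambda>y. a * (y ^ 0 / exp y)) \<longlongrightarrow> a * 0) at_top"
    by (intro tendsto_intros tendsto_power_div_exp_0)
  ultimately show ?case
    using tendsto_add[of "\<lambda>y. poly q y * y * exp (- y)" 0 at_top "\<lambda>y. a * (y ^ 0 / exp y)" "a * 0"]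
    by (simp add: algebra_simps exp_minus field_simps)
qed simp

lemma flat_has_derivative:
  "(flat q has_real_derivative flat ([:0,0,1:] * (q - pderiv q)) s) (at s)"
proof -
  consider "s > 0" | "s < 0" | "s = 0" by linarith
  then show ?thesis
  proof cases
    case 1
    have "((\<lambda>s. poly q (1/s) * exp (- (1/s))) has_real_derivative flat ([:0,0,1:] * (q - pderiv q)) s) (at s)"
      using 1 by (auto intro!: derivative_eq_intros simp: flat_def field_simps power2_eq_square)
    then show ?thesis
      by (rule has_field_derivative_transform_within_open[where S="{0<..}"]) (use 1 in \<open>auto simp: flat_def\<close>)
  next
    case 2
    have "((\<lambda>s. 0) has_real_derivative flat ([:0,0,1:] * (q - pderiv q)) s) (at s)"
      using 2 by (simp add: flat_def)
    then show ?thesis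
      by (rule has_field_derivative_transform_within_open[where S="{..<0}"]) (use 2 in \<open>auto simp: flat_def\<close>)
  next
    case 3
    have r: "((\<lambda>s. poly ([:0,1:] * q) (1/s) * exp (- (1/s))) \<longlongrightarrow> 0) (at_right 0)"
      using filterlim_compose[OF tendsto_poly_exp[of "[:0,1:] * q"] filterlim_inverse_at_top_right]
      by (simp add: inverse_eq_divide)
    have "((\<lambda>s. flat q s / s) \<longlongrightarrow> 0) (at 0)"
    proof (rule filterlim_split_at)
      show "((\<lambda>s. flat q s / s) \<longlongrightarrow> 0) (at_left 0)"
        by (rule tendsto_eventually) (auto simp: flat_def eventually_at_filter)
      show "((\<lambda>s. flat q s / s) \<longlongrightarrow> 0) (at_right 0)"
        by (rule Lim_transform_eventually[OF r]) (auto simp: flat_def eventually_at_filter)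
    qed
    then show ?thesis
      using 3 by (simp add: has_field_derivative_iff flat_def)
  qed
qed

lemma has_derivative_flat_compose:
  assumes "smooth a"
  shows "((\<lambda>x. flat q (a x)) has_derivative
    (\<lambda>h. flat ([:0,0,1:] * (q - pderiv q)) (a x) * (\<Sum>i\<in>UNIV. h$i *\<^sub>R partial_deriv i a x))) (at x)"
  using has_derivative_compose[of a _ x UNIV "flat q", OF smooth_has_derivative[OF assms]
      flat_has_derivative[unfolded has_field_derivative_def]] by (simp add: mult.commute)

inductive_set flat_sums :: "(real^'d::finite \<Rightarrow> real) set" where
  prod: "smooth a \<Longrightarrow> smooth b \<Longrightarrow> (\<lambda>x. b x * flat q (a x)) \<in> flat_sums"
| add: "u \<in> flat_sums \<Longrightarrow> v \<in> flat_sums \<Longrightarrow> (\<lambda>x. u x + v x) \<in> flat_sums"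

lemma smooth_flat:
  fixes a :: "real^'d::finite \<Rightarrow> real"
  assumes "smooth a"
  shows "smooth (\<lambda>x. flat q (a x))"
proof (rule smooth_coinduct[where S = flat_sums])
  have *: "(\<forall>x. v differentiable (at x)) \<and> (\<forall>i. partial_deriv i v \<in> flat_sums)"
    if "v \<in> flat_sums" for v :: "real^'d \<Rightarrow> real"
    using that
  proof induction
    case (prod a b q)
    let ?q = "[:0,0,1:] * (q - pderiv q)"
    note d = has_derivative_mult[OF smooth_has_derivative[OF prod(2)] has_derivative_flat_compose[OF prod(1), of q]]
    have "partial_deriv i (\<lambda>x. b x * flat q (a x))
      = (\<lambda>x. (b x * partial_deriv i a x) * flat ?q (a x) + partial_deriv i b x * flat q (a x))" for i
      by (subst partial_deriv_eqI[OF d])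
         (simp add: axis_def if_distrib[of "\<lambda>c. c * _"] cong: if_cong,
          simp add: fun_eq_iff mult_ac)
    moreover have "\<dots> i \<in> flat_sums" for i
      by (intro flat_sums.intros smooth_mult smooth_partial_deriv prod)
    ultimately show ?case using d unfolding differentiable_def by auto
  next
    case (add u v)
    then show ?case by (auto simp: partial_deriv_add_differentiable intro: flat_sums.intros)
  qed
  show "v differentiable at x" "partial_deriv i v \<in> flat_sums"
    if "v \<in> flat_sums" for v :: "real^'d \<Rightarrow> real" and x i
    using *[OF that] by auto
  show "(\<lambda>x. flat q (a x)) \<in> flat_sums"
    using flat_sums.prod[OF assms smooth_const[of 1]] by simp
qed

lemma truncate_derivative:
  fixes u :: "real^'d::finite \<Rightarrow> 'v::euclidean_space"
  assumes u: "smooth u" and C: "closed C" and O: "open U" "frontier C \<subseteq> U" "\<And>x. x \<in> U \<Longrightarrow> u x = 0"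
  shows "(\<lambda>x. if x \<in> C then u x else 0) differentiable (at x)"
    and "partial_deriv i (\<lambda>x. if x \<in> C then u x else 0) = (\<lambda>x. if x \<in> C then partial_deriv i u x else 0)"
    and "\<And>x. x \<in> U \<Longrightarrow> partial_deriv i u x = 0"
proof -
  have z: "(u has_derivative (\<lambda>h. 0)) (at x)" if "x \<in> U" for x
    by (rule has_derivative_transform_within_open[OF has_derivative_const O(1) that]) (simp add: O(3))
  show pz: "partial_deriv i u x = 0" if "x \<in> U" for x i
    using frechet_derivative_at[OF z[OF that]] unfolding partial_deriv_def by metis
  have d: "((\<lambda>x. if x \<in> C then u x else 0) has_derivative
      (\<lambda>h. if x \<in> C then \<Sum>i\<in>UNIV. h$i *\<^sub>R partial_deriv i u x else 0)) (at x)" for x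
  proof -
    consider "x \<in> interior C" | "x \<in> U" | "x \<notin> C"
      using O(2) C by (auto simp: frontier_def closure_closed)
    then show ?thesis
    proof cases
      case 1
      then have "x \<in> C" using interior_subset by blast
      have "((\<lambda>x. if x \<in> C then u x else 0) has_derivative (\<lambda>h. \<Sum>i\<in>UNIV. h$i *\<^sub>R partial_deriv i u x)) (at x)"
        by (rule has_derivative_transform_within_open[OF smooth_has_derivative[OF u] open_interior 1])
           (use interior_subset in auto)
      then show ?thesis using \<open>x \<in> C\<close> by simp
    next
      case 2
      have "((\<lambda>x. if x \<in> C then u x else 0) has_derivative (\<lambda>h. 0)) (at x)"
        by (rule has_derivative_transform_within_open[OF has_derivative_const O(1) 2]) (simp add: O(3))
      then show ?thesis using pz[OF 2] by (simp cong: if_cong)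
    next
      case 3
      have "((\<lambda>x. if x \<in> C then u x else 0) has_derivative (\<lambda>h. 0)) (at x)"
        by (rule has_derivative_transform_within_open[OF has_derivative_const, of "- C"])
           (use 3 C in auto)
      then show ?thesis using 3 by simp
    qed
  qed
  then show "(\<lambda>x. if x \<in> C then u x else 0) differentiable (at x)"
    unfolding differentiable_def by blast
  show "partial_deriv i (\<lambda>x. if x \<in> C then u x else 0) = (\<lambda>x. if x \<in> C then partial_deriv i u x else 0)"
    by (subst partial_deriv_eqI[OF d])
       (auto simp: fun_eq_iff axis_def if_distrib[of "\<lambda>c. c *\<^sub>R _"] cong: if_cong)
qed

text \<open>A smooth field that vanishes near the boundary of a closed set may be set to zero outside it; this
  commutes with all derivatives.\<close>

lemma smooth_truncate:
  fixes u :: "real^'d::finite \<Rightarrow> 'v::euclidean_space"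
  assumes u: "smooth u" and C: "closed C" and O: "open U" "frontier C \<subseteq> U" "\<And>x. x \<in> U \<Longrightarrow> u x = 0"
  shows "smooth (\<lambda>x. if x \<in> C then u x else 0)"
    and "D js (\<lambda>x. if x \<in> C then u x else 0) = (\<lambda>x. if x \<in> C then D js u x else 0)"
proof -
  show "smooth (\<lambda>x. if x \<in> C then u x else 0)"
  proof (rule smooth_coinduct[where S = "{\<lambda>x. if x \<in> C then u x else 0 | u. smooth u \<and> (\<forall>x\<in>U. u x = 0)}"])
    fix v :: "real^'d \<Rightarrow> 'v" and x i
    assume "v \<in> {\<lambda>x. if x \<in> C then u x else 0 | u. smooth u \<and> (\<forall>x\<in>U. u x = 0)}"
    then obtain u where v: "v = (\<lambda>x. if x \<in> C then u x else 0)" "smooth u" "\<And>x. x\<in>U \<Longrightarrow> u x = 0"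
      by blast
    note t = truncate_derivative[OF v(2) C O(1,2) v(3)]
    show "v differentiable (at x)" unfolding v using t by blast
    show "partial_deriv i v \<in> {\<lambda>x. if x \<in> C then u x else 0 | u. smooth u \<and> (\<forall>x\<in>U. u x = 0)}"
      unfolding v using t(2,3) smooth_partial_deriv[OF v(2)] by blast
  qed (use assms in blast)
  have "(\<forall>x\<in>U. D js u x = 0) \<and> D js (\<lambda>x. if x \<in> C then u x else 0) = (\<lambda>x. if x \<in> C then D js u x else 0)" for js
  proof (induction js)
    case (Cons j js)
    then show ?case
      using truncate_derivative[OF smooth_D[OF u] C O(1,2), of js] by auto
  qed (use O(3) in auto)
  then show "D js (\<lambda>x. if x \<in> C then u x else 0) = (\<lambda>x. if x \<in> C then D js u x else 0)" by blast
qed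

section \<open>Periodic functions on the unit cube\<close>

abbreviation unit_cube :: "(real^'d::finite) set" where
  "unit_cube \<equiv> cbox 0 (\<chi> i. 1)"

lemma mem_unit_cube: "x \<in> unit_cube \<longleftrightarrow> (\<forall>i. 0 \<le> x $ i \<and> x $ i \<le> 1)"
  by (simp add: mem_box_cart)

lemmas HK_integral_add = Henstock_Kurzweil_Integration.integral_add

lemma content_unit_cube [simp]: "measure lborel (unit_cube :: (real^'d::finite) set) = 1"
proof -
  have "(unit_cube :: (real^'d) set) \<noteq> {}"
    by (metis empty_iff mem_unit_cube order_refl zero_index zero_le_one)
  then show ?thesis by (simp add: content_cbox_cart)
qed

subsection \<open>Subdivision into small cubes\<close>

definition grid :: "nat \<Rightarrow> (real^'d::finite) set" where
  "grid N = (\<lambda>g. \<chi> i. real (g i)) ` (UNIV \<rightarrow>\<^sub>E {..<N})"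

lemma grid_iff: "z \<in> grid N \<longleftrightarrow> (\<forall>i. \<exists>n<N. z $ i = real n)"
proof
  assume "\<forall>i. \<exists>n<N. z $ i = real n"
  then obtain g where "\<forall>i. g i < N \<and> z $ i = real (g i)" by metis
  then show "z \<in> grid N"
    unfolding grid_def by (intro image_eqI[of _ _ g]) (auto simp: vec_eq_iff)
qed (auto simp: grid_def PiE_def)

lemma finite_grid [simp]: "finite (grid N)"
  unfolding grid_def by (intro finite_imageI finite_PiE) auto

lemma card_grid: "card (grid N :: (real^'d::finite) set) = N ^ CARD('d)"
proof -
  have "inj_on (\<lambda>g. \<chi> i. real (g i)) (UNIV \<rightarrow>\<^sub>E {..<N} :: ('d \<Rightarrow> nat) set)"
    by (auto simp: inj_on_def vec_eq_iff)
  then show ?thesis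
    by (simp add: grid_def card_image card_PiE)
qed

definition cell :: "nat \<Rightarrow> real^'d::finite \<Rightarrow> (real^'d) set" where
  "cell N z = cbox ((1/N) *\<^sub>R z) ((1/N) *\<^sub>R (z + (\<chi> i. 1)))"

lemma mem_cell:
  assumes "N \<ge> 1"
  shows "x \<in> cell N z \<longleftrightarrow> real N *\<^sub>R x - z \<in> unit_cube"
  unfolding cell_def mem_unit_cube using assms by (auto simp: mem_box_cart field_simps)

lemma interior_cell:
  assumes "N \<ge> 1"
  shows "x \<in> interior (cell N z) \<longleftrightarrow> real N *\<^sub>R x - z \<in> box 0 (\<chi> i. 1)"
  unfolding cell_def interior_cbox using assms by (auto simp: mem_box_cart field_simps)

lemma cell_disjoint:
  assumes N: "N \<ge> 1" and z: "z \<in> grid N" "z' \<in> grid N" "z \<noteq> z'"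
    and x: "real N *\<^sub>R x - z \<in> unit_cube"
  shows "real N *\<^sub>R x - z' \<notin> box 0 (\<chi> i. 1)"
proof
  assume x': "real N *\<^sub>R x - z' \<in> box 0 (\<chi> i. 1)"
  have "z $ i = z' $ i" for i
  proof -
    obtain n n' where n: "z $ i = real n" "z' $ i = real n'"
      using z unfolding grid_iff by metis
    have "0 \<le> N * x $ i - n" "N * x $ i - n \<le> 1" "0 < N * x $ i - n'" "N * x $ i - n' < 1"
      using x x' unfolding mem_box_cart n[symmetric] by (simp_all del: One_nat_def)
    then have "real n < real n' + 1" "real n' < real n + 1" by linarith+
    then have "n = n'" by linarith
    then show ?thesis using n by simp
  qed
  then show False using z(3) by (simp add: vec_eq_iff)
qed

lemma cell_nonempty: "(1/N) *\<^sub>R z \<in> cell N z"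
  by (auto simp: cell_def mem_box_cart divide_simps)

lemma interior_cell_nonempty:
  assumes "N \<ge> 1"
  shows "(1/N) *\<^sub>R (z + (\<chi> i. 1/2)) \<in> interior (cell N z)"
  using assms by (simp add: interior_cell mem_box_cart)

lemma cells_cover:
  assumes N: "N \<ge> 1" and x: "x \<in> (unit_cube :: (real^'d::finite) set)"
  shows "\<exists>z\<in>grid N. x \<in> cell N z"
proof -
  define g where "g i = min (N - 1) (nat \<lfloor>real N * x $ i\<rfloor>)" for i
  define z :: "real^'d" where "z = (\<chi> i. real (g i))"
  have "z \<in> grid N"
    unfolding grid_iff z_def g_def using N by (auto intro!: exI[of _ "min (N - 1) _"])
  moreover have "0 \<le> N * x $ i - z $ i \<and> N * x $ i - z $ i \<le> 1" for i
  proof -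
    have x01: "0 \<le> x $ i" "x $ i \<le> 1" using x by (auto simp: mem_unit_cube)
    then have N0: "0 \<le> real N * x $ i" "real N * x $ i \<le> real N" by (auto simp: mult_left_le)
    show ?thesis
    proof (cases "nat \<lfloor>real N * x $ i\<rfloor> \<le> N - 1")
      case True
      then have "z $ i = of_int \<lfloor>real N * x $ i\<rfloor>"
        using N0 by (simp add: z_def g_def)
      then show ?thesis by linarith
    next
      case False
      then have "z $ i = real N - 1" using N by (simp add: z_def g_def min_def of_nat_diff)
      moreover have "real N - 1 \<le> real N * x $ i" using False N0 N by linarith
      ultimately show ?thesis using N0 by linarith
    qed
  qed
  then have "x \<in> cell N z" using N by (simp add: mem_cell mem_unit_cube)
  ultimately show ?thesis by blast
qed

lemma cell_subset:
  assumes N: "N \<ge> 1" and z: "z \<in> grid N"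
  shows "cell N z \<subseteq> unit_cube"
proof
  fix x assume "x \<in> cell N z"
  then have x: "0 \<le> N * x $ i - z $ i" "N * x $ i - z $ i \<le> 1" for i
    using N by (auto simp: mem_cell mem_unit_cube)
  have "0 \<le> x $ i \<and> x $ i \<le> 1" for i
  proof -
    obtain n where n: "n < N" "z $ i = real n" using z unfolding grid_iff by metis
    then have "0 \<le> real N * x $ i" "real N * x $ i \<le> real N * 1"
      using x[of i] nat_less_real_le[of n N] by linarith+
    then show ?thesis using N by (simp add: zero_le_mult_iff)
  qed
  then show "x \<in> unit_cube" by (simp add: mem_unit_cube)
qed

lemma integral_unit_cube_grid:
  fixes f :: "real^'d::finite \<Rightarrow> 'b::euclidean_space"
  assumes N: "N \<ge> 1" and f: "continuous_on unit_cube f"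
  shows "integral unit_cube f
    = (1 / real N ^ CARD('d)) *\<^sub>R (\<Sum>z\<in>grid N. integral unit_cube (\<lambda>y. f ((1/N) *\<^sub>R (y + z))))"
proof -
  have inj: "inj_on (cell N) (grid N :: (real^'d) set)"
  proof (rule inj_onI)
    fix z z' :: "real^'d" assume z: "z \<in> grid N" "z' \<in> grid N" "cell N z = cell N z'"
    define x where "x = (1/real N) *\<^sub>R (z + (\<chi> i. 1/2))"
    have "x \<in> interior (cell N z)" unfolding x_def by (rule interior_cell_nonempty[OF N])
    then have "x \<in> cell N z" "x \<in> interior (cell N z')" using z(3) interior_subset by auto
    then show "z = z'"
      using cell_disjoint[OF N z(1,2)] by (auto simp: mem_cell[OF N] interior_cell[OF N])
  qed
  have div: "cell N ` grid N division_of (unit_cube :: (real^'d) set)"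
  proof (rule division_ofI)
    fix K1 K2 :: "(real^'d) set" assume K: "K1 \<in> cell N ` grid N" "K2 \<in> cell N ` grid N" "K1 \<noteq> K2"
    then obtain z z' where z: "z \<in> grid N" "z' \<in> grid N" "K1 = cell N z" "K2 = cell N z'" "z \<noteq> z'"
      by auto
    have "x \<notin> interior K2" if "x \<in> interior K1" for x
      using that cell_disjoint[OF N z(1,2,5), of x] interior_subset[of K1] z(3,4)
      by (auto simp: mem_cell[OF N] interior_cell[OF N])
    then show "interior K1 \<inter> interior K2 = {}" by blast
  next
    show "\<Union> (cell N ` grid N) = (unit_cube :: (real^'d) set)"
      using cells_cover[OF N] cell_subset[OF N] by blast
  qed (use cell_subset[OF N] cell_nonempty[of N] in \<open>auto simp: cell_def\<close>)
  have cellint: "integral (cell N z) f = (1 / real N ^ CARD('d)) *\<^sub>R integral unit_cube (\<lambda>y. f ((1/N) *\<^sub>R (y + z)))"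
    if "z \<in> grid N" for z
  proof -
    have "f integrable_on cell N z"
      unfolding cell_def by (rule integrable_continuous)
        (use continuous_on_subset[OF f] cell_subset[OF N that] in \<open>auto simp: cell_def\<close>)
    then have "(f has_integral integral (cell N z) f) (cell N z)" by blast
    then have "((\<lambda>y. f ((1/N) *\<^sub>R y + (1/N) *\<^sub>R z)) has_integral
       (integral (cell N z) f /\<^sub>R (1/N) ^ DIM(real^'d)))
       (cbox (((1/N) *\<^sub>R z - (1/N) *\<^sub>R z) /\<^sub>R (1/N)) (((1/N) *\<^sub>R (z + (\<chi> i. 1)) - (1/N) *\<^sub>R z) /\<^sub>R (1/N)))"
      unfolding cell_def using N by (intro has_integral_affinity') auto
    moreover have "((1/N) *\<^sub>R (z + (\<chi> i. 1)) - (1/N) *\<^sub>R z) /\<^sub>R (1/N) = (\<chi> i. 1)"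
      using N by (simp add: vec_eq_iff field_simps)
    ultimately have "((\<lambda>y. f ((1/N) *\<^sub>R (y + z))) has_integral
       (real N ^ CARD('d) *\<^sub>R integral (cell N z) f)) unit_cube"
      by (simp add: scaleR_add_right power_one_over)
    then have "integral unit_cube (\<lambda>y. f ((1/N) *\<^sub>R (y + z))) = real N ^ CARD('d) *\<^sub>R integral (cell N z) f"
      by (rule integral_unique)
    then show ?thesis using N by simp
  qed
  have "integral unit_cube f = sum (\<lambda>K. integral K f) (cell N ` grid N)"
    by (rule integral_combine_division_topdown[OF integrable_continuous[OF f] div])
  also have "\<dots> = (\<Sum>z\<in>grid N. integral (cell N z) f)"
    by (simp add: sum.reindex[OF inj])
  finally show ?thesis by (simp add: cellint scaleR_sum_right)
qed

subsection \<open>Translation and dilation invariance of the mean\<close>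

definition lattice_vec :: "real^'d::finite \<Rightarrow> bool" where
  "lattice_vec z \<longleftrightarrow> (\<forall>i. z $ i \<in> \<int>)"

lemma periodic_nat:
  assumes "torus_periodic u"
  shows "u (x + real n *\<^sub>R axis i 1) = u x"
proof (induction n)
  case (Suc n)
  have "u (x + real (Suc n) *\<^sub>R axis i 1) = u ((x + real n *\<^sub>R axis i 1) + axis i 1)"
    by (simp add: algebra_simps)
  also have "\<dots> = u (x + real n *\<^sub>R axis i 1)"
    using assms unfolding torus_periodic_def by blast
  finally show ?case using Suc by simp
qed simp

lemma periodic_int:
  assumes "torus_periodic u"
  shows "u (x + of_int n *\<^sub>R axis i 1) = u x"
proof (cases "n \<ge> 0")
  case True
  then show ?thesis using periodic_nat[OF assms, of x "nat n" i] by simp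
next
  case False
  then show ?thesis
    using periodic_nat[OF assms, of "x + of_int n *\<^sub>R axis i 1" "nat (-n)" i] by (simp add: algebra_simps)
qed

lemma vec_sum_axis: "(\<Sum>i\<in>UNIV. (z $ i) *\<^sub>R axis i 1) = (z :: real^'d::finite)"
  using basis_expansion[of z] by (simp only: scalar_mult_eq_scaleR)

lemma periodic_lattice:
  assumes u: "torus_periodic u" and z: "lattice_vec z"
  shows "u (x + z) = u x"
proof -
  have "u (x + (\<Sum>i\<in>S. (z $ i) *\<^sub>R axis i 1)) = u x" if "finite S" for S
    using that
  proof (induction S)
    case (insert j S)
    obtain n where n: "z $ j = of_int n" using z unfolding lattice_vec_def by (metis Ints_cases)
    have "u (x + (\<Sum>i\<in>insert j S. (z $ i) *\<^sub>R axis i 1))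
      = u ((x + (\<Sum>i\<in>S. (z $ i) *\<^sub>R axis i 1)) + of_int n *\<^sub>R axis j 1)"
      using insert by (simp add: n algebra_simps)
    then show ?case using insert periodic_int[OF u] by simp
  qed simp
  from this[of UNIV] show ?thesis by (simp add: vec_sum_axis)
qed

lemma cbox_cut:
  fixes a b :: "real^'d::finite"
  shows "cbox a b \<inter> {x. x \<bullet> axis i 1 \<le> c} = cbox a (\<chi> j. if j = i then min (b $ j) c else b $ j)"
    and "cbox a b \<inter> {x. x \<bullet> axis i 1 \<ge> c} = cbox (\<chi> j. if j = i then max (a $ j) c else a $ j) b"
proof -
  have "(\<forall>j. x $ j \<le> (if j = i then min (b $ j) c else b $ j)) \<longleftrightarrow> (\<forall>j. x $ j \<le> b $ j) \<and> x $ i \<le> c"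
    "(\<forall>j. (if j = i then max (a $ j) c else a $ j) \<le> x $ j) \<longleftrightarrow> (\<forall>j. a $ j \<le> x $ j) \<and> c \<le> x $ i" for x :: "real^'d"
    by (metis min.bounded_iff) (metis max.bounded_iff)
  then show "cbox a b \<inter> {x. x \<bullet> axis i 1 \<le> c} = cbox a (\<chi> j. if j = i then min (b $ j) c else b $ j)"
    and "cbox a b \<inter> {x. x \<bullet> axis i 1 \<ge> c} = cbox (\<chi> j. if j = i then max (a $ j) c else a $ j) b"
    by (simp_all add: set_eq_iff mem_box_cart all_conj_distrib del: min.bounded_iff max.bounded_iff) blast+
qed

text \<open>The unit cube and its translate along a coordinate axis differ by two slabs, which a unit
  translation exchanges.\<close>

lemma integral_shift_coordinate:
  fixes G :: "real^'d::finite \<Rightarrow> 'b::euclidean_space"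
  assumes c: "continuous_on UNIV G" and p: "torus_periodic G" and s: "0 \<le> s" "s \<le> 1"
  shows "integral unit_cube (\<lambda>y. G (y + s *\<^sub>R axis i 1)) = integral unit_cube G"
proof -
  let ?e = "axis i 1 :: real^'d" and ?one = "(\<chi> i. 1) :: real^'d"
  have int: "G integrable_on cbox a b" for a b
    by (rule integrable_continuous) (use c continuous_on_subset in blast)
  have "integral unit_cube (\<lambda>y. G (y + s *\<^sub>R ?e)) = integral (cbox (s *\<^sub>R ?e) (?one + s *\<^sub>R ?e)) G"
    using integral_shift_cbox[of "s *\<^sub>R ?e" "s *\<^sub>R ?e" "?one + s *\<^sub>R ?e" G] by simp
  also have "\<dots> = integral (cbox (s *\<^sub>R ?e) (?one + s *\<^sub>R ?e) \<inter> {x. x \<bullet> ?e \<le> 1}) G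
     + integral (cbox (s *\<^sub>R ?e) (?one + s *\<^sub>R ?e) \<inter> {x. x \<bullet> ?e \<ge> 1}) G"
    by (rule integral_split[OF int]) simp
  also have "cbox (s *\<^sub>R ?e) (?one + s *\<^sub>R ?e) \<inter> {x. x \<bullet> ?e \<le> 1} = cbox (s *\<^sub>R ?e) ?one"
    unfolding cbox_cut using s by (intro arg_cong2[of _ _ _ _ cbox]) (auto simp: vec_eq_iff axis_def)
  also have "cbox (s *\<^sub>R ?e) (?one + s *\<^sub>R ?e) \<inter> {x. x \<bullet> ?e \<ge> 1} = cbox ?e (?one + s *\<^sub>R ?e)"
    unfolding cbox_cut using s by (intro arg_cong2[of _ _ _ _ cbox]) (auto simp: vec_eq_iff axis_def)
  also have "integral (cbox ?e (?one + s *\<^sub>R ?e)) G = integral (cbox 0 (?one + (s - 1) *\<^sub>R ?e)) (\<lambda>y. G (y + ?e))"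
    using integral_shift_cbox[of ?e ?e "?one + s *\<^sub>R ?e" G] by (simp add: algebra_simps)
  also have "(\<lambda>y. G (y + ?e)) = G" using p unfolding torus_periodic_def by blast
  finally have 1: "integral unit_cube (\<lambda>y. G (y + s *\<^sub>R ?e))
    = integral (cbox (s *\<^sub>R ?e) ?one) G + integral (cbox 0 (?one + (s - 1) *\<^sub>R ?e)) G" .
  have "integral unit_cube G = integral (unit_cube \<inter> {x. x \<bullet> ?e \<le> s}) G
     + integral (unit_cube \<inter> {x. x \<bullet> ?e \<ge> s}) G"
    by (rule integral_split[OF int]) simp
  also have "unit_cube \<inter> {x. x \<bullet> ?e \<le> s} = cbox 0 (?one + (s - 1) *\<^sub>R ?e)"
    unfolding cbox_cut using s by (intro arg_cong2[of _ _ _ _ cbox]) (auto simp: vec_eq_iff axis_def)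
  also have "unit_cube \<inter> {x. x \<bullet> ?e \<ge> s} = cbox (s *\<^sub>R ?e) ?one"
    unfolding cbox_cut using s by (intro arg_cong2[of _ _ _ _ cbox]) (auto simp: vec_eq_iff axis_def)
  finally show ?thesis using 1 by simp
qed

lemma torus_periodic_shift: "torus_periodic G \<Longrightarrow> torus_periodic (\<lambda>y. G (y + a))"
  unfolding torus_periodic_def by (metis add.assoc add.commute)

lemma continuous_shift:
  fixes a :: "'a::real_normed_vector"
  shows "continuous_on UNIV G \<Longrightarrow> continuous_on UNIV (\<lambda>y. G (y + a))"
  by (rule continuous_on_compose2[of UNIV G]) (auto intro!: continuous_intros)

lemma integral_periodic_shift:
  fixes G :: "real^'d::finite \<Rightarrow> 'b::euclidean_space"
  assumes c: "continuous_on UNIV G" and p: "torus_periodic G"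
  shows "integral unit_cube (\<lambda>y. G (y + a)) = integral unit_cube G"
proof -
  have one: "integral unit_cube (\<lambda>y. H (y + s *\<^sub>R axis i 1)) = integral unit_cube H"
    if H: "continuous_on UNIV H" "torus_periodic H" for H :: "real^'d \<Rightarrow> 'b" and s i
  proof -
    have "H (y + s *\<^sub>R axis i 1) = H (y + frac s *\<^sub>R axis i 1)" for y
      using periodic_int[OF H(2), of "y + frac s *\<^sub>R axis i 1" "\<lfloor>s\<rfloor>" i]
      by (simp add: frac_def algebra_simps)
    then show ?thesis
      using integral_shift_coordinate[OF H, of "frac s" i] by (simp add: frac_ge_0 frac_lt_1 less_imp_le)
  qed
  have "integral unit_cube (\<lambda>y. G (y + (\<Sum>i\<in>S. (a $ i) *\<^sub>R axis i 1))) = integral unit_cube G"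
    if "finite S" for S
    using that
  proof (induction S)
    case (insert j S)
    have "integral unit_cube (\<lambda>y. G (y + a $ j *\<^sub>R axis j 1 + (\<Sum>i\<in>S. (a $ i) *\<^sub>R axis i 1)))
      = integral unit_cube (\<lambda>y. G (y + (\<Sum>i\<in>S. (a $ i) *\<^sub>R axis i 1)))"
      by (rule one[OF continuous_shift[OF c] torus_periodic_shift[OF p]])
    then show ?case using insert by (simp add: algebra_simps)
  qed simp
  from this[of UNIV] show ?thesis by (simp add: vec_sum_axis)
qed

lemma integral_periodic_reflect:
  fixes G :: "real^'d::finite \<Rightarrow> 'b::euclidean_space"
  assumes c: "continuous_on UNIV G" and p: "torus_periodic G"
  shows "integral unit_cube (\<lambda>y. G (x - y)) = integral unit_cube G"
proof -
  let ?one = "(\<chi> i. 1) :: real^'d"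
  let ?H = "\<lambda>t. G (t + x)"
  have "integral unit_cube (\<lambda>y. ?H (- y)) = integral (cbox (- ?one) 0) ?H"
    using integral_reflect[of 0 "- ?one" ?H] by simp
  also have "\<dots> = integral unit_cube (\<lambda>y. G (y + (x - ?one)))"
    using integral_shift_cbox[of "- ?one" "- ?one" 0 ?H] by (simp add: algebra_simps)
  also have "\<dots> = integral unit_cube G" by (rule integral_periodic_shift[OF c p])
  finally show ?thesis by (simp add: algebra_simps)
qed

lemma integral_periodic_dilate:
  fixes G :: "real^'d::finite \<Rightarrow> 'b::euclidean_space"
  assumes c: "continuous_on UNIV G" and p: "torus_periodic G" and N: "N \<ge> 1"
  shows "integral unit_cube (\<lambda>x. G (real N *\<^sub>R x)) = integral unit_cube G"
proof -
  have "continuous_on unit_cube (\<lambda>x. G (real N *\<^sub>R x))"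
    by (rule continuous_on_compose2[OF c]) (auto intro!: continuous_intros)
  from integral_unit_cube_grid[OF N this]
  have "integral unit_cube (\<lambda>x. G (real N *\<^sub>R x))
     = (1 / real N ^ CARD('d)) *\<^sub>R (\<Sum>z\<in>grid N. integral unit_cube (\<lambda>y. G (y + z)))"
    using N by simp
  also have "\<dots> = integral unit_cube G"
    using N by (simp add: integral_periodic_shift[OF c p] card_grid sum_constant_scaleR)
  finally show ?thesis .
qed

section \<open>Approximation by trigonometric polynomials\<close>

definition conv :: "(real^'d::finite \<Rightarrow> real) \<Rightarrow> (real^'d \<Rightarrow> 'v::euclidean_space) \<Rightarrow> real^'d \<Rightarrow> 'v" where
  "conv c u x = integral unit_cube (\<lambda>y. c y *\<^sub>R u (x - y))"

lemma continuous_reflect: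
  fixes u :: "'a::real_normed_vector \<Rightarrow> 'b::topological_space"
  shows "continuous_on UNIV u \<Longrightarrow> continuous_on S (\<lambda>y. u (x - y))"
  by (rule continuous_on_compose2[of UNIV u]) (auto intro!: continuous_intros)

lemma conv_integrable:
  fixes u :: "real^'d::finite \<Rightarrow> 'v::euclidean_space"
  assumes "continuous_on UNIV c" "continuous_on UNIV u"
  shows "(\<lambda>y. c y *\<^sub>R u (x - y)) integrable_on unit_cube"
  by (intro integrable_continuous continuous_on_scaleR continuous_reflect assms
      continuous_on_subset[OF assms(1)]) simp

lemma conv_add_left:
  fixes u :: "real^'d::finite \<Rightarrow> 'v::euclidean_space"
  assumes "continuous_on UNIV c" "continuous_on UNIV c'" "continuous_on UNIV u"
  shows "conv (\<lambda>y. c y + c' y) u x = conv c u x + conv c' u x"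
  unfolding conv_def scaleR_add_left by (intro integral_add conv_integrable assms)

lemma conv_commute:
  fixes u :: "real^'d::finite \<Rightarrow> 'v::euclidean_space"
  assumes "continuous_on UNIV c" "continuous_on UNIV u" "torus_periodic c" "torus_periodic u"
  shows "conv c u x = integral unit_cube (\<lambda>t. c (x - t) *\<^sub>R u t)"
proof -
  have "torus_periodic (\<lambda>t. c (x - t) *\<^sub>R u t)"
    unfolding torus_periodic_def
  proof safe
    fix i t
    have "c (x - (t + axis i 1)) = c (x - (t + axis i 1) + axis i 1)"
      using assms(3) unfolding torus_periodic_def by metis
    then show "c (x - (t + axis i 1)) *\<^sub>R u (t + axis i 1) = c (x - t) *\<^sub>R u t"
      using assms(4) unfolding torus_periodic_def by (simp add: algebra_simps)
  qed
  moreover have "continuous_on UNIV (\<lambda>t. c (x - t) *\<^sub>R u t)"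
    by (intro continuous_on_scaleR continuous_reflect assms)
  ultimately show ?thesis
    unfolding conv_def using integral_periodic_reflect[of "\<lambda>t. c (x - t) *\<^sub>R u t" x] by simp
qed

lemma conv_has_derivative:
  fixes u :: "real^'d::finite \<Rightarrow> 'v::euclidean_space"
  assumes c: "continuous_on UNIV c" and u: "smooth u"
  shows "(conv c u has_derivative (\<lambda>h. \<Sum>i\<in>UNIV. h$i *\<^sub>R conv c (partial_deriv i u) x)) (at x)"
proof -
  define fx :: "real^'d \<Rightarrow> real^'d \<Rightarrow> ((real^'d) \<Rightarrow>\<^sub>L 'v)" where
    "fx x y = (\<Sum>i\<in>UNIV. blinfun_scaleR_left (c y *\<^sub>R partial_deriv i u (x - y)) o\<^sub>L blinfun_inner_left (axis i 1))"
    for x y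
  have fx_apply: "blinfun_apply (fx x y) h = (\<Sum>i\<in>UNIV. h$i *\<^sub>R (c y *\<^sub>R partial_deriv i u (x - y)))"
    for x y h :: "real^'d"
    by (simp add: fx_def blinfun.sum_left)
  have pc: "continuous_on UNIV (partial_deriv i u)" for i
    by (rule smooth_continuous_on[OF smooth_partial_deriv[OF u]])
  have cont2: "continuous_on (UNIV \<times> unit_cube) (\<lambda>p. c (snd p) *\<^sub>R partial_deriv i u (fst p - snd p))" for i
    by (intro continuous_on_scaleR continuous_on_compose2[OF c] continuous_on_compose2[OF pc])
       (auto intro!: continuous_intros)
  have cont: "continuous_on (UNIV \<times> unit_cube) (\<lambda>(x, y). fx x y)"
    unfolding fx_def split_beta
    by (intro continuous_on_sum bounded_bilinear.continuous_on[OF bounded_bilinear_blinfun_compose]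
        bounded_linear.continuous_on[OF bounded_linear_blinfun_scaleR_left] cont2 continuous_on_const)
  have "((\<lambda>x. integral unit_cube (\<lambda>y. c y *\<^sub>R u (x - y))) has_derivative
      blinfun_apply (integral unit_cube (fx x))) (at x within UNIV)"
  proof (rule leibniz_rule[OF _ _ cont])
    fix x y :: "real^'d"
    have "((\<lambda>x. u (x - y)) has_derivative (\<lambda>h. \<Sum>i\<in>UNIV. h$i *\<^sub>R partial_deriv i u (x - y))) (at x)"
      by (rule has_derivative_compose[of "\<lambda>x. x - y" _ _ UNIV u, OF _ smooth_has_derivative[OF u], where f'="\<lambda>h. h"])
         (auto intro!: derivative_eq_intros)
    then have "((\<lambda>x. c y *\<^sub>R u (x - y)) has_derivative (\<lambda>h. c y *\<^sub>R (\<Sum>i\<in>UNIV. h$i *\<^sub>R partial_deriv i u (x - y)))) (at x)"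
      by (rule has_derivative_scaleR_right)
    moreover have "(\<lambda>h. c y *\<^sub>R (\<Sum>i\<in>UNIV. h$i *\<^sub>R partial_deriv i u (x - y))) = blinfun_apply (fx x y)"
      by (simp add: fun_eq_iff fx_apply scaleR_sum_right mult.commute)
    ultimately show "((\<lambda>x. c y *\<^sub>R u (x - y)) has_derivative blinfun_apply (fx x y)) (at x)"
      by simp
  qed (auto intro: conv_integrable c smooth_continuous_on[OF u])
  moreover have "blinfun_apply (integral unit_cube (fx x)) h = (\<Sum>i\<in>UNIV. h$i *\<^sub>R conv c (partial_deriv i u) x)" for h
  proof -
    have "continuous_on unit_cube (\<lambda>y. fx x y)"
      using continuous_on_compose2[OF cont, of unit_cube "\<lambda>y. (x, y)"] continuous_on_Pair[OF continuous_on_const continuous_on_id]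
      by fastforce
    then have "blinfun_apply (integral unit_cube (fx x)) h = integral unit_cube (\<lambda>y. blinfun_apply (fx x y) h)"
      by (intro blinfun_apply_integral integrable_continuous)
    also have "\<dots> = (\<Sum>i\<in>UNIV. integral unit_cube (\<lambda>y. h$i *\<^sub>R (c y *\<^sub>R partial_deriv i u (x - y))))"
      unfolding fx_apply
      by (rule integral_sum) (rule finite, rule integrable_cmul, rule conv_integrable[OF c pc])
    finally show ?thesis by (simp only: conv_def integral_cmul)
  qed
  then have "blinfun_apply (integral unit_cube (fx x)) = (\<lambda>h. \<Sum>i\<in>UNIV. h$i *\<^sub>R conv c (partial_deriv i u) x)"
    by (rule ext)
  ultimately show ?thesis
    unfolding conv_def[of c u, abs_def] by (simp only:)
qed

lemma smooth_conv:
  fixes u :: "real^'d::finite \<Rightarrow> 'v::euclidean_space"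
  assumes c: "continuous_on UNIV c" and u: "smooth u"
  shows "smooth (conv c u)" "D js (conv c u) = conv c (D js u)"
proof -
  have pd: "partial_deriv i (conv c u) = conv c (partial_deriv i u)" if "smooth u" for u :: "real^'d \<Rightarrow> 'v" and i
    by (subst partial_deriv_eqI[OF conv_has_derivative[OF c that]])
       (simp add: fun_eq_iff axis_def if_distrib[of "\<lambda>c. c *\<^sub>R _"] cong: if_cong)
  show "smooth (conv c u)"
  proof (rule smooth_coinduct[where S = "conv c ` {u. smooth u}"])
    fix v :: "real^'d \<Rightarrow> 'v" and x i assume "v \<in> conv c ` {u. smooth u}"
    then obtain u where v: "v = conv c u" "smooth u" by auto
    show "v differentiable (at x)"
      using conv_has_derivative[OF c v(2)] unfolding v(1) differentiable_def by blast
    show "partial_deriv i v \<in> conv c ` {u. smooth u}"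
      unfolding v(1) pd[OF v(2)] using smooth_partial_deriv[OF v(2)] by blast
  qed (use u in blast)
  show "D js (conv c u) = conv c (D js u)"
    by (induction js) (simp_all add: pd smooth_D u)
qed

lemma conv_blinfun:
  fixes u :: "real^'d::finite \<Rightarrow> 'v::euclidean_space" and L :: "'v \<Rightarrow>\<^sub>L 'w::euclidean_space"
  assumes "continuous_on UNIV c" "continuous_on UNIV u"
  shows "blinfun_apply L (conv c u x) = conv c (\<lambda>y. L (u y)) x"
  unfolding conv_def using integral_blinfun_apply[OF conv_integrable[OF assms], of L]
  by (simp add: blinfun.scaleR_right)

lemma conv_sum:
  fixes u :: "'j \<Rightarrow> real^'d::finite \<Rightarrow> 'v::euclidean_space"
  assumes "continuous_on UNIV c" "\<And>j. j \<in> J \<Longrightarrow> continuous_on UNIV (u j)" "finite J"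
  shows "conv c (\<lambda>y. \<Sum>j\<in>J. u j y) x = (\<Sum>j\<in>J. conv c (u j) x)"
  unfolding conv_def scaleR_sum_right
  by (rule integral_sum) (auto intro: conv_integrable assms)

lemma diff_op_conv:
  fixes u :: "real^'d::finite \<Rightarrow> 'v::euclidean_space"
    and A :: "('d \<Rightarrow> nat) \<Rightarrow> ('v \<Rightarrow>\<^sub>L 'w::euclidean_space)"
  assumes c: "continuous_on UNIV c" and u: "smooth u"
  shows "diff_op A k (conv c u) x = conv c (diff_op A k u) x"
proof -
  have cD: "continuous_on UNIV (D js u)" for js
    by (rule smooth_continuous_on[OF smooth_D[OF u]])
  then have cA: "continuous_on UNIV (\<lambda>y. A \<gamma> (D js u y))" for js \<gamma>
    by (rule bounded_linear.continuous_on[OF blinfun.bounded_linear_right])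
  have "conv c (\<lambda>y. \<Sum>\<gamma>\<in>multi_indices k. A \<gamma> (D (indices_of \<gamma>) u y)) x
    = (\<Sum>\<gamma>\<in>multi_indices k. conv c (\<lambda>y. A \<gamma> (D (indices_of \<gamma>) u y)) x)"
    by (rule conv_sum[OF c _ finite_multi_indices]) (rule cA)
  then show ?thesis
    unfolding diff_op_eq_D[abs_def] smooth_conv(2)[OF c u] conv_blinfun[OF c cD] by simp
qed

inductive trig_poly :: "(real^'d::finite \<Rightarrow> real) \<Rightarrow> bool" where
  wave: "lattice_vec \<xi> \<Longrightarrow> trig_poly (\<lambda>y. c * cos (((2 * pi) *\<^sub>R \<xi>) \<bullet> y + \<theta>))"
| add: "trig_poly f \<Longrightarrow> trig_poly g \<Longrightarrow> trig_poly (\<lambda>y. f y + g y)"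

lemma lattice_vec_add: "lattice_vec z \<Longrightarrow> lattice_vec w \<Longrightarrow> lattice_vec (z + w)"
  and lattice_vec_diff: "lattice_vec z \<Longrightarrow> lattice_vec w \<Longrightarrow> lattice_vec (z - w)"
  and lattice_vec_axis: "lattice_vec (axis i 1)"
  and lattice_vec_zero: "lattice_vec 0"
  by (auto simp: lattice_vec_def axis_def)

lemma trig_poly_continuous: "trig_poly f \<Longrightarrow> continuous_on S f"
  by (induction rule: trig_poly.induct) (auto intro!: continuous_intros)

lemma wave_periodic:
  assumes "lattice_vec \<xi>"
  shows "torus_periodic (\<lambda>y. cos (((2 * pi) *\<^sub>R \<xi>) \<bullet> y + \<theta>))"
  unfolding torus_periodic_def
proof safe
  fix i and y :: "real^'a"
  obtain n where n: "\<xi> $ i = of_int n" using assms unfolding lattice_vec_def by (metis Ints_cases)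
  have "((2 * pi) *\<^sub>R \<xi>) \<bullet> (y + axis i 1) + \<theta> = ((2 * pi) *\<^sub>R \<xi>) \<bullet> y + \<theta> + 2 * pi * of_int n"
    by (simp add: inner_add_right n)
  then show "cos (((2 * pi) *\<^sub>R \<xi>) \<bullet> (y + axis i 1) + \<theta>) = cos (((2 * pi) *\<^sub>R \<xi>) \<bullet> y + \<theta>)"
    by (simp only: cos_add sin_int_2pin cos_int_2pin) simp
qed

lemma trig_poly_periodic: "trig_poly f \<Longrightarrow> torus_periodic f"
proof (induction rule: trig_poly.induct)
  case (wave \<xi> c \<theta>)
  then show ?case using wave_periodic[of \<xi> \<theta>] by (simp add: torus_periodic_def)
qed (simp add: torus_periodic_def)

lemma trig_poly_mult:
  assumes f: "trig_poly f" and g: "trig_poly g"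
  shows "trig_poly (\<lambda>y. f y * g y)"
  using f
proof induction
  case (wave \<xi> c \<theta>)
  show ?case
    using g
  proof induction
    case (wave \<xi>' c' \<theta>')
    have "(\<lambda>y. c * cos (((2 * pi) *\<^sub>R \<xi>) \<bullet> y + \<theta>) * (c' * cos (((2 * pi) *\<^sub>R \<xi>') \<bullet> y + \<theta>')))
      = (\<lambda>y. (c * c' / 2) * cos (((2 * pi) *\<^sub>R (\<xi> - \<xi>')) \<bullet> y + (\<theta> - \<theta>'))
           + (c * c' / 2) * cos (((2 * pi) *\<^sub>R (\<xi> + \<xi>')) \<bullet> y + (\<theta> + \<theta>')))"
    proof
      fix y
      define s t where "s = ((2 * pi) *\<^sub>R \<xi>) \<bullet> y + \<theta>" and "t = ((2 * pi) *\<^sub>R \<xi>') \<bullet> y + \<theta>'"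
      have e: "((2 * pi) *\<^sub>R (\<xi> - \<xi>')) \<bullet> y + (\<theta> - \<theta>') = s - t"
        "((2 * pi) *\<^sub>R (\<xi> + \<xi>')) \<bullet> y + (\<theta> + \<theta>') = s + t"
        by (simp_all add: s_def t_def inner_diff_left inner_add_left algebra_simps)
      show "c * cos (((2 * pi) *\<^sub>R \<xi>) \<bullet> y + \<theta>) * (c' * cos (((2 * pi) *\<^sub>R \<xi>') \<bullet> y + \<theta>'))
        = (c * c' / 2) * cos (((2 * pi) *\<^sub>R (\<xi> - \<xi>')) \<bullet> y + (\<theta> - \<theta>'))
           + (c * c' / 2) * cos (((2 * pi) *\<^sub>R (\<xi> + \<xi>')) \<bullet> y + (\<theta> + \<theta>'))"
        unfolding e s_def[symmetric] t_def[symmetric] by (simp add: cos_diff cos_add algebra_simps)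
    qed
    then show ?case
      using wave \<open>lattice_vec \<xi>\<close> by (simp only:) (intro trig_poly.intros lattice_vec_add lattice_vec_diff)
  qed (simp add: distrib_left trig_poly.add)
qed (simp add: distrib_right trig_poly.add)

lemma trig_poly_const: "trig_poly (\<lambda>y. c)"
  using trig_poly.wave[OF lattice_vec_zero, of c 0] by simp

lemma trig_poly_prod:
  assumes "\<And>j. j \<in> J \<Longrightarrow> trig_poly (f j)"
  shows "trig_poly (\<lambda>y. \<Prod>j\<in>J. f j y)"
  using assms by (induction J rule: infinite_finite_induct) (auto intro: trig_poly_const trig_poly_mult)

lemma trig_poly_power: "trig_poly f \<Longrightarrow> trig_poly (\<lambda>y. f y ^ n)"
  by (induction n) (auto intro: trig_poly_const trig_poly_mult)

lemma periodic_uniform: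
  fixes u :: "real^'d::finite \<Rightarrow> 'v::euclidean_space"
  assumes c: "continuous_on UNIV u" and p: "torus_periodic u"
  shows "uniformly_continuous_on UNIV u" "bounded (range u)"
proof -
  define K :: "(real^'d) set" where "K = cbox (\<chi> i. -1) (\<chi> i. 2)"
  have ucK: "uniformly_continuous_on K u"
    unfolding K_def by (intro compact_uniformly_continuous) (use c continuous_on_subset in auto)
  define fl :: "real^'d \<Rightarrow> real^'d" where "fl x = (\<chi> i. of_int \<lfloor>x $ i\<rfloor>)" for x
  have per: "u (y - fl x) = u y" for x y
  proof -
    have "lattice_vec (fl x)" by (simp add: lattice_vec_def fl_def)
    from periodic_lattice[OF p this, of "y - fl x"] show ?thesis by simp
  qed
  have flK: "x - fl x \<in> K" "norm (y - x) < 1 \<Longrightarrow> y - fl x \<in> K" for x y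
  proof -
    have fl: "0 \<le> x $ i - fl x $ i \<and> x $ i - fl x $ i \<le> 1" for i
      unfolding fl_def vec_lambda_beta by linarith
    then show "x - fl x \<in> K" unfolding K_def by (auto simp: mem_box_cart) (smt (verit))+
    assume "norm (y - x) < 1"
    then have "\<bar>y $ i - x $ i\<bar> < 1" for i
      using component_le_norm_cart[of "y - x" i] by simp
    then have "- 1 \<le> y $ i - fl x $ i \<and> y $ i - fl x $ i \<le> 2" for i
      using fl[of i] by (smt (verit))
    then show "y - fl x \<in> K" unfolding K_def by (auto simp: mem_box_cart)
  qed
  show "uniformly_continuous_on UNIV u"
    unfolding uniformly_continuous_on_def
  proof safe
    fix e :: real assume "e > 0"
    then obtain \<delta> where \<delta>: "\<delta> > 0" "\<And>x y. x \<in> K \<Longrightarrow> y \<in> K \<Longrightarrow> dist y x < \<delta> \<Longrightarrow> dist (u y) (u x) < e"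
      using ucK unfolding uniformly_continuous_on_def by metis
    have "dist (u y) (u x) < e" if "dist y x < min \<delta> 1" for x y
      using \<delta>(2)[of "x - fl x" "y - fl x"] flK(1)[of x] flK(2)[of y x] that by (simp add: per dist_norm)
    then show "\<exists>\<delta>>0. \<forall>x\<in>UNIV. \<forall>y\<in>UNIV. dist y x < \<delta> \<longrightarrow> dist (u y) (u x) < e"
      using \<delta>(1) by (intro exI[of _ "min \<delta> 1"]) auto
  qed
  have "range u = u ` K" using per flK(1) by (metis (no_types, lifting) image_eqI subsetI subset_antisym image_subset_iff rangeI)
  moreover have "compact (u ` K)"
    unfolding K_def by (intro compact_continuous_image) (use c continuous_on_subset in auto)
  ultimately show "bounded (range u)" by (simp add: compact_imp_bounded)
qed

text \<open>A nonnegative trigonometric polynomial with maximum 1, attained exactly at the lattice points; its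
  normalised powers are an approximate identity on the torus.\<close>

definition fejer :: "real^'d::finite \<Rightarrow> real" where
  "fejer y = (\<Prod>i\<in>UNIV. (1 + cos (2 * pi * y $ i)) / 2)"

lemma trig_poly_fejer: "trig_poly (fejer :: real^'d::finite \<Rightarrow> real)"
proof -
  have "trig_poly (\<lambda>y. 1/2 * cos (((2 * pi) *\<^sub>R 0) \<bullet> y + 0) + 1/2 * cos (((2 * pi) *\<^sub>R axis i 1) \<bullet> y + 0))"
    for i :: 'd
    by (intro trig_poly.intros lattice_vec_zero lattice_vec_axis)
  then have "trig_poly (\<lambda>y :: real^'d. (1 + cos (2 * pi * y $ i)) / 2)" for i
    by (simp add: inner_axis' add_divide_distrib)
  then show ?thesis
    unfolding fejer_def[abs_def] by (rule trig_poly_prod)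
qed

lemma cos_half_bounds: "0 \<le> (1 + cos t) / 2 \<and> (1 + cos t) / 2 \<le> 1" for t :: real
proof
  show "0 \<le> (1 + cos t) / 2" using add_left_mono[OF cos_ge_minus_one[of t], of 1] by simp
  show "(1 + cos t) / 2 \<le> 1" by simp
qed

lemma fejer_bounds: "0 \<le> fejer y" "fejer y \<le> 1"
proof -
  note * = cos_half_bounds
  show "0 \<le> fejer y" unfolding fejer_def using * by (intro prod_nonneg) auto
  show "fejer y \<le> 1" unfolding fejer_def using * by (intro prod_le_1) auto
qed

lemma fejer_eq_1:
  assumes "fejer y = 1" "y \<in> unit_cube"
  shows "y \<in> grid 2"
  unfolding grid_iff
proof
  fix i
  note * = cos_half_bounds
  have "fejer y = (1 + cos (2 * pi * y $ i)) / 2 * (\<Prod>j\<in>UNIV - {i}. (1 + cos (2 * pi * y $ j)) / 2)"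
    unfolding fejer_def by (subst prod.remove[of UNIV i]) auto
  also have "\<dots> \<le> (1 + cos (2 * pi * y $ i)) / 2 * 1"
    using * by (intro mult_left_mono prod_le_1) auto
  finally have "cos (2 * pi * y $ i) = 1" using assms(1) cos_le_one[of "2 * pi * y $ i"] by simp
  then obtain n :: int where "2 * pi * y $ i = of_int n * 2 * pi" using cos_one_2pi_int by auto
  then have n: "y $ i = of_int n" by simp
  have "0 \<le> y $ i" "y $ i \<le> 1" using assms(2) by (auto simp: mem_unit_cube)
  then have "0 \<le> n" "n \<le> 1" unfolding n by simp_all
  then show "\<exists>m<2. y $ i = real m" using n by (intro exI[of _ "nat n"]) auto
qed

text \<open>Convolution with normalised powers of the kernel concentrates at the lattice points, because
  the kernel attains its maximum 1 only there: away from them its powers decay geometrically faster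
  than the normalising integral, which is bounded below by the contribution near the origin.\<close>

lemma trig_poly_approx:
  fixes u :: "real^'d::finite \<Rightarrow> 'v::euclidean_space"
  assumes c: "continuous_on UNIV u" and p: "torus_periodic u" and \<epsilon>: "\<epsilon> > 0"
  shows "\<exists>f. trig_poly f \<and> (\<forall>x. norm (conv f u x - u x) \<le> \<epsilon>)"
proof -
  have cf: "continuous_on S fejer" for S :: "(real^'d) set" by (rule trig_poly_continuous[OF trig_poly_fejer])
  obtain M where M: "M > 0" "\<And>x. norm (u x) \<le> M"
    using periodic_uniform(2)[OF c p] unfolding bounded_pos by auto
  have "\<exists>\<delta>>0. \<forall>x\<in>UNIV. \<forall>y\<in>UNIV. dist y x < \<delta> \<longrightarrow> dist (u y) (u x) < \<epsilon> / 2"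
    using periodic_uniform(1)[OF c p, unfolded uniformly_continuous_on_def] \<epsilon> by (meson half_gt_zero)
  then obtain \<delta> where \<delta>: "\<delta> > 0" "\<And>x y. dist y x < \<delta> \<Longrightarrow> dist (u y) (u x) < \<epsilon> / 2"
    by auto
  define V :: "(real^'d) set" where "V = {y \<in> unit_cube. \<forall>z\<in>grid 2. \<delta> \<le> dist y z} "
  obtain \<rho> where \<rho>: "0 \<le> \<rho>" "\<rho> < 1" "\<And>y. y \<in> V \<Longrightarrow> fejer y \<le> \<rho>"
  proof (cases "V = {}")
    case False
    have "V = unit_cube \<inter> (\<Inter>z\<in>grid 2. {y. \<delta> \<le> dist y z})" by (auto simp: V_def)
    moreover have "closed (\<Inter>z\<in>grid 2. {y :: real^'d. \<delta> \<le> dist y z})"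
      by (intro closed_INT ballI closed_Collect_le continuous_on_const continuous_on_dist continuous_on_id)
    ultimately have "compact V" using compact_Int_closed[OF compact_cbox] by simp
    from continuous_attains_sup[OF this False cf]
    obtain y0 where y0: "y0 \<in> V" "\<forall>y\<in>V. fejer y \<le> fejer y0" by (elim bexE)
    have "fejer y0 \<noteq> 1"
    proof
      assume "fejer y0 = 1"
      moreover have V0: "y0 \<in> unit_cube" "\<forall>z\<in>grid 2. \<delta> \<le> dist y0 z" using y0(1) by (simp_all add: V_def)
      ultimately have "y0 \<in> grid 2" by (intro fejer_eq_1)
      then have "\<delta> \<le> dist y0 y0" using V0(2) by (rule bspec[rotated])
      then show False using \<delta>(1) by simp
    qed
    then have "fejer y0 < 1" using fejer_bounds(2)[of y0] by simp
    then show ?thesis using y0(2) by (intro that[of "fejer y0"] fejer_bounds(1)) simp_all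
  qed (rule that[of 0]; simp)
  \<comment> \<open>A level strictly between the maximum of the kernel away from the lattice and its maximum 1.\<close>
  define \<sigma> where "\<sigma> = (1 + \<rho>) / 2"
  have \<sigma>: "\<rho> < \<sigma>" "\<sigma> < 1" "0 < \<sigma>" using \<rho> by (auto simp: \<sigma>_def)
  obtain r where r: "r > 0" "\<And>y :: real^'d. dist y 0 < r \<Longrightarrow> \<sigma> < fejer y"
  proof -
    have "open {y :: real^'d. \<sigma> < fejer y}"
      by (intro open_Collect_less continuous_on_const cf)
    moreover have "(0 :: real^'d) \<in> {y. \<sigma> < fejer y}" using \<sigma> by (simp add: fejer_def)
    ultimately obtain r where "r > 0" "ball 0 r \<subseteq> {y :: real^'d. \<sigma> < fejer y}"
      by (rule openE)
    then show ?thesis by (intro that[of r]) (simp_all add: subset_eq dist_commute)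
  qed
  \<comment> \<open>Small enough for a cube of this side to lie in the ball of radius \<open>r\<close>.\<close>
  define \<eta> where "\<eta> = min 1 (r / (2 * CARD('d)))"
  have \<eta>: "0 < \<eta>" "\<eta> \<le> 1" using r(1) by (auto simp: \<eta>_def)
  have near: "\<sigma> \<le> fejer y" if "y \<in> cbox 0 (\<chi> i. \<eta>)" for y :: "real^'d"
  proof -
    have "norm y \<le> (\<Sum>i\<in>UNIV. \<bar>y $ i\<bar>)" by (rule norm_le_l1_cart)
    also have "\<dots> \<le> (\<Sum>i\<in>(UNIV::'d set). \<eta>)"
      using that by (intro sum_mono) (auto simp: mem_box_cart)
    also have "\<dots> \<le> CARD('d) * (r / (2 * CARD('d)))"
      unfolding sum_constant by (rule mult_left_mono) (simp_all add: \<eta>_def)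
    also have "\<dots> < r" using r(1) by simp
    finally show ?thesis using r(2)[of y] by simp
  qed
  obtain n where n: "2 * M * (\<rho> / \<sigma>) ^ n \<le> \<epsilon> / 2 * \<eta> ^ CARD('d)"
  proof -
    have "(\<lambda>n. 2 * M * (\<rho> / \<sigma>) ^ n) \<longlonglongrightarrow> 2 * M * 0"
      using \<sigma> \<rho> by (intro tendsto_intros LIMSEQ_realpow_zero) auto
    moreover have "0 < \<epsilon> / 2 * \<eta> ^ CARD('d)" using \<epsilon> \<eta> by simp
    ultimately have "\<forall>\<^sub>F n in sequentially. 2 * M * (\<rho> / \<sigma>) ^ n < \<epsilon> / 2 * \<eta> ^ CARD('d)"
      using order_tendstoD(2) by fastforce
    then show ?thesis using that by (auto simp: eventually_sequentially intro: less_imp_le)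
  qed
  define I where "I = integral unit_cube (\<lambda>y :: real^'d. fejer y ^ n)"
  have fint: "(\<lambda>y. fejer y ^ n) integrable_on cbox a b" for a b :: "real^'d"
    by (intro integrable_continuous continuous_intros cf)
  have I: "\<sigma> ^ n * \<eta> ^ CARD('d) \<le> I"
  proof -
    have "\<sigma> ^ n * \<eta> ^ CARD('d) = integral (cbox 0 (\<chi> i. \<eta>)) (\<lambda>y :: real^'d. \<sigma> ^ n)"
    proof -
      have "cbox 0 (\<chi> i. \<eta>) \<noteq> ({} :: (real^'d) set)"
        using \<eta>(1) by (simp add: interval_ne_empty_cart less_imp_le)
      then show ?thesis by (simp add: content_cbox_cart)
    qed
    also have "\<dots> \<le> integral (cbox 0 (\<chi> i. \<eta>)) (\<lambda>y :: real^'d. fejer y ^ n)"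
      using near \<sigma> by (intro integral_le fint power_mono) auto
    also have "\<dots> \<le> I"
      unfolding I_def
    proof (rule integral_subset_le[OF _ fint fint])
      have "y $ i \<le> 1" if "y $ i \<le> \<eta>" for y :: "real^'d" and i
        using that \<eta>(2) by linarith
      then show "cbox 0 (\<chi> i. \<eta>) \<subseteq> (unit_cube :: (real^'d) set)"
        by (simp add: subset_eq mem_box_cart)
    qed (simp add: fejer_bounds(1))
    finally show ?thesis .
  qed
  then have I0: "I > 0" using \<sigma> \<eta> by (smt (verit) mult_pos_pos zero_less_power)
  have small: "2 * M * \<rho> ^ n \<le> \<epsilon> / 2 * I"
  proof -
    have "2 * M * \<rho> ^ n = (2 * M * (\<rho> / \<sigma>) ^ n) * \<sigma> ^ n"
      using \<sigma> by (simp add: power_divide)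
    also have "\<dots> \<le> (\<epsilon> / 2 * \<eta> ^ CARD('d)) * \<sigma> ^ n"
      using n \<sigma> by (intro mult_right_mono) auto
    also have "\<dots> \<le> \<epsilon> / 2 * I"
      using I \<epsilon> by (simp add: mult_left_mono mult.commute mult.left_commute)
    finally show ?thesis .
  qed
  have pw: "norm (fejer y ^ n *\<^sub>R (u (x - y) - u x)) \<le> \<epsilon> / 2 * fejer y ^ n + 2 * M * \<rho> ^ n"
    if y: "y \<in> unit_cube" for x y
  proof (cases "y \<in> V")
    case True
    have "norm (u (x - y) - u x) \<le> 2 * M"
      using norm_triangle_ineq4[of "u (x - y)" "u x"] M(2)[of x] M(2)[of "x - y"] by linarith
    then have "fejer y ^ n * norm (u (x - y) - u x) \<le> \<rho> ^ n * (2 * M)"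
      using \<rho>(1,3) True by (intro mult_mono power_mono) (auto simp: fejer_bounds(1))
    moreover have "0 \<le> \<epsilon> / 2 * fejer y ^ n" using \<epsilon> by (simp add: fejer_bounds(1))
    moreover have "norm (fejer y ^ n *\<^sub>R (u (x - y) - u x)) = fejer y ^ n * norm (u (x - y) - u x)"
      by (simp add: fejer_bounds(1))
    ultimately show ?thesis by (simp only: mult.commute[of "fejer y ^ n" "\<epsilon> / 2"] mult.commute[of "\<rho> ^ n" "2 * M"])
  next
    case False
    then obtain z where z: "z \<in> grid 2" "dist y z < \<delta>" using y by (force simp: V_def)
    have "lattice_vec z" using z(1) unfolding grid_iff lattice_vec_def by (metis Ints_of_nat)
    then have "u x = u (x - z)" using periodic_lattice[OF p, of z "x - z"] by simp
    moreover have "dist (x - y) (x - z) < \<delta>" using z(2) by (simp add: dist_norm norm_minus_commute)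
    ultimately have "norm (u (x - y) - u x) \<le> \<epsilon> / 2" using \<delta>(2) by (metis dist_norm less_imp_le)
    then have "fejer y ^ n * norm (u (x - y) - u x) \<le> fejer y ^ n * (\<epsilon> / 2)"
      by (intro mult_left_mono) (auto simp: fejer_bounds(1))
    moreover have "0 \<le> 2 * M * \<rho> ^ n" using M(1) \<rho>(1) by simp
    moreover have "norm (fejer y ^ n *\<^sub>R (u (x - y) - u x)) = fejer y ^ n * norm (u (x - y) - u x)"
      by (simp add: fejer_bounds(1))
    ultimately show ?thesis by (simp only: mult.commute[of "fejer y ^ n" "\<epsilon> / 2"] mult.commute[of "\<rho> ^ n" "2 * M"])
  qed
  define f where "f y = 1 / I * fejer y ^ n" for y :: "real^'d"
  have "trig_poly f"
    unfolding f_def by (intro trig_poly_mult trig_poly_const trig_poly_power trig_poly_fejer)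
  moreover have "norm (conv f u x - u x) \<le> \<epsilon>" for x
  proof -
    have int1: "(\<lambda>y. fejer y ^ n *\<^sub>R (u (x - y))) integrable_on unit_cube"
      by (rule conv_integrable[OF _ c]) (intro continuous_intros cf)
    have int2: "(\<lambda>y :: real^'d. fejer y ^ n *\<^sub>R u x) integrable_on unit_cube"
      by (intro integrable_continuous continuous_intros cf)
    have "conv f u x = (1 / I) *\<^sub>R integral unit_cube (\<lambda>y. fejer y ^ n *\<^sub>R u (x - y))"
      unfolding conv_def f_def by (simp only: scaleR_scaleR[symmetric] integral_cmul)
    moreover have "u x = (1 / I) *\<^sub>R integral unit_cube (\<lambda>y :: real^'d. fejer y ^ n *\<^sub>R u x)"
    proof -
      have "integral unit_cube (\<lambda>y :: real^'d. fejer y ^ n *\<^sub>R u x) = I *\<^sub>R u x"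
        unfolding I_def using integral_linear[OF fint bounded_linear_scaleR_left, of 0 "\<chi> i. 1" "u x"]
        by (simp add: o_def)
      then show ?thesis using I0 by simp
    qed
    ultimately have "conv f u x - u x = (1 / I) *\<^sub>R integral unit_cube (\<lambda>y. fejer y ^ n *\<^sub>R (u (x - y) - u x))"
      by (simp add: scaleR_diff_right Henstock_Kurzweil_Integration.integral_diff[OF int1 int2])
    then have "norm (conv f u x - u x) = 1 / I * norm (integral unit_cube (\<lambda>y. fejer y ^ n *\<^sub>R (u (x - y) - u x)))"
      using I0 by simp
    also have "\<dots> \<le> 1 / I * integral unit_cube (\<lambda>y :: real^'d. \<epsilon> / 2 * fejer y ^ n + 2 * M * \<rho> ^ n)"
    proof (intro mult_left_mono integral_norm_bound_integral pw)
      show "(\<lambda>y. fejer y ^ n *\<^sub>R (u (x - y) - u x)) integrable_on unit_cube"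
        unfolding scaleR_diff_right by (intro integrable_diff int1 int2)
      show "(\<lambda>y :: real^'d. \<epsilon> / 2 * fejer y ^ n + 2 * M * \<rho> ^ n) integrable_on unit_cube"
        by (intro integrable_continuous continuous_intros cf)
    qed (use I0 in auto)
    also have "integral unit_cube (\<lambda>y :: real^'d. \<epsilon> / 2 * fejer y ^ n + 2 * M * \<rho> ^ n) = \<epsilon> / 2 * I + 2 * M * \<rho> ^ n"
    proof -
      have "(\<lambda>y :: real^'d. \<epsilon> / 2 * fejer y ^ n) integrable_on unit_cube" "(\<lambda>y :: real^'d. 2 * M * \<rho> ^ n) integrable_on unit_cube"
        by (intro integrable_continuous continuous_intros cf)+
      from HK_integral_add[OF this] show ?thesis
        by (simp add: I_def)
    qed
    also have "1 / I * (\<epsilon> / 2 * I + 2 * M * \<rho> ^ n) \<le> 1 / I * (\<epsilon> / 2 * I + \<epsilon> / 2 * I)"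
      using small I0 by (intro mult_left_mono add_left_mono) auto
    also have "\<dots> = \<epsilon>" using I0 by simp
    finally show ?thesis .
  qed
  ultimately show ?thesis by blast
qed

lemma integral_scaleR_const:
  fixes f :: "real^'d::finite \<Rightarrow> real" and a :: "'v::euclidean_space"
  assumes "f integrable_on S"
  shows "integral S (\<lambda>y. f y *\<^sub>R a) = integral S f *\<^sub>R a"
  using integral_linear[OF assms bounded_linear_scaleR_left, of a] by (simp add: o_def)

lemma conv_wave:
  fixes u :: "real^'d::finite \<Rightarrow> 'v::euclidean_space"
  assumes \<xi>: "lattice_vec \<xi>" and c: "continuous_on UNIV u" and p: "torus_periodic u"
  defines "\<eta> \<equiv> (2 * pi) *\<^sub>R \<xi>"
  obtains a b where "conv (\<lambda>y. r * cos (\<eta> \<bullet> y + \<theta>)) u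
    = (\<lambda>x. cos (\<eta> \<bullet> x + 0) *\<^sub>R a + cos (\<eta> \<bullet> x + (- (pi/2))) *\<^sub>R b)"
proof
  let ?f = "\<lambda>y. r * cos (\<eta> \<bullet> y + \<theta>)"
  let ?C = "\<lambda>t. (r * cos (\<theta> - \<eta> \<bullet> t)) *\<^sub>R u t" and ?S = "\<lambda>t. (- r * sin (\<theta> - \<eta> \<bullet> t)) *\<^sub>R u t"
  have cont: "?C integrable_on unit_cube" "?S integrable_on unit_cube"
    using continuous_on_subset[OF c]
    by (auto intro!: integrable_continuous continuous_intros)
  show "conv ?f u = (\<lambda>x. cos (\<eta> \<bullet> x + 0) *\<^sub>R integral unit_cube ?C
    + cos (\<eta> \<bullet> x + (- (pi/2))) *\<^sub>R integral unit_cube ?S)"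
  proof
    fix x
    have "torus_periodic ?f"
      using wave_periodic[OF \<xi>, of \<theta>] by (simp add: \<eta>_def torus_periodic_def)
    moreover have "continuous_on UNIV ?f" by (intro continuous_intros)
    ultimately have "conv ?f u x = integral unit_cube (\<lambda>t. ?f (x - t) *\<^sub>R u t)"
      using c p by (intro conv_commute)
    also have "(\<lambda>t. ?f (x - t) *\<^sub>R u t)
      = (\<lambda>t. cos (\<eta> \<bullet> x) *\<^sub>R ?C t + sin (\<eta> \<bullet> x) *\<^sub>R ?S t)"
    proof
      fix t
      have "\<eta> \<bullet> (x - t) + \<theta> = \<eta> \<bullet> x + (\<theta> - \<eta> \<bullet> t)" by (simp add: inner_diff_right)
      then have "?f (x - t) = cos (\<eta> \<bullet> x) * (r * cos (\<theta> - \<eta> \<bullet> t)) + sin (\<eta> \<bullet> x) * (- r * sin (\<theta> - \<eta> \<bullet> t))"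
        by (simp only: cos_add) (simp add: algebra_simps)
      then show "?f (x - t) *\<^sub>R u t = cos (\<eta> \<bullet> x) *\<^sub>R ?C t + sin (\<eta> \<bullet> x) *\<^sub>R ?S t"
        by (simp only: scaleR_add_left scaleR_scaleR)
    qed
    also have "integral unit_cube \<dots> = cos (\<eta> \<bullet> x) *\<^sub>R integral unit_cube ?C + sin (\<eta> \<bullet> x) *\<^sub>R integral unit_cube ?S"
      using HK_integral_add[OF integrable_cmul[OF cont(1)] integrable_cmul[OF cont(2)]]
      by (simp only: integral_cmul)
    also have "sin (\<eta> \<bullet> x) = cos (\<eta> \<bullet> x + (- (pi/2)))" by (simp only: cos_add) simp
    finally show "conv ?f u x = cos (\<eta> \<bullet> x + 0) *\<^sub>R integral unit_cube ?C
      + cos (\<eta> \<bullet> x + (- (pi/2))) *\<^sub>R integral unit_cube ?S" by (simp only: add_0_right)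
  qed
qed

lemma zero_if_conv_zero:
  fixes u :: "real^'d::finite \<Rightarrow> 'v::euclidean_space"
  assumes c: "continuous_on UNIV u" and p: "torus_periodic u"
    and z: "\<And>f x. trig_poly f \<Longrightarrow> conv f u x = 0"
  shows "u x = 0"
proof (rule ccontr)
  assume "u x \<noteq> 0"
  then obtain f where "trig_poly f" "\<forall>x'. norm (conv f u x' - u x') \<le> norm (u x) / 2"
    using trig_poly_approx[OF c p, of "norm (u x) / 2"] by auto
  then have "norm (u x) \<le> norm (u x) / 2" using z by (metis diff_0 norm_minus_cancel)
  then show False using \<open>u x \<noteq> 0\<close> by simp
qed

lemma D_periodic:
  assumes "smooth u" "torus_periodic u"
  shows "torus_periodic (D js u)"
  unfolding torus_periodic_def
proof safe
  fix i x
  have "(\<lambda>x. u (1 *\<^sub>R x + axis i 1)) = u" using assms(2) by (simp add: torus_periodic_def)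
  then show "D js u (x + axis i 1) = D js u x"
    using fun_cong[OF D_affine[OF assms(1), of js 1 "axis i 1"], of x] by simp
qed

text \<open>A homogeneous operator whose symbol vanishes identically vanishes: this is clear on plane
  waves, and periodic fields are uniform limits of their convolutions with trigonometric
  polynomials, which commute with derivatives.\<close>

lemma operator_zero_if_symbol_zero:
  fixes v :: "real^'d::finite \<Rightarrow> real" and C :: "'j \<Rightarrow> 'w::euclidean_space"
  assumes J: "finite J" and len: "\<And>j. j \<in> J \<Longrightarrow> length (js j) = m"
    and sym: "\<And>\<xi>. (\<Sum>j\<in>J. mpow \<xi> (js j) *\<^sub>R C j) = 0"
    and v: "smooth v" "torus_periodic v"
  shows "(\<Sum>j\<in>J. D (js j) v x *\<^sub>R C j) = 0"
proof -
  define L where "L u x = (\<Sum>j\<in>J. D (js j) u x *\<^sub>R C j)" for u :: "real^'d \<Rightarrow> real" and x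
  have L_add: "L (\<lambda>x. u x + u' x) x = L u x + L u' x" if "smooth u" "smooth u'" for u u' x
    by (simp add: L_def D_add[OF that] scaleR_add_left sum.distrib)
  have L_wave: "L (\<lambda>x. cos (\<eta> \<bullet> x + \<theta>) *\<^sub>R a) x = 0" for \<eta> \<theta> a x
  proof -
    have "L (\<lambda>x. cos (\<eta> \<bullet> x + \<theta>) *\<^sub>R a) x
      = (a * cos (\<eta> \<bullet> x + (\<theta> + m * (pi/2)))) *\<^sub>R (\<Sum>j\<in>J. mpow \<eta> (js j) *\<^sub>R C j)"
      unfolding L_def scaleR_sum_right
      by (rule sum.cong[OF refl], simp only: D_cos_scaleR len, simp add: mult_ac)
    then show ?thesis by (simp add: sym)
  qed
  have cD: "continuous_on UNIV (D js v)" for js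
    by (rule smooth_continuous_on[OF smooth_D[OF v(1)]])
  have cL: "continuous_on UNIV (L v)"
    unfolding L_def[abs_def] by (intro continuous_on_sum continuous_on_scaleR cD continuous_on_const)
  have pL: "torus_periodic (L v)"
    using D_periodic[OF v] unfolding torus_periodic_def L_def by simp
  have "L v x = 0" for x
  proof (rule zero_if_conv_zero[OF cL pL])
    fix f :: "real^'d \<Rightarrow> real" and x assume f: "trig_poly f"
    have cf: "continuous_on UNIV f" if "trig_poly f" for f :: "real^'d \<Rightarrow> real"
      using trig_poly_continuous[OF that] .
    have conv_L: "conv f (L v) x = L (conv f v) x" if "trig_poly f" for f x
    proof -
      have "conv f (L v) x = (\<Sum>j\<in>J. conv f (\<lambda>x. D (js j) v x *\<^sub>R C j) x)"
        unfolding L_def[abs_def]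
        by (rule conv_sum[OF cf[OF that] _ J]) (intro continuous_on_scaleR cD continuous_on_const)
      also have "\<dots> = L (conv f v) x"
        unfolding L_def smooth_conv(2)[OF cf[OF that] v(1)]
      proof (rule sum.cong[OF refl])
        fix j
        have "conv f (\<lambda>x. D (js j) v x *\<^sub>R C j) x
          = integral unit_cube (\<lambda>y. (f y *\<^sub>R D (js j) v (x - y)) *\<^sub>R C j)"
          by (simp add: conv_def)
        then show "conv f (\<lambda>x. D (js j) v x *\<^sub>R C j) x = conv f (D (js j) v) x *\<^sub>R C j"
          using integral_scaleR_const[OF conv_integrable[OF cf[OF that] cD, of "js j" x], of "C j"]
          by (simp only: conv_def)
      qed
      finally show ?thesis .
    qed
    from f have "conv f (L v) x = 0"
    proof (induction arbitrary: x)
      case (wave \<xi> c \<theta>)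
      obtain a b where ab: "conv (\<lambda>y. c * cos (((2*pi) *\<^sub>R \<xi>) \<bullet> y + \<theta>)) v
        = (\<lambda>x. cos (((2*pi) *\<^sub>R \<xi>) \<bullet> x + 0) *\<^sub>R a + cos (((2*pi) *\<^sub>R \<xi>) \<bullet> x + (- (pi/2))) *\<^sub>R b)"
        using conv_wave[OF wave smooth_continuous_on[OF v(1)] v(2)] by blast
      show ?case
        unfolding conv_L[OF trig_poly.wave[OF wave]] ab
        by (subst L_add) (simp_all only: L_wave smooth_cos_scaleR add_0)
    next
      case (add f g)
      then show ?case by (simp add: conv_add_left cf cL)
    qed
    then show "conv f (L v) x = 0" .
  qed
  then show ?thesis by (simp add: L_def)
qed

inductive wave_sum ::
    "(('d::finite \<Rightarrow> nat) \<Rightarrow> ('v::euclidean_space \<Rightarrow>\<^sub>L 'w::euclidean_space)) \<Rightarrow> nat \<Rightarrow>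
     (real^'d \<Rightarrow> 'v) \<Rightarrow> bool" for A k where
  zero: "wave_sum A k (\<lambda>x. 0)"
| wave: "lattice_vec \<xi> \<Longrightarrow> \<xi> \<noteq> 0 \<Longrightarrow> blinfun_apply (symbol A k ((2 * pi) *\<^sub>R \<xi>)) a = 0
    \<Longrightarrow> wave_sum A k (\<lambda>x. cos (((2 * pi) *\<^sub>R \<xi>) \<bullet> x + \<theta>) *\<^sub>R a)"
| add: "wave_sum A k u \<Longrightarrow> wave_sum A k v \<Longrightarrow> wave_sum A k (\<lambda>x. u x + v x)"

text \<open>The Fourier coefficients of a field in the kernel of the operator lie in the kernel of the
  symbol at their frequency; the frequency 0 drops out with the mean.\<close>

lemma wave_sum_conv:
  fixes u :: "real^'d::finite \<Rightarrow> 'v::euclidean_space"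
    and A :: "('d \<Rightarrow> nat) \<Rightarrow> ('v \<Rightarrow>\<^sub>L 'w::euclidean_space)"
  assumes f: "trig_poly f" and u: "smooth u" "torus_periodic u" "\<And>x. diff_op A k u x = 0"
    and mean: "integral unit_cube u = 0"
  shows "wave_sum A k (conv f u)"
  using f
proof induction
  case (wave \<xi> c \<theta>)
  let ?f = "\<lambda>y. c * cos (((2 * pi) *\<^sub>R \<xi>) \<bullet> y + \<theta>)"
  have cu: "continuous_on UNIV u" by (rule smooth_continuous_on[OF u(1)])
  have cf: "continuous_on UNIV ?f" and pf: "torus_periodic ?f"
    using trig_poly_continuous trig_poly_periodic trig_poly.wave[OF wave] by blast+
  show ?case
  proof (cases "\<xi> = 0")
    case True
    have "conv ?f u x = 0" for x
    proof -
      have "conv ?f u x = integral unit_cube (\<lambda>t. ?f (x - t) *\<^sub>R u t)"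
        by (rule conv_commute[OF cf cu pf u(2)])
      also have "\<dots> = integral unit_cube (\<lambda>t. (c * cos \<theta>) *\<^sub>R u t)" using True by simp
      finally show ?thesis using mean by (simp only: integral_cmul) simp
    qed
    then have "conv ?f u = (\<lambda>x. 0)" by (rule ext)
    then show ?thesis by (simp only: wave_sum.zero)
  next
    case False
    define \<eta> where "\<eta> = (2 * pi) *\<^sub>R \<xi>"
    have \<eta>0: "\<eta> \<noteq> 0" using False by (simp add: \<eta>_def)
    obtain a b where ab: "conv ?f u
      = (\<lambda>x. cos (\<eta> \<bullet> x + 0) *\<^sub>R a + cos (\<eta> \<bullet> x + (- (pi/2))) *\<^sub>R b)"
      using conv_wave[OF wave cu u(2)] unfolding \<eta>_def by blast
    have eq: "cos (\<eta> \<bullet> x + real k * (pi/2)) *\<^sub>R symbol A k \<eta> a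
        + cos (\<eta> \<bullet> x + real k * (pi/2) - pi/2) *\<^sub>R symbol A k \<eta> b = 0" for x
    proof -
      have "diff_op A k (conv ?f u) x = conv ?f (\<lambda>x. 0) x"
        unfolding diff_op_conv[OF cf u(1)] using u(3) by presburger
      then have "diff_op A k (conv ?f u) x = 0" by (simp add: conv_def)
      then have "diff_op A k (\<lambda>x. cos (\<eta> \<bullet> x + 0) *\<^sub>R a) x + diff_op A k (\<lambda>x. cos (\<eta> \<bullet> x + (- (pi/2))) *\<^sub>R b) x = 0"
        unfolding ab by (subst (asm) diff_op_add) (rule smooth_cos_scaleR)+
      moreover have "\<eta> \<bullet> x + (- (pi/2) + real k * (pi/2)) = \<eta> \<bullet> x + real k * (pi/2) - pi/2" by simp
      ultimately show ?thesis unfolding diff_op_cos by (simp only: add_0)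
    qed
    have val: "\<exists>x. \<eta> \<bullet> x + real k * (pi/2) = s" for s
      using \<eta>0 by (intro exI[of _ "((s - real k * (pi/2)) / (\<eta> \<bullet> \<eta>)) *\<^sub>R \<eta>"]) simp
    obtain x1 where "\<eta> \<bullet> x1 + real k * (pi/2) = 0" using val by blast
    then have a0: "symbol A k \<eta> a = 0" using eq[of x1] by simp
    obtain x2 where x2: "\<eta> \<bullet> x2 + real k * (pi/2) = pi/2" using val by blast
    have b0: "symbol A k \<eta> b = 0" using eq[of x2] unfolding x2 a0 by simp
    show ?thesis
      unfolding ab unfolding \<eta>_def
      using wave False a0 b0 unfolding \<eta>_def by (intro wave_sum.add wave_sum.wave)
  qed
next
  case (add f g)
  have "conv (\<lambda>y. f y + g y) u = (\<lambda>x. conv f u x + conv g u x)"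
    by (rule ext) (intro conv_add_left trig_poly_continuous add smooth_continuous_on[OF u(1)])
  then show ?case using add by (simp only:) (rule wave_sum.add)
qed

section \<open>Potentials for operators of constant rank\<close>

abbreviation words :: "nat \<Rightarrow> 'd list set" where
  "words m \<equiv> {js. length js = m}"

lemma finite_words [simp]: "finite (words m :: 'd::finite list set)"
  using finite_lists_length_eq[of "UNIV :: 'd set" m] by simp

definition hpoly :: "nat \<Rightarrow> (real^'d::finite \<Rightarrow> 'a::real_vector) \<Rightarrow> bool" where
  "hpoly m P \<longleftrightarrow> (\<exists>c. \<forall>\<xi>. P \<xi> = (\<Sum>js\<in>words m. mpow \<xi> js *\<^sub>R c js))"

lemma hpolyI: "(\<And>\<xi>. P \<xi> = (\<Sum>js\<in>words m. mpow \<xi> js *\<^sub>R c js)) \<Longrightarrow> hpoly m P"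
  unfolding hpoly_def by blast

lemma hpoly_diff: "hpoly m P \<Longrightarrow> hpoly m Q \<Longrightarrow> hpoly m (\<lambda>\<xi>. P \<xi> - Q \<xi>)"
proof -
  assume "hpoly m P" "hpoly m Q"
  then obtain c d where "\<And>\<xi>. P \<xi> = (\<Sum>js\<in>words m. mpow \<xi> js *\<^sub>R c js)"
    "\<And>\<xi>. Q \<xi> = (\<Sum>js\<in>words m. mpow \<xi> js *\<^sub>R d js)"
    unfolding hpoly_def by blast
  then show ?thesis
    by (intro hpolyI[where c = "\<lambda>js. c js - d js"]) (simp add: scaleR_diff_right sum_subtractf)
qed

lemma hpoly_linear:
  assumes L: "linear L" and "hpoly m P"
  shows "hpoly m (\<lambda>\<xi>. L (P \<xi>))"
proof -
  obtain c where "\<And>\<xi>. P \<xi> = (\<Sum>js\<in>words m. mpow \<xi> js *\<^sub>R c js)"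
    using assms(2) unfolding hpoly_def by blast
  then show ?thesis
    by (intro hpolyI[where c = "\<lambda>js. L (c js)"]) (simp add: linear_sum[OF L] linear_scale[OF L])
qed

lemma hpoly_bilinear:
  fixes P :: "real^'d::finite \<Rightarrow> 'a::real_normed_vector" and Q :: "real^'d \<Rightarrow> 'b::real_normed_vector"
  assumes B: "bounded_bilinear B" and "hpoly m P" "hpoly n Q"
  shows "hpoly (m + n) (\<lambda>\<xi>. B (P \<xi>) (Q \<xi>))"
proof -
  interpret bounded_bilinear B by (rule B)
  obtain c d where c: "\<And>\<xi>. P \<xi> = (\<Sum>js\<in>words m. mpow \<xi> js *\<^sub>R c js)"
    and d: "\<And>\<xi>. Q \<xi> = (\<Sum>js\<in>words n. mpow \<xi> js *\<^sub>R d js)"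
    using assms(2,3) unfolding hpoly_def by blast
  show ?thesis
  proof (rule hpolyI)
    fix \<xi> :: "real^'d"
    have "B (P \<xi>) (Q \<xi>) = (\<Sum>is\<in>words m. \<Sum>js\<in>words n. mpow \<xi> (is @ js) *\<^sub>R B (c is) (d js))"
      unfolding c d
      by (subst sum.swap) (simp add: sum_left sum_right scaleR_left scaleR_right mpow_append scaleR_sum_right mult.commute)
    also have "\<dots> = (\<Sum>(is, js)\<in>words m \<times> words n. mpow \<xi> (is @ js) *\<^sub>R B (c is) (d js))"
      by (rule sum.cartesian_product)
    also have "\<dots> = (\<Sum>zs\<in>words (m + n). mpow \<xi> zs *\<^sub>R B (c (take m zs)) (d (drop m zs)))"
      by (rule sum.reindex_bij_witness[where i = "\<lambda>zs. (take m zs, drop m zs)" and j = "\<lambda>(is, js). is @ js"])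
         auto
    finally show "B (P \<xi>) (Q \<xi>) = (\<Sum>zs\<in>words (m + n). mpow \<xi> zs *\<^sub>R B (c (take m zs)) (d (drop m zs)))" .
  qed
qed

lemma hpoly_inner: "hpoly 1 (\<lambda>\<xi> :: real^'d::finite. \<xi> \<bullet> \<eta>)"
proof (rule hpolyI)
  fix \<xi> :: "real^'d"
  have "(\<Sum>js\<in>words 1. mpow \<xi> js *\<^sub>R \<eta> $ hd js) = (\<Sum>i\<in>UNIV. \<xi> $ i * \<eta> $ i)"
    by (rule sum.reindex_bij_witness[where i = "\<lambda>i. [i]" and j = hd]) (auto simp: length_Suc_conv)
  then show "\<xi> \<bullet> \<eta> = (\<Sum>js\<in>words 1. mpow \<xi> js *\<^sub>R \<eta> $ hd js)"
    by (simp add: inner_vec_def)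
qed

lemma hpoly_symbol: "hpoly k (symbol A k)"
proof (rule hpolyI)
  fix \<xi> :: "real^'a"
  let ?c = "\<lambda>js. \<Sum>\<gamma>\<in>multi_indices k. if indices_of \<gamma> = js then A \<gamma> else 0"
  have "(\<Sum>js\<in>words k. mpow \<xi> js *\<^sub>R ?c js)
    = (\<Sum>js\<in>words k. \<Sum>\<gamma>\<in>multi_indices k. if indices_of \<gamma> = js then mpow \<xi> js *\<^sub>R A \<gamma> else 0)"
    by (simp add: scaleR_sum_right if_distrib[of "\<lambda>x. _ *\<^sub>R x"] cong: if_cong)
  also have "\<dots> = (\<Sum>\<gamma>\<in>multi_indices k. \<Sum>js\<in>words k. if indices_of \<gamma> = js then mpow \<xi> js *\<^sub>R A \<gamma> else 0)"
    by (rule sum.swap)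
  also have "\<dots> = symbol A k \<xi>"
    unfolding symbol_eq_mpow
    by (rule sum.cong[OF refl]) (simp add: sum.delta' length_indices_of multi_indices_def)
  finally show "symbol A k \<xi> = (\<Sum>js\<in>words k. mpow \<xi> js *\<^sub>R ?c js)" by simp
qed

text \<open>Gaussian elimination, without coordinates.  If \<open>q = w \<bullet> A e\<close> does not vanish at the base
  frequency, then \<open>A' X = q A X - (w \<bullet> A X) A e\<close> has rank one less than \<open>A\<close> wherever \<open>q \<noteq> 0\<close>,
  kills the kernel of \<open>A\<close>, and a polynomial solution of \<open>A' P' = 0\<close> yields the solution
  \<open>P = q P' - (w \<bullet> A P') e\<close> of \<open>A P = 0\<close>.  At rank 0 every vector solves the equation; the factor
  \<open>g\<close> collects the pivots, outside whose zeros the rank is under control.\<close>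

lemma polynomial_kernel:
  fixes A :: "real^'d::finite \<Rightarrow> ('v::euclidean_space \<Rightarrow>\<^sub>L 'w::euclidean_space)" and g :: "real^'d \<Rightarrow> real"
  assumes "hpoly k A" "hpoly l g" "g \<xi>\<^sub>0 \<noteq> 0" "dim (range (A \<xi>\<^sub>0)) = r"
    and "\<And>\<xi>. g \<xi> \<noteq> 0 \<Longrightarrow> dim (range (A \<xi>)) \<le> r" and "A \<xi>\<^sub>0 a = 0"
  shows "\<exists>m P t. hpoly m P \<and> (\<forall>\<xi>. A \<xi> (P \<xi>) = 0) \<and> t \<noteq> 0 \<and> P \<xi>\<^sub>0 = t *\<^sub>R a"
  using assms
proof (induction r arbitrary: k l A g)
  case 0
  have "A \<xi> (g \<xi> *\<^sub>R a) = 0" for \<xi>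
  proof (cases "g \<xi> = 0")
    case False
    then have "dim (range (A \<xi>)) = 0" using "0.prems"(5) by blast
    then show ?thesis by (auto simp: dim_eq_0 blinfun.scaleR_right)
  qed (simp add: blinfun.zero_right)
  moreover have "hpoly l (\<lambda>\<xi>. g \<xi> *\<^sub>R a)"
    using "0.prems"(2) by (intro hpoly_linear[of "\<lambda>s. s *\<^sub>R a"]) (auto intro: linearI simp: scaleR_add_left)
  ultimately show ?case
    using "0.prems"(3) by (intro exI[of _ l] exI[of _ "\<lambda>\<xi>. g \<xi> *\<^sub>R a"] exI[of _ "g \<xi>\<^sub>0"]) simp
next
  case (Suc r)
  have "\<exists>e. A \<xi>\<^sub>0 e \<noteq> 0"
  proof (rule ccontr)
    assume "\<nexists>e. A \<xi>\<^sub>0 e \<noteq> 0"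
    then have "dim (range (A \<xi>\<^sub>0)) = 0" by (auto simp: dim_eq_0)
    then show False using Suc.prems(4) by simp
  qed
  then obtain e where e: "A \<xi>\<^sub>0 e \<noteq> 0" by blast
  define w where "w = A \<xi>\<^sub>0 e"
  define q where "q \<xi> = A \<xi> e \<bullet> w" for \<xi>
  define A' where "A' \<xi> = q \<xi> *\<^sub>R A \<xi> - (blinfun_scaleR_left (A \<xi> e) o\<^sub>L (blinfun_inner_left w o\<^sub>L A \<xi>))" for \<xi>
  have A': "A' \<xi> X = q \<xi> *\<^sub>R A \<xi> X - (A \<xi> X \<bullet> w) *\<^sub>R A \<xi> e" for \<xi> X
    by (simp add: A'_def blinfun.diff_left blinfun.scaleR_left)
  have q0: "q \<xi>\<^sub>0 \<noteq> 0" using e by (simp add: q_def w_def)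
  have lin_e: "linear (\<lambda>T :: 'v \<Rightarrow>\<^sub>L 'w. T e)" and lin_w: "linear (\<lambda>y :: 'w. y \<bullet> w)"
    by (auto intro!: linearI simp: blinfun.add_left blinfun.scaleR_left inner_add_left)
  have hAe: "hpoly k (\<lambda>\<xi>. A \<xi> e)" by (rule hpoly_linear[OF lin_e Suc.prems(1)])
  have hq: "hpoly k q" unfolding q_def[abs_def] by (rule hpoly_linear[OF lin_w hAe])
  have hA': "hpoly (k + k) A'"
  proof -
    have "hpoly (k + k) (\<lambda>\<xi>. q \<xi> *\<^sub>R A \<xi>)"
      by (rule hpoly_bilinear[OF bounded_bilinear_scaleR hq Suc.prems(1)])
    moreover have "hpoly (k + k) (\<lambda>\<xi>. blinfun_scaleR_left (A \<xi> e) o\<^sub>L (blinfun_inner_left w o\<^sub>L A \<xi>))"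
    proof (rule hpoly_bilinear[OF bounded_bilinear_blinfun_compose])
      show "hpoly k (\<lambda>\<xi>. blinfun_scaleR_left (A \<xi> e))"
        by (rule hpoly_linear[OF bounded_linear.linear[OF bounded_linear_blinfun_scaleR_left] hAe])
      show "hpoly k (\<lambda>\<xi>. blinfun_inner_left w o\<^sub>L A \<xi>)"
        by (rule hpoly_linear[OF bounded_linear.linear[OF bounded_bilinear.bounded_linear_right[OF bounded_bilinear_blinfun_compose]] Suc.prems(1)])
    qed
    ultimately show ?thesis unfolding A'_def[abs_def] by (rule hpoly_diff)
  qed
  have hg: "hpoly (l + k) (\<lambda>\<xi>. g \<xi> * q \<xi>)"
    by (rule hpoly_bilinear[OF bounded_bilinear_mult Suc.prems(2) hq])
  have sub: "subspace (range (A \<xi>))" for \<xi>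
    by (rule linear_subspace_image[OF bounded_linear.linear[OF blinfun.bounded_linear_right] subspace_UNIV])
  have rank_le: "dim (range (A' \<xi>)) \<le> r" if "g \<xi> * q \<xi> \<noteq> 0" for \<xi>
  proof -
    let ?H = "range (A \<xi>) \<inter> {y. w \<bullet> y = 0}"
    have "subspace ?H" by (intro subspace_inter sub subspace_hyperplane)
    have "A' \<xi> X \<in> ?H" for X
    proof -
      have "A' \<xi> X = A \<xi> (q \<xi> *\<^sub>R X - (A \<xi> X \<bullet> w) *\<^sub>R e)"
        by (simp add: A' blinfun.diff_right blinfun.scaleR_right)
      moreover have "w \<bullet> A' \<xi> X = 0"
        by (simp add: A' inner_diff_right q_def inner_commute)
      ultimately show ?thesis by auto
    qed
    then have "dim (range (A' \<xi>)) \<le> dim ?H" by (intro dim_subset) auto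
    also have "\<dots> < dim (range (A \<xi>))"
    proof (rule dim_psubset)
      have n: "A \<xi> e \<notin> ?H" using that by (auto simp: q_def inner_commute)
      have s: "span ?H = ?H" "span (range (A \<xi>)) = range (A \<xi>)"
        using \<open>subspace ?H\<close> sub by (simp_all only: span_eq_iff)
      have "?H \<noteq> range (A \<xi>)"
      proof
        assume "?H = range (A \<xi>)"
        then have "A \<xi> e \<in> ?H" by (simp only: rangeI)
        then show False using n by (rule notE[rotated])
      qed
      then show "span ?H \<subset> span (range (A \<xi>))"
        unfolding s by (intro psubsetI Int_lower1)
    qed
    also have "\<dots> \<le> Suc r" using that Suc.prems(5) by simp
    finally show ?thesis by simp
  qed
  moreover have "dim (range (A' \<xi>\<^sub>0)) = r"
  proof (rule antisym)
    show "dim (range (A' \<xi>\<^sub>0)) \<le> r" using rank_le q0 Suc.prems(3) by simp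
    have "range (A \<xi>\<^sub>0) \<subseteq> span (insert (A \<xi>\<^sub>0 e) (range (A' \<xi>\<^sub>0)))"
    proof
      fix y assume "y \<in> range (A \<xi>\<^sub>0)"
      then obtain X where X: "y = A \<xi>\<^sub>0 X" by auto
      have "y = (1 / q \<xi>\<^sub>0) *\<^sub>R (A' \<xi>\<^sub>0 X + (A \<xi>\<^sub>0 X \<bullet> w) *\<^sub>R A \<xi>\<^sub>0 e)"
        unfolding A' X using q0 by simp
      also have "\<dots> \<in> span (insert (A \<xi>\<^sub>0 e) (range (A' \<xi>\<^sub>0)))"
        by (intro span_scale span_add) (auto intro: span_base)
      finally show "y \<in> span (insert (A \<xi>\<^sub>0 e) (range (A' \<xi>\<^sub>0)))" .
    qed
    then have "Suc r \<le> dim (insert (A \<xi>\<^sub>0 e) (range (A' \<xi>\<^sub>0)))"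
      using dim_subset[of "range (A \<xi>\<^sub>0)"] Suc.prems(4) by (metis dim_span)
    also have "\<dots> \<le> dim (range (A' \<xi>\<^sub>0)) + 1" by (simp add: dim_insert)
    finally show "r \<le> dim (range (A' \<xi>\<^sub>0))" by simp
  qed
  moreover have "A' \<xi>\<^sub>0 a = 0" using Suc.prems(6) by (simp add: A')
  moreover have "g \<xi>\<^sub>0 * q \<xi>\<^sub>0 \<noteq> 0" using q0 Suc.prems(3) by simp
  ultimately obtain m P t where P: "hpoly m P" "\<And>\<xi>. A' \<xi> (P \<xi>) = 0" "t \<noteq> 0" "P \<xi>\<^sub>0 = t *\<^sub>R a"
    using Suc.IH[OF hA' hg] by blast
  define R where "R \<xi> = q \<xi> *\<^sub>R P \<xi> - (A \<xi> (P \<xi>) \<bullet> w) *\<^sub>R e" for \<xi>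
  have "hpoly (k + m) R"
    unfolding R_def[abs_def]
  proof (rule hpoly_diff)
    show "hpoly (k + m) (\<lambda>\<xi>. q \<xi> *\<^sub>R P \<xi>)"
      by (rule hpoly_bilinear[OF bounded_bilinear_scaleR hq P(1)])
    have AP: "hpoly (k + m) (\<lambda>\<xi>. A \<xi> (P \<xi>))"
      by (rule hpoly_bilinear[OF bounded_bilinear_blinfun_apply Suc.prems(1) P(1)])
    have lin: "linear (\<lambda>y :: 'w. (y \<bullet> w) *\<^sub>R e)"
      by (auto intro!: linearI simp: inner_add_left scaleR_add_left)
    show "hpoly (k + m) (\<lambda>\<xi>. (A \<xi> (P \<xi>) \<bullet> w) *\<^sub>R e)" by (rule hpoly_linear[OF lin AP])
  qed
  moreover have "A \<xi> (R \<xi>) = 0" for \<xi>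
    using P(2)[of \<xi>] by (simp add: A' R_def blinfun.diff_right blinfun.scaleR_right)
  moreover have "R \<xi>\<^sub>0 = (q \<xi>\<^sub>0 * t) *\<^sub>R a"
    using Suc.prems(6) by (simp add: R_def P(4) blinfun.scaleR_right)
  ultimately show ?case using q0 P(3) by (metis mult_eq_0_iff)
qed

text \<open>The pivot polynomial \<open>\<xi> \<bullet> \<eta>\<close> starts the elimination: where it is nonzero, so is \<open>\<xi>\<close>, and the rank is
  the constant one.\<close>

lemma potential_exists:
  fixes A :: "('d::finite \<Rightarrow> nat) \<Rightarrow> ('v::euclidean_space \<Rightarrow>\<^sub>L 'w::euclidean_space)"
  assumes cr: "constant_rank A k" and \<eta>: "\<eta> \<noteq> 0" and a: "symbol A k \<eta> a = 0"
  obtains m c where "\<And>\<xi>. symbol A k \<xi> (\<Sum>js\<in>words m. mpow \<xi> js *\<^sub>R c js) = 0"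
    and "(\<Sum>js\<in>words m. mpow \<eta> js *\<^sub>R c js) = a"
proof -
  obtain r where r: "\<And>\<xi>. \<xi> \<noteq> 0 \<Longrightarrow> dim (range (symbol A k \<xi>)) = r"
    using cr unfolding constant_rank_def by blast
  have "\<exists>m P t. hpoly m P \<and> (\<forall>\<xi>. symbol A k \<xi> (P \<xi>) = 0) \<and> t \<noteq> 0 \<and> P \<eta> = t *\<^sub>R a"
  proof (rule polynomial_kernel[OF hpoly_symbol hpoly_inner[of \<eta>]])
    show "\<eta> \<bullet> \<eta> \<noteq> 0" using \<eta> by simp
    show "dim (range (symbol A k \<eta>)) = r" by (rule r[OF \<eta>])
    show "dim (range (symbol A k \<xi>)) \<le> r" if "\<xi> \<bullet> \<eta> \<noteq> 0" for \<xi>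
    proof -
      have "\<xi> \<noteq> 0" using that by auto
      then show ?thesis using r by simp
    qed
  qed (rule a)
  then obtain m P t where P: "hpoly m P" "\<And>\<xi>. symbol A k \<xi> (P \<xi>) = 0" "t \<noteq> 0" "P \<eta> = t *\<^sub>R a"
    by blast
  then obtain c where c: "\<And>\<xi>. P \<xi> = (\<Sum>js\<in>words m. mpow \<xi> js *\<^sub>R c js)"
    unfolding hpoly_def by blast
  have eq: "(\<Sum>js\<in>words m. mpow \<xi> js *\<^sub>R ((1/t) *\<^sub>R c js)) = (1/t) *\<^sub>R P \<xi>" for \<xi>
    by (simp add: c scaleR_sum_right mult.commute)
  show ?thesis
  proof (rule that)
    show "symbol A k \<xi> (\<Sum>js\<in>words m. mpow \<xi> js *\<^sub>R ((1/t) *\<^sub>R c js)) = 0" for \<xi>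
      unfolding eq by (simp add: blinfun.scaleR_right P(2))
    show "(\<Sum>js\<in>words m. mpow \<eta> js *\<^sub>R ((1/t) *\<^sub>R c js)) = a"
      unfolding eq by (simp add: P(3,4))
  qed
qed

lemma diff_op_potential:
  fixes A :: "('d::finite \<Rightarrow> nat) \<Rightarrow> ('v::euclidean_space \<Rightarrow>\<^sub>L 'w::euclidean_space)"
  assumes c: "\<And>\<xi>. symbol A k \<xi> (\<Sum>js\<in>words m. mpow \<xi> js *\<^sub>R c js) = 0"
    and v: "smooth v" "torus_periodic v"
  shows "diff_op A k (\<lambda>x. \<Sum>js\<in>words m. D js v x *\<^sub>R c js) x = 0"
proof -
  let ?J = "multi_indices k \<times> words m :: (('d \<Rightarrow> nat) \<times> 'd list) set"
  have "(\<Sum>p\<in>?J. D (indices_of (fst p) @ snd p) v x *\<^sub>R blinfun_apply (A (fst p)) (c (snd p))) = 0"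
  proof (rule operator_zero_if_symbol_zero[where m = "k + m"])
    show "finite ?J" by (simp add: finite_multi_indices)
    fix \<xi> :: "real^'d"
    have "symbol A k \<xi> (\<Sum>js\<in>words m. mpow \<xi> js *\<^sub>R c js)
      = (\<Sum>\<gamma>\<in>multi_indices k. \<Sum>js\<in>words m. mpow \<xi> (indices_of \<gamma> @ js) *\<^sub>R A \<gamma> (c js))"
      unfolding symbol_eq_mpow
      by (subst sum.swap) (simp add: mult.commute blinfun.sum_left blinfun.sum_right blinfun.scaleR_left blinfun.scaleR_right
          scaleR_sum_right mpow_append)
    then show "(\<Sum>p\<in>?J. mpow \<xi> (indices_of (fst p) @ snd p) *\<^sub>R blinfun_apply (A (fst p)) (c (snd p))) = 0"
      by (simp add: sum.cartesian_product c case_prod_beta)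
  qed (auto simp: length_indices_of multi_indices_def v)
  then have "(\<Sum>\<gamma>\<in>multi_indices k. \<Sum>js\<in>words m. D (indices_of \<gamma> @ js) v x *\<^sub>R A \<gamma> (c js)) = 0"
    by (simp add: sum.cartesian_product case_prod_beta)
  moreover have "D is (\<lambda>x. \<Sum>js\<in>words m. D js v x *\<^sub>R c js) x = (\<Sum>js\<in>words m. D (is @ js) v x *\<^sub>R c js)" for "is" x
  proof -
    have "smooth (\<lambda>x. D js v x *\<^sub>R c js)" for js
      by (rule smooth_linear[OF bounded_linear_scaleR_left smooth_D[OF v(1)]])
    then show ?thesis
      by (simp add: D_sum D_linear[OF bounded_linear_scaleR_left smooth_D[OF v(1)]] D_append)
  qed
  ultimately show ?thesis
    by (simp add: diff_op_eq_D blinfun.sum_right blinfun.scaleR_right)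
qed

subsection \<open>Localising oscillations\<close>

text \<open>Derivatives of a modulated wave are polynomials in the frequency scale; only the leading
  coefficient, where every derivative has hit the wave, matters below.\<close>

lemma D_modulated_wave:
  fixes \<phi> :: "real^'d::finite \<Rightarrow> real"
  assumes \<phi>: "smooth \<phi>"
  shows "\<exists>\<psi>. (\<forall>l. smooth (\<psi> l)) \<and> \<psi> (length js) = (\<lambda>x. mpow \<eta> js * \<phi> x) \<and>
    (\<forall>N. D js (\<lambda>x. \<phi> x * cos ((N *\<^sub>R \<eta>) \<bullet> x + \<theta>))
      = (\<lambda>x. \<Sum>l\<le>length js. N ^ l * (\<psi> l x * cos ((N *\<^sub>R \<eta>) \<bullet> x + (\<theta> + real l * (pi/2))))))"
proof (induction js)
  case Nil
  show ?case using \<phi> by (intro exI[of _ "\<lambda>l. \<phi>"]) simp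
next
  case (Cons j js)
  let ?n = "length js"
  obtain \<psi> where \<psi>: "\<And>l. smooth (\<psi> l)" "\<psi> ?n = (\<lambda>x. mpow \<eta> js * \<phi> x)"
    "\<And>N. D js (\<lambda>x. \<phi> x * cos ((N *\<^sub>R \<eta>) \<bullet> x + \<theta>))
      = (\<lambda>x. \<Sum>l\<le>?n. N ^ l * (\<psi> l x * cos ((N *\<^sub>R \<eta>) \<bullet> x + (\<theta> + real l * (pi/2)))))"
    using Cons.IH by blast
  define \<psi>' where "\<psi>' l x = (if l \<le> ?n then partial_deriv j (\<psi> l) x else 0)
    + (if l = 0 then 0 else \<eta> $ j * \<psi> (l - 1) x)" for l x
  have sm: "smooth (\<psi>' l)" for l
  proof -
    have "smooth (\<lambda>x. if l \<le> ?n then partial_deriv j (\<psi> l) x else 0)"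
      by (cases "l \<le> ?n") (simp_all add: smooth_partial_deriv[OF \<psi>(1)] smooth_const)
    moreover have "smooth (\<lambda>x. if l = 0 then 0 else \<eta> $ j * \<psi> (l - 1) x)"
      by (cases "l = 0") (simp_all add: smooth_const smooth_mult[OF smooth_const \<psi>(1)])
    ultimately show ?thesis unfolding \<psi>'_def[abs_def] by (rule smooth_add)
  qed
  have D: "D (j # js) (\<lambda>x. \<phi> x * cos ((N *\<^sub>R \<eta>) \<bullet> x + \<theta>))
      = (\<lambda>x. \<Sum>l\<le>Suc ?n. N ^ l * (\<psi>' l x * cos ((N *\<^sub>R \<eta>) \<bullet> x + (\<theta> + real l * (pi/2)))))" for N
  proof -
    define C where "C l x = cos ((N *\<^sub>R \<eta>) \<bullet> x + (\<theta> + real l * (pi/2)))" for l x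
    have smC: "smooth (C l)" for l
      using smooth_cos[of 1 "N *\<^sub>R \<eta>" "\<theta> + real l * (pi/2)"] by (simp add: C_def[abs_def])
    have pdC: "partial_deriv j (C l) = (\<lambda>x. N * \<eta> $ j * C (Suc l) x)" for l
      using partial_deriv_cos[of j 1 "N *\<^sub>R \<eta>" "\<theta> + real l * (pi/2)"]
      by (simp add: C_def[abs_def] algebra_simps add_divide_distrib)
    have sm1: "smooth (\<lambda>x. \<psi> l x * C l x)" for l by (intro smooth_mult \<psi>(1) smC)
    have pd1: "partial_deriv j (\<lambda>x. \<psi> l x * C l x)
      = (\<lambda>x. partial_deriv j (\<psi> l) x * C l x + N * (\<eta> $ j * \<psi> l x * C (Suc l) x))" for l
      using partial_deriv_scaleR_fun[OF \<psi>(1) smC, of j l l] by (simp add: pdC algebra_simps)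
    have "D [j] (\<lambda>x. \<Sum>l\<in>{..?n}. N ^ l * (\<psi> l x * C l x)) = (\<lambda>x. \<Sum>l\<in>{..?n}. D [j] (\<lambda>x. N ^ l * (\<psi> l x * C l x)) x)"
      by (rule D_sum) (intro smooth_mult smooth_const sm1)
    also have "\<dots> = (\<lambda>x. \<Sum>l\<le>?n. N ^ l * (partial_deriv j (\<psi> l) x * C l x + N * (\<eta> $ j * \<psi> l x * C (Suc l) x)))"
      using D_linear[OF bounded_linear_mult_right sm1, of "[j]"] by (simp add: pd1)
    also have "\<dots> = (\<lambda>x. \<Sum>l\<le>Suc ?n. N ^ l * (\<psi>' l x * C l x))"
    proof
      fix x
      have "(\<Sum>l\<le>Suc ?n. N ^ l * (\<psi>' l x * C l x))
        = (\<Sum>l\<le>Suc ?n. N ^ l * ((if l \<le> ?n then partial_deriv j (\<psi> l) x else 0) * C l x))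
         + (\<Sum>l\<le>Suc ?n. N ^ l * ((if l = 0 then 0 else \<eta> $ j * \<psi> (l - 1) x) * C l x))"
        by (simp only: \<psi>'_def sum.distrib[symmetric] distrib_left distrib_right)
      also have "(\<Sum>l\<le>Suc ?n. N ^ l * ((if l \<le> ?n then partial_deriv j (\<psi> l) x else 0) * C l x))
        = (\<Sum>l\<le>?n. N ^ l * (partial_deriv j (\<psi> l) x * C l x))"
        by simp
      also have "(\<Sum>l\<le>Suc ?n. N ^ l * ((if l = 0 then 0 else \<eta> $ j * \<psi> (l - 1) x) * C l x))
        = (\<Sum>l\<le>?n. N ^ l * (N * (\<eta> $ j * \<psi> l x * C (Suc l) x)))"
        by (subst sum.atMost_Suc_shift) (simp add: mult_ac)
      finally show "(\<Sum>l\<le>?n. N ^ l * (partial_deriv j (\<psi> l) x * C l x + N * (\<eta> $ j * \<psi> l x * C (Suc l) x)))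
        = (\<Sum>l\<le>Suc ?n. N ^ l * (\<psi>' l x * C l x))"
        by (simp only: distrib_left sum.distrib)
    qed
    finally show ?thesis unfolding C_def by (simp only: D_Cons D_Nil \<psi>(3))
  qed
  have "\<psi>' (length (j # js)) = (\<lambda>x. mpow \<eta> (j # js) * \<phi> x)"
    by (simp add: \<psi>'_def \<psi>(2) fun_eq_iff)
  then show ?case
    using sm D by (intro exI[of _ \<psi>'] conjI allI) simp_all
qed

lemma D_vanishes:
  assumes "smooth u" "open U" "\<And>x. x \<in> U \<Longrightarrow> u x = 0" "x \<in> U"
  shows "D js u x = 0"
  using assms(4)
proof (induction js arbitrary: x)
  case (Cons j js)
  then show ?case
    using truncate_derivative(3)[OF smooth_D[OF assms(1)] closed_empty assms(2), of js] by simp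
qed (use assms in simp)

lemma bounded_on_unit_cube:
  fixes f :: "real^'d::finite \<Rightarrow> real"
  assumes "continuous_on UNIV f"
  obtains B where "0 \<le> B" "\<And>x. x \<in> unit_cube \<Longrightarrow> \<bar>f x\<bar> \<le> B"
proof -
  have "compact (f ` unit_cube)"
    using continuous_on_subset[OF assms] by (intro compact_continuous_image) auto
  then have "bounded (f ` unit_cube)" by (rule compact_imp_bounded)
  then obtain B where "0 < B" "\<forall>y\<in>f ` unit_cube. norm y \<le> B" unfolding bounded_pos by blast
  then show ?thesis by (intro that[of B]) auto
qed

lemma wave_sum_smooth_periodic:
  assumes "wave_sum A k p"
  shows "smooth p" "torus_periodic p"
proof -
  show "smooth p" using assms
    by induction (rule smooth_const smooth_cos_scaleR smooth_add; assumption?)+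
  show "torus_periodic p" using assms
  proof induction
    case (wave \<xi> a \<theta>)
    then show ?case using wave_periodic[OF wave(1), of \<theta>] by (simp add: torus_periodic_def)
  qed (simp_all add: torus_periodic_def)
qed

text \<open>A field that approximates \<open>\<phi> q\<close> inside the kernel of the operator.  It is required to vanish on
  every open set where the cutoff does, so that it can be truncated to one period cell afterwards.\<close>

definition localises ::
    "(('d::finite \<Rightarrow> nat) \<Rightarrow> ('v::euclidean_space \<Rightarrow>\<^sub>L 'w::euclidean_space)) \<Rightarrow> nat \<Rightarrow>
     (real^'d \<Rightarrow> real) \<Rightarrow> (real^'d \<Rightarrow> 'v) \<Rightarrow> real \<Rightarrow> (real^'d \<Rightarrow> 'v) \<Rightarrow> bool" where
  "localises A k \<phi> q \<epsilon> u \<longleftrightarrow> smooth u \<and> (\<forall>x. diff_op A k u x = 0)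
    \<and> (\<forall>U. open U \<longrightarrow> (\<forall>x\<in>U. \<phi> x = 0) \<longrightarrow> (\<forall>x\<in>U. u x = 0))
    \<and> (\<forall>x\<in>unit_cube. norm (u x - \<phi> x *\<^sub>R q x) \<le> \<epsilon>)"

lemma localises_add:
  assumes 1: "localises A k \<phi> q1 \<epsilon>1 w1" and 2: "localises A k \<phi> q2 \<epsilon>2 w2"
  shows "localises A k \<phi> (\<lambda>x. q1 x + q2 x) (\<epsilon>1 + \<epsilon>2) (\<lambda>x. w1 x + w2 x)"
proof -
  have s: "smooth w1" "smooth w2" and z: "\<And>x. diff_op A k w1 x = 0" "\<And>x. diff_op A k w2 x = 0"
    using 1 2 by (simp_all add: localises_def)
  have "norm (w1 x + w2 x - \<phi> x *\<^sub>R (q1 x + q2 x)) \<le> \<epsilon>1 + \<epsilon>2" if "x \<in> unit_cube" for x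
  proof -
    have eq: "w1 x + w2 x - \<phi> x *\<^sub>R (q1 x + q2 x) = (w1 x - \<phi> x *\<^sub>R q1 x) + (w2 x - \<phi> x *\<^sub>R q2 x)"
      by (simp add: algebra_simps)
    have "norm (w1 x - \<phi> x *\<^sub>R q1 x) \<le> \<epsilon>1" "norm (w2 x - \<phi> x *\<^sub>R q2 x) \<le> \<epsilon>2"
      using 1 2 that by (simp_all add: localises_def)
    then show ?thesis unfolding eq by (rule norm_triangle_mono)
  qed
  moreover have "\<forall>x\<in>U. w1 x + w2 x = 0" if "open U" "\<forall>x\<in>U. \<phi> x = 0" for U
    using 1 2 that by (simp add: localises_def)
  ultimately show ?thesis
    unfolding localises_def by (simp add: smooth_add s diff_op_add[OF s] z)
qed

text \<open>Each wave is \<open>P(D)\<close> applied to a scalar wave, up to a power of the frequency.  Applying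
  \<open>P(D)\<close> after the cutoff instead keeps the field in the kernel of the operator at the cost of an
  error that is small for high frequency.\<close>

lemma localise_wave_sum:
  fixes A :: "('d::finite \<Rightarrow> nat) \<Rightarrow> ('v::euclidean_space \<Rightarrow>\<^sub>L 'w::euclidean_space)"
    and \<phi> :: "real^'d \<Rightarrow> real"
  assumes cr: "constant_rank A k" and p: "wave_sum A k p"
    and \<phi>: "smooth \<phi>" "torus_periodic \<phi>" and \<epsilon>: "\<epsilon> > 0"
  shows "\<exists>N\<^sub>0. \<forall>N\<ge>N\<^sub>0. \<exists>u. localises A k \<phi> (\<lambda>x. p (real N *\<^sub>R x)) \<epsilon> u"
  using p \<epsilon>
proof (induction arbitrary: \<epsilon>)
  case zero
  then have "localises A k \<phi> (\<lambda>x. 0) \<epsilon> (\<lambda>x. 0)"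
    by (simp add: localises_def smooth_const diff_op_zero)
  then show ?case by blast
next
  case (add u v)
  have "\<epsilon> / 2 > 0" using add.prems by simp
  obtain N1 where N1: "\<forall>N\<ge>N1. \<exists>w. localises A k \<phi> (\<lambda>x. u (real N *\<^sub>R x)) (\<epsilon> / 2) w"
    using add.IH(1)[OF \<open>\<epsilon> / 2 > 0\<close>] by (elim exE)
  obtain N2 where N2: "\<forall>N\<ge>N2. \<exists>w. localises A k \<phi> (\<lambda>x. v (real N *\<^sub>R x)) (\<epsilon> / 2) w"
    using add.IH(2)[OF \<open>\<epsilon> / 2 > 0\<close>] by (elim exE)
  show ?case
  proof (intro exI[of _ "max N1 N2"] allI impI)
    fix N assume N: "max N1 N2 \<le> N"
    then have "N1 \<le> N" "N2 \<le> N" by auto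
    obtain w1 where w1: "localises A k \<phi> (\<lambda>x. u (real N *\<^sub>R x)) (\<epsilon> / 2) w1"
      using N1 \<open>N1 \<le> N\<close> by blast
    obtain w2 where w2: "localises A k \<phi> (\<lambda>x. v (real N *\<^sub>R x)) (\<epsilon> / 2) w2"
      using N2 \<open>N2 \<le> N\<close> by blast
    show "\<exists>w. localises A k \<phi> (\<lambda>x. u (real N *\<^sub>R x) + v (real N *\<^sub>R x)) \<epsilon> w"
      using localises_add[OF w1 w2] by (intro exI) simp
  qed
next
  case (wave \<xi> a \<theta>)
  define \<eta> where "\<eta> = (2 * pi) *\<^sub>R \<xi>"
  have \<eta>0: "\<eta> \<noteq> 0" using wave(2) by (simp add: \<eta>_def)
  obtain m c where c: "\<And>\<zeta>. symbol A k \<zeta> (\<Sum>js\<in>words m. mpow \<zeta> js *\<^sub>R c js) = 0"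
    "(\<Sum>js\<in>words m. mpow \<eta> js *\<^sub>R c js) = a"
    by (rule potential_exists[OF cr \<eta>0 wave(3)[folded \<eta>_def]], rule that)
  \<comment> \<open>Each of the \<open>m\<close> derivatives will advance the phase by a quarter turn.\<close>
  define \<theta>' where "\<theta>' = \<theta> - real m * (pi/2)"
  have "\<forall>js. \<exists>\<psi>. (\<forall>l. smooth (\<psi> l)) \<and> \<psi> (length js) = (\<lambda>x. mpow \<eta> js * \<phi> x) \<and>
    (\<forall>N. D js (\<lambda>x. \<phi> x * cos ((N *\<^sub>R \<eta>) \<bullet> x + \<theta>'))
      = (\<lambda>x. \<Sum>l\<le>length js. N ^ l * (\<psi> l x * cos ((N *\<^sub>R \<eta>) \<bullet> x + (\<theta>' + real l * (pi/2))))))"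
    by (intro allI D_modulated_wave \<phi>(1))
  from choice[OF this] obtain \<psi> where
    all: "\<forall>js. (\<forall>l. smooth (\<psi> js l)) \<and> \<psi> js (length js) = (\<lambda>x. mpow \<eta> js * \<phi> x) \<and>
    (\<forall>N. D js (\<lambda>x. \<phi> x * cos ((N *\<^sub>R \<eta>) \<bullet> x + \<theta>'))
      = (\<lambda>x. \<Sum>l\<le>length js. N ^ l * (\<psi> js l x * cos ((N *\<^sub>R \<eta>) \<bullet> x + (\<theta>' + real l * (pi/2))))))"
    by (elim exE)
  have \<psi>1: "smooth (\<psi> js l)" for js l
    by (rule all[THEN spec, of js, THEN conjunct1, THEN spec])
  have \<psi>2: "\<psi> js (length js) = (\<lambda>x. mpow \<eta> js * \<phi> x)" for js
    by (rule all[THEN spec, of js, THEN conjunct2, THEN conjunct1])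
  have \<psi>3: "D js (\<lambda>x. \<phi> x * cos ((N *\<^sub>R \<eta>) \<bullet> x + \<theta>'))
      = (\<lambda>x. \<Sum>l\<le>length js. N ^ l * (\<psi> js l x * cos ((N *\<^sub>R \<eta>) \<bullet> x + (\<theta>' + real l * (pi/2)))))" for js N
    by (rule all[THEN spec, of js, THEN conjunct2, THEN conjunct2, THEN spec])
  have "\<exists>B\<ge>0. \<forall>x\<in>unit_cube. \<bar>\<psi> js l x\<bar> \<le> B" for js l
    by (rule bounded_on_unit_cube[OF smooth_continuous_on[OF \<psi>1], of js l]) blast
  then obtain B where B: "\<And>js l. 0 \<le> B js l" "\<And>js l x. x \<in> unit_cube \<Longrightarrow> \<bar>\<psi> js l x\<bar> \<le> B js l"
    by metis
  define M where "M = (\<Sum>js\<in>words m. \<Sum>l<m. B js l * norm (c js))"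
  have M0: "M \<ge> 0" unfolding M_def by (intro sum_nonneg mult_nonneg_nonneg B(1) norm_ge_zero)
  obtain N\<^sub>0 :: nat where N\<^sub>0: "N\<^sub>0 \<ge> 1" "M / \<epsilon> \<le> real N\<^sub>0"
    using real_arch_simple[of "max 1 (M / \<epsilon>)"] by auto
  show ?case
  proof (intro exI[of _ N\<^sub>0] allI impI)
    fix N assume "N\<^sub>0 \<le> N"
    then have N: "1 \<le> N" "M \<le> \<epsilon> * real N" 
      using N\<^sub>0 wave.prems by (auto simp: field_simps)
        (smt (verit) mult_left_mono of_nat_le_iff)
    define v where "v x = \<phi> x * cos ((real N *\<^sub>R \<eta>) \<bullet> x + \<theta>')" for x
    have sv: "smooth v"
      unfolding v_def[abs_def] using smooth_mult[OF \<phi>(1) smooth_cos[of 1 "real N *\<^sub>R \<eta>" \<theta>']] by simp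
    have pv: "torus_periodic v"
    proof -
      have "lattice_vec (real N *\<^sub>R \<xi>)" using wave(1) by (auto simp: lattice_vec_def)
      note W = wave_periodic[OF this, of \<theta>']
      have "real N *\<^sub>R \<eta> = (2 * pi) *\<^sub>R (real N *\<^sub>R \<xi>)" by (simp add: \<eta>_def mult.commute)
      then show ?thesis
        unfolding torus_periodic_def v_def
        by (intro allI) (simp only: W[unfolded torus_periodic_def, rule_format] \<phi>(2)[unfolded torus_periodic_def, rule_format])
    qed
    define u where "u x = (1 / real N ^ m) *\<^sub>R (\<Sum>js\<in>words m. D js v x *\<^sub>R c js)" for x
    have sP: "smooth (\<lambda>x. \<Sum>js\<in>words m. D js v x *\<^sub>R c js)"
      by (rule smooth_sum) (rule smooth_linear[OF bounded_linear_scaleR_left smooth_D[OF sv]])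
    have "localises A k \<phi> (\<lambda>x. cos (((2 * pi) *\<^sub>R \<xi>) \<bullet> (real N *\<^sub>R x) + \<theta>) *\<^sub>R a) \<epsilon> u"
      unfolding localises_def
    proof (intro conjI allI impI ballI)
      show "smooth u" unfolding u_def[abs_def] by (rule smooth_scaleR[OF sP])
      show "diff_op A k u x = 0" for x
        unfolding u_def[abs_def] diff_op_scaleR[OF sP] diff_op_potential[OF c(1) sv pv] by simp
      show "u x = 0" if "open U" "\<forall>x\<in>U. \<phi> x = 0" "x \<in> U" for U x
      proof -
        have "D js v x = 0" for js
          by (rule D_vanishes[OF sv that(1) _ that(3)]) (simp add: v_def that(2))
        then show ?thesis by (simp add: u_def)
      qed
      fix x :: "real^'d" assume x: "x \<in> unit_cube"
      define C where "C l = cos ((real N *\<^sub>R \<eta>) \<bullet> x + (\<theta>' + real l * (pi/2)))" for l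
      have Dv: "D js v x = real N ^ m * (mpow \<eta> js * \<phi> x * C m) + (\<Sum>l<m. real N ^ l * (\<psi> js l x * C l))"
        if "js \<in> words m" for js
      proof -
        have "D js v x = (\<Sum>l\<le>length js. real N ^ l * (\<psi> js l x * C l))"
          unfolding v_def[abs_def] \<psi>3 C_def ..
        also have "\<dots> = real N ^ m * (\<psi> js m x * C m) + (\<Sum>l<m. real N ^ l * (\<psi> js l x * C l))"
          using that by (simp add: lessThan_Suc_atMost[symmetric])
        finally show ?thesis using \<psi>2[of js] that by simp
      qed
      have "(\<Sum>js\<in>words m. D js v x *\<^sub>R c js)
        = (\<Sum>js\<in>words m. (real N ^ m * \<phi> x * C m) *\<^sub>R (mpow \<eta> js *\<^sub>R c js)
            + (\<Sum>l<m. real N ^ l * (\<psi> js l x * C l)) *\<^sub>R c js)"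
        by (rule sum.cong[OF refl]) (simp add: Dv scaleR_add_left mult_ac)
      also have "\<dots> = (real N ^ m * \<phi> x * C m) *\<^sub>R a
            + (\<Sum>js\<in>words m. (\<Sum>l<m. real N ^ l * (\<psi> js l x * C l)) *\<^sub>R c js)"
        by (simp only: sum.distrib scaleR_sum_right[symmetric] c(2))
      finally have "u x = (\<phi> x * C m) *\<^sub>R a
            + (1 / real N ^ m) *\<^sub>R (\<Sum>js\<in>words m. (\<Sum>l<m. real N ^ l * (\<psi> js l x * C l)) *\<^sub>R c js)"
        using N(1) by (simp add: u_def scaleR_add_right)
      moreover have "C m = cos (((2 * pi) *\<^sub>R \<xi>) \<bullet> (real N *\<^sub>R x) + \<theta>)"
        by (simp add: C_def \<theta>'_def \<eta>_def mult_ac)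
      ultimately have "u x - \<phi> x *\<^sub>R cos (((2 * pi) *\<^sub>R \<xi>) \<bullet> (real N *\<^sub>R x) + \<theta>) *\<^sub>R a
        = (1 / real N ^ m) *\<^sub>R (\<Sum>js\<in>words m. (\<Sum>l<m. real N ^ l * (\<psi> js l x * C l)) *\<^sub>R c js)"
        by simp
      then have "norm (u x - \<phi> x *\<^sub>R cos (((2 * pi) *\<^sub>R \<xi>) \<bullet> (real N *\<^sub>R x) + \<theta>) *\<^sub>R a)
        = norm (\<Sum>js\<in>words m. (\<Sum>l<m. real N ^ l * (\<psi> js l x * C l)) *\<^sub>R c js) / real N ^ m"
        by simp
      also have "norm (\<Sum>js\<in>words m. (\<Sum>l<m. real N ^ l * (\<psi> js l x * C l)) *\<^sub>R c js)
        \<le> (\<Sum>js\<in>words m. (\<Sum>l<m. real N ^ (m - 1) * B js l) * norm (c js))"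
      proof (rule sum_norm_le)
        fix js
        have "norm (\<Sum>l<m. real N ^ l * (\<psi> js l x * C l)) \<le> (\<Sum>l<m. real N ^ (m - 1) * B js l)"
        proof (rule sum_norm_le)
          fix l assume "l \<in> {..<m}"
          then have "l < m" by simp
          have "\<bar>\<psi> js l x * C l\<bar> \<le> B js l * 1"
            unfolding abs_mult by (intro mult_mono B x) (auto simp: C_def B(1))
          moreover have "real N ^ l \<le> real N ^ (m - 1)"
            using \<open>l < m\<close> N(1) by (intro power_increasing) auto
          ultimately have "real N ^ l * \<bar>\<psi> js l x * C l\<bar> \<le> real N ^ (m - 1) * B js l"
            by (intro mult_mono) auto
          then show "norm (real N ^ l * (\<psi> js l x * C l)) \<le> real N ^ (m - 1) * B js l"
            by (simp add: abs_mult)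
        qed
        then show "norm ((\<Sum>l<m. real N ^ l * (\<psi> js l x * C l)) *\<^sub>R c js)
          \<le> (\<Sum>l<m. real N ^ (m - 1) * B js l) * norm (c js)"
          by (simp add: mult_right_mono)
      qed
      also have "(\<Sum>js\<in>words m. (\<Sum>l<m. real N ^ (m - 1) * B js l) * norm (c js)) = real N ^ (m - 1) * M"
        by (simp add: M_def sum_distrib_left sum_distrib_right mult_ac)
      also have "real N ^ (m - 1) * M / real N ^ m \<le> \<epsilon>"
      proof (cases m)
        case 0
        then show ?thesis using wave.prems by (simp add: M_def)
      next
        case (Suc m')
        then have e: "real N ^ (m - 1) * M / real N ^ m = M / real N" using N(1) by simp
        have "M / real N \<le> \<epsilon>" using N by (simp add: field_simps)
        then show ?thesis by (simp only: e)
      qed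
      finally show "norm (u x - \<phi> x *\<^sub>R cos (((2 * pi) *\<^sub>R \<xi>) \<bullet> (real N *\<^sub>R x) + \<theta>) *\<^sub>R a) \<le> \<epsilon>"
        by (simp add: divide_right_mono)
    qed
    then show "\<exists>u. localises A k \<phi> (\<lambda>x. cos (((2 * pi) *\<^sub>R \<xi>) \<bullet> (real N *\<^sub>R x) + \<theta>) *\<^sub>R a) \<epsilon> u"
      by blast
  qed
qed

subsection \<open>Compactly supported fields in the unit cube\<close>

text \<open>Fields supported in the open unit cube can be scaled and pasted side by side without destroying
  the differential constraint, which periodic fields cannot.\<close>

definition core_fields ::
    "(('d::finite \<Rightarrow> nat) \<Rightarrow> ('v::euclidean_space \<Rightarrow>\<^sub>L 'w::euclidean_space)) \<Rightarrow> nat \<Rightarrow>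
     (real^'d \<Rightarrow> 'v) set" where
  "core_fields A k = {w. smooth w \<and> (\<forall>x. diff_op A k w x = 0) \<and>
     (\<exists>K. compact K \<and> K \<subseteq> box 0 (\<chi> i. 1) \<and> (\<forall>x. x \<notin> K \<longrightarrow> w x = 0))}"

text \<open>Vanishes exactly on the faces of the lattice cells.  The cutoff built from it is periodic and zero
  near these faces; hence the potential can be applied to periodic functions, and the result
  truncated to one cell.\<close>

definition face_weight :: "real^'d::finite \<Rightarrow> real" where
  "face_weight x = (\<Prod>i\<in>UNIV. (1 - cos (2 * pi * x $ i)) / 2)"

definition cutoff :: "nat \<Rightarrow> real^'d::finite \<Rightarrow> real" where
  "cutoff n x = flat [:1:] (real n * face_weight x - 1)"

lemma smooth_face_weight: "smooth (face_weight :: real^'d::finite \<Rightarrow> real)"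
proof -
  have "smooth (\<lambda>x :: real^'d. 1/2 + (- 1/2) * cos (((2 * pi) *\<^sub>R axis i 1) \<bullet> x + 0))" for i
    by (rule smooth_add[OF smooth_const smooth_cos])
  then have "smooth (\<lambda>x :: real^'d. (1 - cos (2 * pi * x $ i)) / 2)" for i
    by (simp add: inner_axis' diff_divide_distrib)
  then show ?thesis unfolding face_weight_def[abs_def] by (rule smooth_prod)
qed

lemma smooth_cutoff: "smooth (cutoff n :: real^'d::finite \<Rightarrow> real)"
proof -
  have "smooth (\<lambda>x :: real^'d. real n * face_weight x + (- 1))"
    by (rule smooth_add[OF smooth_mult[OF smooth_const smooth_face_weight] smooth_const])
  from smooth_flat[OF this] show ?thesis unfolding cutoff_def[abs_def] by simp
qed

lemma periodic_cutoff: "torus_periodic (cutoff n :: real^'d::finite \<Rightarrow> real)"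
proof -
  have "cos (2 * pi * (x + axis i 1) $ j) = cos (2 * pi * x $ j)" for i j and x :: "real^'d"
  proof (cases "i = j")
    case True
    have "2 * pi * (x + axis i 1) $ j = 2 * pi * x $ j + 2 * pi" using True by (simp add: algebra_simps)
    then show ?thesis by (simp only: cos_periodic)
  qed (simp add: axis_def)
  then show ?thesis by (simp add: torus_periodic_def cutoff_def face_weight_def)
qed

lemma cutoff_bounds: "0 \<le> cutoff n x" "cutoff n x \<le> 1"
  by (simp_all add: cutoff_def flat_def)

lemma face_weight_pos: "x \<in> box 0 (\<chi> i. 1) \<Longrightarrow> 0 < face_weight x"
  unfolding face_weight_def
proof (rule prod_pos)
  fix i assume x: "x \<in> box 0 (\<chi> i. 1)"
  have "cos (2 * pi * x $ i) \<noteq> 1"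
  proof
    assume "cos (2 * pi * x $ i) = 1"
    then obtain n :: int where "2 * pi * x $ i = of_int n * 2 * pi" using cos_one_2pi_int by auto
    then have n: "x $ i = of_int n" by simp
    have "0 < x $ i" "x $ i < 1" using x by (simp_all add: mem_box_cart)
    then have "0 < n" "n < 1" unfolding n by simp_all
    then show False by simp
  qed
  then have "cos (2 * pi * x $ i) < 1"
    using cos_le_one[of "2 * pi * x $ i"] by (rule order.not_eq_order_implies_strict)
  then show "0 < (1 - cos (2 * pi * x $ i)) / 2" by simp
qed

lemma face_weight_zero:
  assumes "x \<in> unit_cube" "x \<notin> box 0 (\<chi> i. 1)"
  shows "face_weight x = 0"
proof -
  obtain i where "\<not> (0 < x $ i \<and> x $ i < 1)" using assms(2) by (auto simp: mem_box_cart)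
  moreover have "0 \<le> x $ i" "x $ i \<le> 1" using assms(1) by (simp_all add: mem_unit_cube)
  ultimately have "x $ i = 0 \<or> x $ i = 1" by linarith
  then show ?thesis by (auto simp: face_weight_def intro!: exI[of _ i])
qed

lemma integral_cutoff: "(\<lambda>n. integral unit_cube (\<lambda>x :: real^'d::finite. 1 - cutoff n x)) \<longlonglongrightarrow> 0"
proof -
  let ?B = "box 0 (\<chi> i. 1) :: (real^'d) set"
  have c: "(\<lambda>x :: real^'d. 1 - cutoff n x) integrable_on unit_cube" for n
    by (intro integrable_continuous continuous_on_diff continuous_on_const smooth_continuous_on smooth_cutoff)
  then have cB: "(\<lambda>x :: real^'d. 1 - cutoff n x) integrable_on ?B" for n
    using integrable_on_open_interval by blast
  have "(\<lambda>n. integral ?B (\<lambda>x :: real^'d. 1 - cutoff n x)) \<longlonglongrightarrow> integral ?B (\<lambda>x. 0)"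
  proof (rule dominated_convergence(2)[where h = "\<lambda>x. 1", OF cB])
    show "(\<lambda>x. 1 :: real) integrable_on ?B"
      using integrable_on_open_interval integrable_const by blast
    show "norm (1 - cutoff n x) \<le> 1" for n and x :: "real^'d"
      using cutoff_bounds[of n x] by simp
    show "(\<lambda>n. 1 - cutoff n x) \<longlonglongrightarrow> 0" if "x \<in> ?B" for x
    proof -
      have lim: "filterlim (\<lambda>n. - 1 + face_weight x * real n) at_top sequentially"
        by (rule filterlim_tendsto_add_at_top[OF tendsto_const
            filterlim_tendsto_pos_mult_at_top[OF tendsto_const face_weight_pos[OF that] filterlim_real_sequentially]])
      have "(\<lambda>n. exp (- inverse (- 1 + face_weight x * real n))) \<longlonglongrightarrow> exp (- 0)"
        by (intro tendsto_exp tendsto_minus filterlim_compose[OF tendsto_inverse_0_at_top lim] filterlim_ident)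
      then have "(\<lambda>n. exp (- inverse (- 1 + face_weight x * real n))) \<longlonglongrightarrow> 1" by simp
      moreover have "\<forall>\<^sub>F n in sequentially. 0 < - 1 + face_weight x * real n"
        by (rule eventually_compose_filterlim[OF eventually_gt_at_top lim])
      then have "\<forall>\<^sub>F n in sequentially. exp (- inverse (- 1 + face_weight x * real n)) = cutoff n x"
        by eventually_elim (simp add: cutoff_def flat_def mult.commute inverse_eq_divide)
      ultimately have "(\<lambda>n. cutoff n x) \<longlonglongrightarrow> 1" by (rule Lim_transform_eventually)
      from tendsto_diff[OF tendsto_const[of 1] this] show ?thesis by simp
    qed
  qed
  then show ?thesis by (simp add: integral_open_interval)
qed

lemma lipschitz_continuous:
  fixes F :: "'v::euclidean_space \<Rightarrow> real"
  assumes L: "\<And>X Y. \<bar>F X - F Y\<bar> \<le> L * norm (X - Y)"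
  shows "continuous_on S F"
proof -
  have "dist (F X) (F Y) \<le> \<bar>L\<bar> * dist X Y" for X Y
  proof -
    have "L * norm (X - Y) \<le> \<bar>L\<bar> * norm (X - Y)" by (rule mult_right_mono) auto
    then show ?thesis using L[of X Y] by (simp add: dist_norm)
  qed
  then have "\<bar>L\<bar>-lipschitz_on S F" by (simp add: lipschitz_on_def)
  then show ?thesis by (rule lipschitz_on_continuous_on)
qed

lemma lipschitz_field_integrable:
  fixes F :: "'v::euclidean_space \<Rightarrow> real" and u :: "real^'d::finite \<Rightarrow> 'v"
  assumes L: "\<And>X Y. \<bar>F X - F Y\<bar> \<le> L * norm (X - Y)" and u: "continuous_on UNIV u"
  shows "continuous_on UNIV (\<lambda>x. F (X + u x))" "(\<lambda>x. F (X + u x)) integrable_on cbox a b"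
proof -
  show c: "continuous_on UNIV (\<lambda>x. F (X + u x))"
    by (rule continuous_on_compose2[OF lipschitz_continuous[OF L, of UNIV]])
       (intro continuous_on_add continuous_on_const u, simp)
  show "(\<lambda>x. F (X + u x)) integrable_on cbox a b"
    by (rule integrable_continuous) (rule continuous_on_subset[OF c], simp)
qed

lemma core_field_from_localised:
  assumes loc: "localises A k (cutoff n) q \<epsilon> u"
  obtains w where "w \<in> core_fields A k" "\<And>x. x \<in> unit_cube \<Longrightarrow> w x = u x"
proof -
  have s: "smooth u" and z: "\<And>x. diff_op A k u x = 0"
    and v: "\<And>U x. open U \<Longrightarrow> \<forall>x\<in>U. cutoff n x = 0 \<Longrightarrow> x \<in> U \<Longrightarrow> u x = 0"
    using loc by (auto simp: localises_def)
  define w where "w x = (if x \<in> unit_cube then u x else 0)" for x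
  have cfw: "continuous_on UNIV (\<lambda>x :: real^'a. real n * face_weight x)"
    by (intro continuous_on_mult continuous_on_const smooth_continuous_on smooth_face_weight)
  define U where "U = {x :: real^'a. real n * face_weight x < 1}"
  have "open U" unfolding U_def by (intro open_Collect_less cfw continuous_on_const)
  have U0: "u x = 0" if "x \<in> U" for x
    by (rule v[OF \<open>open U\<close> _ that]) (simp add: U_def cutoff_def flat_def)
  have fr: "frontier unit_cube \<subseteq> U"
  proof
    fix x :: "real^'a" assume "x \<in> frontier unit_cube"
    then have "x \<in> unit_cube" "x \<notin> box 0 (\<chi> i. 1)" by (auto simp: frontier_def)
    then show "x \<in> U" by (simp add: U_def face_weight_zero)
  qed
  note tr = smooth_truncate[OF s closed_cbox \<open>open U\<close> fr U0]
  have "smooth w" unfolding w_def[abs_def] by (rule tr(1))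
  moreover have "diff_op A k w x = 0" for x
  proof -
    have "D js w x = (if x \<in> unit_cube then D js u x else 0)" for js
      unfolding w_def[abs_def] by (simp only: tr(2))
    then have "diff_op A k w x = (if x \<in> unit_cube then diff_op A k u x else 0)"
      by (simp add: diff_op_eq_D blinfun.zero_right)
    then show ?thesis by (simp add: z)
  qed
  moreover have "compact (unit_cube - U)" using \<open>open U\<close> by (rule compact_diff[OF compact_cbox])
  moreover have "unit_cube - U \<subseteq> box 0 (\<chi> i. 1)"
    by (auto simp: U_def face_weight_zero)
  moreover have "w x = 0" if "x \<notin> unit_cube - U" for x
    using that U0 by (auto simp: w_def)
  ultimately have "w \<in> core_fields A k" unfolding core_fields_def by blast
  moreover have "w x = u x" if "x \<in> unit_cube" for x using that by (simp add: w_def)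
  ultimately show ?thesis by (rule that)
qed

text \<open>Periodic wave sums can be traded for compactly supported fields: speed up the wave, which
  does not change averages over the cube, and localise; the boundary layer has small volume.\<close>

lemma core_field_recovery:
  fixes A :: "('d::finite \<Rightarrow> nat) \<Rightarrow> ('v::euclidean_space \<Rightarrow>\<^sub>L 'w::euclidean_space)" and F :: "'v \<Rightarrow> real"
  assumes cr: "constant_rank A k" and p: "wave_sum A k p"
    and L: "\<And>X Y. \<bar>F X - F Y\<bar> \<le> L * norm (X - Y)" "0 \<le> L" and \<epsilon>: "\<epsilon> > 0"
  shows "\<exists>w\<in>core_fields A k. integral unit_cube (\<lambda>x. F (X + w x)) \<le> integral unit_cube (\<lambda>x. F (X + p x)) + \<epsilon>"
proof -
  note pp = wave_sum_smooth_periodic[OF p]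
  have cp: "continuous_on UNIV p" by (rule smooth_continuous_on[OF pp(1)])
  obtain M where M: "M > 0" "\<And>x. norm (p x) \<le> M"
    using periodic_uniform(2)[OF cp pp(2)] unfolding bounded_pos by auto
  have "(\<lambda>n. L * M * integral unit_cube (\<lambda>x :: real^'d. 1 - cutoff n x)) \<longlonglongrightarrow> L * M * 0"
    by (intro tendsto_mult tendsto_const integral_cutoff)
  then have "\<forall>\<^sub>F n in sequentially. L * M * integral unit_cube (\<lambda>x :: real^'d. 1 - cutoff n x) < \<epsilon> / 2"
    using \<epsilon> by (intro order_tendstoD(2)) auto
  then obtain n where n: "L * M * integral unit_cube (\<lambda>x :: real^'d. 1 - cutoff n x) < \<epsilon> / 2"
    by (meson eventually_sequentially order_refl)
  define \<delta> where "\<delta> = \<epsilon> / (2 * (L + 1))"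
  have \<delta>: "\<delta> > 0" using \<epsilon> L(2) by (simp add: \<delta>_def)
  have L\<delta>: "L * \<delta> \<le> \<epsilon> / 2" using \<epsilon> L(2) by (simp add: \<delta>_def field_simps)
  obtain N\<^sub>0 where "\<forall>N\<ge>N\<^sub>0. \<exists>u. localises A k (cutoff n) (\<lambda>x. p (real N *\<^sub>R x)) \<delta> u"
    using localise_wave_sum[OF cr p smooth_cutoff[of n] periodic_cutoff[of n] \<delta>] by (elim exE)
  then obtain N u where N: "N \<ge> 1" "localises A k (cutoff n) (\<lambda>x. p (real N *\<^sub>R x)) \<delta> u"
    by (meson max.cobounded1 max.cobounded2)
  obtain w where w: "w \<in> core_fields A k" "\<And>x. x \<in> unit_cube \<Longrightarrow> w x = u x"
    using core_field_from_localised[OF N(2)] by metis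
  have cw: "continuous_on UNIV w" using w(1) by (auto simp: core_fields_def smooth_continuous_on)
  have cpN: "continuous_on UNIV (\<lambda>x. p (real N *\<^sub>R x))"
    by (rule continuous_on_compose2[OF cp]) (auto intro!: continuous_intros)
  have icut: "(\<lambda>x :: real^'d. 1 - cutoff n x) integrable_on unit_cube"
    by (intro integrable_continuous continuous_on_diff continuous_on_const smooth_continuous_on smooth_cutoff)
  have pw: "F (X + w x) \<le> F (X + p (real N *\<^sub>R x)) + (L * \<delta> + L * M * (1 - cutoff n x))"
    if x: "x \<in> unit_cube" for x
  proof -
    let ?q = "p (real N *\<^sub>R x)"
    have "norm (w x - ?q) \<le> norm (w x - cutoff n x *\<^sub>R ?q) + norm (cutoff n x *\<^sub>R ?q - ?q)"
      using norm_triangle_ineq[of "w x - cutoff n x *\<^sub>R ?q" "cutoff n x *\<^sub>R ?q - ?q"] by simp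
    also have "norm (w x - cutoff n x *\<^sub>R ?q) \<le> \<delta>"
      using N(2) x by (simp add: localises_def w(2))
    also have "norm (cutoff n x *\<^sub>R ?q - ?q) = (1 - cutoff n x) * norm ?q"
    proof -
      have "cutoff n x *\<^sub>R ?q - ?q = (cutoff n x - 1) *\<^sub>R ?q" by (simp add: scaleR_diff_left)
      then show ?thesis using cutoff_bounds[of n x] by simp
    qed
    also have "\<dots> \<le> (1 - cutoff n x) * M"
      using cutoff_bounds[of n x] M(2) by (intro mult_left_mono) auto
    finally have "L * norm (w x - ?q) \<le> L * (\<delta> + (1 - cutoff n x) * M)"
      using L(2) by (intro mult_left_mono) auto
    moreover have "F (X + w x) - F (X + ?q) \<le> L * norm (w x - ?q)"
      using L(1)[of "X + w x" "X + ?q"] by simp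
    ultimately show ?thesis by (simp add: algebra_simps)
  qed
  have "integral unit_cube (\<lambda>x. F (X + w x))
    \<le> integral unit_cube (\<lambda>x. F (X + p (real N *\<^sub>R x)) + (L * \<delta> + L * M * (1 - cutoff n x)))"
    by (intro integral_le lipschitz_field_integrable[OF L(1)] cw cpN integrable_add integrable_const pw
        integrable_on_mult_right icut)
  also have "\<dots> = integral unit_cube (\<lambda>x. F (X + p (real N *\<^sub>R x)))
     + integral unit_cube (\<lambda>x :: real^'d. L * \<delta> + L * M * (1 - cutoff n x))"
    by (intro HK_integral_add lipschitz_field_integrable[OF L(1)] cpN
        integrable_add integrable_const integrable_on_mult_right icut)
  also have "integral unit_cube (\<lambda>x :: real^'d. L * \<delta> + L * M * (1 - cutoff n x))
     = L * \<delta> + L * M * integral unit_cube (\<lambda>x :: real^'d. 1 - cutoff n x)"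
    using HK_integral_add[OF integrable_const integrable_on_mult_right[OF icut],
        of "L * \<delta>" "L * M"] by simp
  also have "integral unit_cube (\<lambda>x. F (X + p (real N *\<^sub>R x))) = integral unit_cube (\<lambda>x. F (X + p x))"
  proof (rule integral_periodic_dilate[OF _ _ N(1)])
    show "continuous_on UNIV (\<lambda>x. F (X + p x))" by (rule lipschitz_field_integrable[OF L(1) cp])
    show "torus_periodic (\<lambda>x. F (X + p x))" using pp(2) by (simp add: torus_periodic_def)
  qed
  finally show ?thesis using n L\<delta> w(1) by (intro bexI[of _ w]) auto
qed

section \<open>The quasiconvex envelope\<close>

text \<open>The infimum runs over compactly supported fields.  For the bounds used here this is as good as
  periodic fields, and it makes the envelope quasiconvex by pasting.  Lipschitz continuity of the
  integrand passes to the envelope as an infimum of translates.\<close>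

locale lipschitz_integrand =
  fixes A :: "('d::finite \<Rightarrow> nat) \<Rightarrow> ('v::euclidean_space \<Rightarrow>\<^sub>L 'w::euclidean_space)" and k :: nat
    and h :: "'v \<Rightarrow> real" and L :: real
  assumes lip: "\<And>X Y. \<bar>h X - h Y\<bar> \<le> L * norm (X - Y)" and L_nonneg: "0 \<le> L"
    and nonneg: "\<And>X. 0 \<le> h X"
begin

definition env :: "'v \<Rightarrow> real" where
  "env X = (INF w\<in>core_fields A k. integral unit_cube (\<lambda>x. h (X + w x)))"

lemma core_continuous: "w \<in> core_fields A k \<Longrightarrow> continuous_on UNIV w"
  by (auto simp: core_fields_def smooth_continuous_on)

lemma zero_core: "(\<lambda>x. 0) \<in> core_fields A k"
  by (auto simp: core_fields_def smooth_const diff_op_zero intro!: exI[of _ "{}"])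

lemma integral_core_nonneg: "w \<in> core_fields A k \<Longrightarrow> 0 \<le> integral unit_cube (\<lambda>x. h (X + w x))"
  by (intro integral_nonneg lipschitz_field_integrable[OF lip] core_continuous nonneg)

lemma env_le: "w \<in> core_fields A k \<Longrightarrow> env X \<le> integral unit_cube (\<lambda>x. h (X + w x))"
  unfolding env_def by (rule cINF_lower) (auto intro!: bdd_belowI2[of _ 0] integral_core_nonneg)

lemma env_greatest:
  assumes "\<And>w. w \<in> core_fields A k \<Longrightarrow> c \<le> integral unit_cube (\<lambda>x. h (X + w x))"
  shows "c \<le> env X"
  unfolding env_def using zero_core by (intro cINF_greatest assms) auto

lemma env_le_self: "env X \<le> h X"
  using env_le[OF zero_core, of X] by simp

lemma env_attain:
  assumes "\<epsilon> > 0"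
  shows "\<exists>w\<in>core_fields A k. integral unit_cube (\<lambda>x. h (X + w x)) \<le> env X + \<epsilon>"
proof (rule ccontr)
  assume "\<not> ?thesis"
  then have "env X + \<epsilon> \<le> env X" by (intro env_greatest) (auto intro: less_imp_le)
  then show False using assms by simp
qed

lemma env_lipschitz: "\<bar>env X - env Y\<bar> \<le> L * norm (X - Y)"
proof -
  have *: "env X \<le> env Y + L * norm (X - Y)" for X Y
  proof -
    have "env X - L * norm (X - Y) \<le> env Y"
    proof (rule env_greatest)
      fix w assume w: "w \<in> core_fields A k"
      have "env X \<le> integral unit_cube (\<lambda>x. h (X + w x))" by (rule env_le[OF w])
      also have "\<dots> \<le> integral unit_cube (\<lambda>x. h (Y + w x) + L * norm (X - Y))"
      proof (intro integral_le lipschitz_field_integrable[OF lip] core_continuous[OF w] integrable_add integrable_const)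
        fix x
        show "h (X + w x) \<le> h (Y + w x) + L * norm (X - Y)"
          using lip[of "X + w x" "Y + w x"] by (simp add: abs_le_iff)
      qed
      also have "\<dots> = integral unit_cube (\<lambda>x. h (Y + w x)) + L * norm (X - Y)"
        by (subst HK_integral_add)
           (auto intro: lipschitz_field_integrable[OF lip] core_continuous[OF w])
      finally show "env X - L * norm (X - Y) \<le> integral unit_cube (\<lambda>x. h (Y + w x))" by simp
    qed
    then show ?thesis by simp
  qed
  show ?thesis using *[of X Y] *[of Y X] by (simp add: norm_minus_commute abs_le_iff)
qed

text \<open>Placing nearly optimal fields, scaled down, into the cells of a fine grid on which the given
  field is almost constant yields an admissible competitor, since compact supports in different
  cells do not interact.\<close>

lemma env_quasiconvex_core:
  assumes w: "w \<in> core_fields A k"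
  shows "env X \<le> integral unit_cube (\<lambda>x. env (X + w x))"
proof (rule field_le_epsilon)
  fix e :: real assume "e > 0"
  \<comment> \<open>The cell competitors are optimal up to \<open>\<epsilon>\<close>, and freezing \<open>w\<close> on a cell costs \<open>L \<epsilon>\<close> twice.\<close>
  define \<epsilon> where "\<epsilon> = e / (1 + 2 * L)"
  have \<epsilon>: "\<epsilon> > 0" using \<open>e > 0\<close> L_nonneg by (simp add: \<epsilon>_def)
  have sw: "smooth w" and zw: "\<And>x. diff_op A k w x = 0" using w by (auto simp: core_fields_def)
  have cw: "continuous_on UNIV w" by (rule core_continuous[OF w])
  have "uniformly_continuous_on unit_cube w"
    by (intro compact_uniformly_continuous continuous_on_subset[OF cw]) auto
  then obtain \<delta> where \<delta>: "\<delta> > 0"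
    "\<And>x x'. x \<in> unit_cube \<Longrightarrow> x' \<in> unit_cube \<Longrightarrow> dist x' x < \<delta> \<Longrightarrow> dist (w x') (w x) < \<epsilon>"
    unfolding uniformly_continuous_on_def using \<epsilon> by meson
  obtain N :: nat where "max 1 (CARD('d) / \<delta>) < real N"
    using reals_Archimedean2 by blast
  then have N: "1 \<le> N" "CARD('d) / \<delta> < real N" by auto
  have near: "norm (w ((1/N) *\<^sub>R (y + z)) - w ((1/N) *\<^sub>R z)) \<le> \<epsilon>"
    if "y \<in> unit_cube" "z \<in> grid N" for y z
  proof -
    have mem: "(1/N) *\<^sub>R (y + z) \<in> unit_cube" if "y \<in> unit_cube" for y
      using cell_subset[OF N(1) \<open>z \<in> grid N\<close>] mem_cell[OF N(1), of "(1/N) *\<^sub>R (y + z)" z] that N(1) by auto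
    have "(0 :: real^'d) \<in> unit_cube" by (simp add: mem_unit_cube)
    then have "(1/N) *\<^sub>R z \<in> unit_cube" using mem[of 0] by simp
    moreover have "dist ((1/N) *\<^sub>R (y + z)) ((1/N) *\<^sub>R z) < \<delta>"
    proof -
      have "norm y \<le> (\<Sum>i\<in>UNIV. \<bar>y $ i\<bar>)" by (rule norm_le_l1_cart)
      also have "\<dots> \<le> (\<Sum>i\<in>(UNIV::'d set). 1)"
        using that(1) by (intro sum_mono) (auto simp: mem_unit_cube)
      finally have "norm y \<le> CARD('d)" by simp
      also have "\<dots> < \<delta> * real N" using N(2) \<delta>(1) by (simp add: field_simps)
      finally have "norm y / real N < \<delta>" using N(1) by (simp add: field_simps)
      moreover have "(1/N) *\<^sub>R (y + z) - (1/N) *\<^sub>R z = (1/N) *\<^sub>R y" by (simp add: scaleR_add_right)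
      ultimately show ?thesis by (simp add: dist_norm)
    qed
    ultimately show ?thesis using \<delta>(2)[OF _ mem[OF that(1)]] by (simp add: dist_norm less_imp_le)
  qed
  have "\<forall>z. \<exists>v\<in>core_fields A k. integral unit_cube (\<lambda>y. h (X + w ((1/N) *\<^sub>R z) + v y)) \<le> env (X + w ((1/N) *\<^sub>R z)) + \<epsilon>"
    using env_attain[OF \<epsilon>] by blast
  then obtain W where W: "\<And>z. W z \<in> core_fields A k"
    "\<And>z. integral unit_cube (\<lambda>y. h (X + w ((1/N) *\<^sub>R z) + W z y)) \<le> env (X + w ((1/N) *\<^sub>R z)) + \<epsilon>"
    by metis
  have sW: "smooth (W z)" and zW: "diff_op A k (W z) x = 0" for z x
    using W(1)[of z] by (auto simp: core_fields_def)
  obtain K where K: "\<And>z. compact (K z)" "\<And>z. K z \<subseteq> box 0 (\<chi> i. 1)" "\<And>z x. x \<notin> K z \<Longrightarrow> W z x = 0"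
    using W(1) unfolding core_fields_def by (simp, metis)
  obtain K0 where K0: "compact K0" "K0 \<subseteq> box 0 (\<chi> i. 1)" "\<And>x. x \<notin> K0 \<Longrightarrow> w x = 0"
    using w unfolding core_fields_def by blast
  define V where "V x = w x + (\<Sum>z\<in>grid N. W z (real N *\<^sub>R x + - z))" for x
  have sWa: "smooth (\<lambda>x. W z (real N *\<^sub>R x + - z))" for z by (rule smooth_affine[OF sW])
  have sS: "smooth (\<lambda>x. \<Sum>z\<in>grid N. W z (real N *\<^sub>R x + - z))" by (rule smooth_sum[OF sWa])
  have "V \<in> core_fields A k"
    unfolding core_fields_def
  proof (intro CollectI conjI allI exI impI)
    show "smooth V" unfolding V_def[abs_def] by (rule smooth_add[OF sw sS])
    show "diff_op A k V x = 0" for x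
      unfolding V_def[abs_def] diff_op_add[OF sw sS] zw diff_op_sum[OF sWa] diff_op_affine[OF sW] zW by simp
    let ?K = "K0 \<union> (\<Union>z\<in>grid N. (\<lambda>x. (1/N) *\<^sub>R (x + z)) ` K z)"
    show "compact ?K"
      using K0(1) K(1) by (intro compact_Un compact_UN compact_continuous_image continuous_intros) auto
    have "(1/N) *\<^sub>R (x + z) \<in> box 0 (\<chi> i. 1)" if "z \<in> grid N" "x \<in> K z" for x z
    proof -
      have "(1/N) *\<^sub>R (x + z) \<in> interior (cell N z)"
        using K(2)[of z] that(2) N(1) by (auto simp: interior_cell[OF N(1)])
      then show ?thesis
        using interior_mono[OF cell_subset[OF N(1) that(1)]] by auto
    qed
    then show "?K \<subseteq> box 0 (\<chi> i. 1)" using K0(2) by auto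
    fix x assume x: "x \<notin> ?K"
    have "W z (real N *\<^sub>R x + - z) = 0" if "z \<in> grid N" for z
    proof (rule K(3), rule notI)
      assume "real N *\<^sub>R x + - z \<in> K z"
      then have "(1/N) *\<^sub>R ((real N *\<^sub>R x + - z) + z) \<in> (\<lambda>x. (1/N) *\<^sub>R (x + z)) ` K z" by (rule imageI)
      then have "x \<in> (\<lambda>x. (1/N) *\<^sub>R (x + z)) ` K z" using N(1) by simp
      then show False using x that by blast
    qed
    then show "V x = 0" using K0(3)[of x] x by (simp add: V_def)
  qed
  note Vcore = this
  have Vcell: "V ((1/N) *\<^sub>R (y + z)) = w ((1/N) *\<^sub>R (y + z)) + W z y" if "y \<in> unit_cube" "z \<in> grid N" for y z
  proof -
    let ?x = "(1/N) *\<^sub>R (y + z)"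
    have Nx: "real N *\<^sub>R ?x = y + z" using N(1) by simp
    have "W z' (real N *\<^sub>R ?x + - z') = 0" if "z' \<in> grid N" "z' \<noteq> z" for z'
    proof -
      have "real N *\<^sub>R ?x - z' \<notin> box 0 (\<chi> i. 1)"
        by (rule cell_disjoint[OF N(1) \<open>z \<in> grid N\<close> that(1) that(2)[symmetric]]) (simp only: Nx, simp add: \<open>y \<in> unit_cube\<close>)
      then have "real N *\<^sub>R ?x + - z' \<notin> K z'" using K(2)[of z'] by auto
      then show ?thesis by (rule K(3))
    qed
    then have "(\<Sum>z'\<in>grid N. W z' (real N *\<^sub>R ?x + - z')) = W z (real N *\<^sub>R ?x + - z)"
      using \<open>z \<in> grid N\<close> by (subst sum.remove[of _ z]) auto
    then show ?thesis by (simp only: V_def Nx) simp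
  qed
  have cVN: "continuous_on UNIV (\<lambda>y. w ((1/N) *\<^sub>R (y + z)))" for z
    by (rule continuous_on_compose2[OF cw]) (auto intro!: continuous_intros)
  have cell_le: "integral unit_cube (\<lambda>y. h (X + V ((1/N) *\<^sub>R (y + z))))
     \<le> integral unit_cube (\<lambda>y. env (X + w ((1/N) *\<^sub>R (y + z)))) + e" if z: "z \<in> grid N" for z
  proof -
    let ?X = "X + w ((1/N) *\<^sub>R z)"
    have cWz: "continuous_on UNIV (W z)" by (rule core_continuous[OF W(1)])
    have "integral unit_cube (\<lambda>y. h (X + V ((1/N) *\<^sub>R (y + z)))) 
      = integral unit_cube (\<lambda>y. h (X + (w ((1/N) *\<^sub>R (y + z)) + W z y)))"
      by (rule integral_cong) (simp add: Vcell z)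
    also have "\<dots> \<le> integral unit_cube (\<lambda>y. h (?X + W z y) + L * \<epsilon>)"
    proof (intro integral_le lipschitz_field_integrable[OF lip] continuous_on_add cVN cWz continuous_on_const integrable_add integrable_const)
      fix y :: "real^'d" assume y: "y \<in> unit_cube"
      have "h (X + (w ((1/N) *\<^sub>R (y + z)) + W z y)) - h (?X + W z y) \<le> L * norm (w ((1/N) *\<^sub>R (y + z)) - w ((1/N) *\<^sub>R z))"
        using lip[of "X + (w ((1/N) *\<^sub>R (y + z)) + W z y)" "?X + W z y"] by (simp add: algebra_simps)
      also have "\<dots> \<le> L * \<epsilon>" using near[OF y z] L_nonneg by (rule mult_left_mono)
      finally show "h (X + (w ((1/N) *\<^sub>R (y + z)) + W z y)) \<le> h (?X + W z y) + L * \<epsilon>" by simp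
    qed
    also have "\<dots> = integral unit_cube (\<lambda>y. h (?X + W z y)) + L * \<epsilon>"
      by (subst HK_integral_add)
         (auto intro: lipschitz_field_integrable[OF lip] cWz)
    also have "\<dots> \<le> env ?X + \<epsilon> + L * \<epsilon>" using W(2)[of z] by simp
    also have "env ?X = integral unit_cube (\<lambda>y :: real^'d. env ?X)" by simp
    also have "\<dots> \<le> integral unit_cube (\<lambda>y. env (X + w ((1/N) *\<^sub>R (y + z))) + L * \<epsilon>)"
    proof (intro integral_le lipschitz_field_integrable[OF env_lipschitz] cVN continuous_on_const integrable_add integrable_const)
      fix y :: "real^'d" assume y: "y \<in> unit_cube"
      have "env ?X - env (X + w ((1/N) *\<^sub>R (y + z))) \<le> L * norm (w ((1/N) *\<^sub>R (y + z)) - w ((1/N) *\<^sub>R z))"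
        using env_lipschitz[of ?X "X + w ((1/N) *\<^sub>R (y + z))"] by (simp add: norm_minus_commute)
      also have "\<dots> \<le> L * \<epsilon>" using near[OF y z] L_nonneg by (rule mult_left_mono)
      finally show "env ?X \<le> env (X + w ((1/N) *\<^sub>R (y + z))) + L * \<epsilon>" by simp
    qed
    also have "\<dots> = integral unit_cube (\<lambda>y. env (X + w ((1/N) *\<^sub>R (y + z)))) + L * \<epsilon>"
      by (subst HK_integral_add)
         (auto intro: lipschitz_field_integrable[OF env_lipschitz] cVN)
    finally have "integral unit_cube (\<lambda>y. h (X + V ((1/N) *\<^sub>R (y + z))))
      \<le> integral unit_cube (\<lambda>y. env (X + w ((1/N) *\<^sub>R (y + z)))) + (1 + 2 * L) * \<epsilon>"
      by (simp add: algebra_simps)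
    then show ?thesis using L_nonneg by (simp add: \<epsilon>_def)
  qed
  have cont: "continuous_on unit_cube (\<lambda>x. h (X + V x))" "continuous_on unit_cube (\<lambda>x. env (X + w x))"
    using lipschitz_field_integrable(1)[OF lip core_continuous[OF Vcore], of X]
      lipschitz_field_integrable(1)[OF env_lipschitz cw, of X] continuous_on_subset by blast+
  have "env X \<le> integral unit_cube (\<lambda>x. h (X + V x))" by (rule env_le[OF Vcore])
  also have "\<dots> = (1 / real N ^ CARD('d)) *\<^sub>R (\<Sum>z\<in>grid N. integral unit_cube (\<lambda>y. h (X + V ((1/N) *\<^sub>R (y + z)))))"
    by (rule integral_unit_cube_grid[OF N(1) cont(1)])
  also have "\<dots> \<le> (1 / real N ^ CARD('d)) *\<^sub>R (\<Sum>z\<in>grid N. integral unit_cube (\<lambda>y. env (X + w ((1/N) *\<^sub>R (y + z)))) + e)"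
    by (intro scaleR_left_mono sum_mono cell_le) auto
  also have "\<dots> = (1 / real N ^ CARD('d)) *\<^sub>R (\<Sum>z\<in>grid N. integral unit_cube (\<lambda>y. env (X + w ((1/N) *\<^sub>R (y + z))))) + e"
    using N(1) by (simp add: sum.distrib card_grid field_simps)
  also have "\<dots> = integral unit_cube (\<lambda>x. env (X + w x)) + e"
    by (simp only: integral_unit_cube_grid[OF N(1) cont(2)])
  finally show "env X \<le> integral unit_cube (\<lambda>x. env (X + w x)) + e" .
qed

end

lemma LINT_unit_cube:
  fixes g :: "real^'d::finite \<Rightarrow> 'b::euclidean_space"
  assumes "continuous_on UNIV g"
  shows "(LINT y:unit_cube|lborel. g y) = integral unit_cube g"
proof (rule set_borel_integral_eq_integral(2))
  show "set_integrable lborel unit_cube g"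
    unfolding set_integrable_def
    by (intro borel_integrable_compact compact_cbox continuous_on_subset[OF assms]) simp
qed

text \<open>A periodic field is replaced by a nearby finite sum of waves, and this by a compactly supported
  field, at small cost for the Lipschitz function \<open>env\<close>.\<close>

lemma (in lipschitz_integrand) env_quasiconvex:
  assumes cr: "constant_rank A k"
  shows "quasiconvex A k env"
  unfolding quasiconvex_def
proof (intro conjI allI impI)
  show "continuous_on UNIV env" by (rule lipschitz_continuous[OF env_lipschitz])
  fix X and u :: "real^'d \<Rightarrow> 'v"
  assume "smooth u \<and> torus_periodic u \<and> (\<forall>y. diff_op A k u y = 0) \<and> (LINT y:unit_cube|lborel. u y) = 0"
  then have u: "smooth u" "torus_periodic u" "\<And>x. diff_op A k u x = 0" "(LINT y:unit_cube|lborel. u y) = 0"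
    by auto
  have cu: "continuous_on UNIV u" by (rule smooth_continuous_on[OF u(1)])
  have mean: "integral unit_cube u = 0" using u(4) by (simp add: LINT_unit_cube[OF cu])
  have "env X \<le> integral unit_cube (\<lambda>x. env (X + u x))"
  proof (rule field_le_epsilon)
    fix e :: real assume "e > 0"
    define \<epsilon> where "\<epsilon> = e / (2 * (L + 1))"
    have \<epsilon>: "\<epsilon> > 0" using \<open>e > 0\<close> L_nonneg by (simp add: \<epsilon>_def)
    have L\<epsilon>: "L * \<epsilon> \<le> e / 2" using \<open>e > 0\<close> L_nonneg by (simp add: \<epsilon>_def field_simps)
    obtain f where f: "trig_poly f" "\<And>x. norm (conv f u x - u x) \<le> \<epsilon>"
      using trig_poly_approx[OF cu u(2) \<epsilon>] by blast
    have p: "wave_sum A k (conv f u)" by (rule wave_sum_conv[OF f(1) u(1-3) mean])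
    have cp: "continuous_on UNIV (conv f u)" by (rule smooth_continuous_on[OF wave_sum_smooth_periodic(1)[OF p]])
    obtain w where w: "w \<in> core_fields A k"
      "integral unit_cube (\<lambda>x. env (X + w x)) \<le> integral unit_cube (\<lambda>x. env (X + conv f u x)) + e / 2"
      using core_field_recovery[OF cr p env_lipschitz L_nonneg, of "e / 2" X] \<open>e > 0\<close> by auto
    have "env X \<le> integral unit_cube (\<lambda>x. env (X + w x))" by (rule env_quasiconvex_core[OF w(1)])
    also note w(2)
    also have "integral unit_cube (\<lambda>x. env (X + conv f u x)) \<le> integral unit_cube (\<lambda>x. env (X + u x) + L * \<epsilon>)"
    proof (intro integral_le lipschitz_field_integrable[OF env_lipschitz] cu cp integrable_add integrable_const)
      fix x
      have "env (X + conv f u x) - env (X + u x) \<le> L * norm (conv f u x - u x)"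
        using env_lipschitz[of "X + conv f u x" "X + u x"] by simp
      also have "\<dots> \<le> L * \<epsilon>" using f(2) L_nonneg by (rule mult_left_mono)
      finally show "env (X + conv f u x) \<le> env (X + u x) + L * \<epsilon>" by simp
    qed
    also have "integral unit_cube (\<lambda>x. env (X + u x) + L * \<epsilon>) = integral unit_cube (\<lambda>x. env (X + u x)) + L * \<epsilon>"
      by (subst HK_integral_add)
         (auto intro: lipschitz_field_integrable[OF env_lipschitz] cu)
    finally show "env X \<le> integral unit_cube (\<lambda>x. env (X + u x)) + e" using L\<epsilon> by simp
  qed
  also have "\<dots> = (LINT y:unit_cube|lborel. env (X + u y))"
    by (rule LINT_unit_cube[symmetric]) (rule lipschitz_field_integrable[OF env_lipschitz cu])
  finally show "env X \<le> (LINT y:unit_cube|lborel. env (X + u y))" .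
qed

text \<open>An integrand within bounded distance of a Lipschitz positively homogeneous one has that one
  as its recession function, attained uniformly in the direction.\<close>

lemma E_space_near_homogeneous:
  fixes f G :: "'v::euclidean_space \<Rightarrow> real"
  assumes f: "continuous_on UNIV f" and G: "continuous_on UNIV G"
    and hom: "\<And>t X. t > 0 \<Longrightarrow> G (t *\<^sub>R X) = t * G X"
    and near: "\<And>X. \<bar>f X - G X\<bar> \<le> M"
  shows "f \<in> E_space" "recession f = G"
proof -
  define r where "r X = (if norm X < 1 then (1 - norm X) * (f (X /\<^sub>R (1 - norm X)) - G (X /\<^sub>R (1 - norm X))) else 0)" for X
  have M0: "0 \<le> M" using near[of 0] by linarith
  have r_bound: "\<bar>r X\<bar> \<le> (1 - norm X) * M" if "norm X \<le> 1" for X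
    using that near[of "X /\<^sub>R (1 - norm X)"]
    by (cases "norm X < 1") (auto simp: r_def abs_mult intro!: mult_left_mono)
  have "continuous (at X within cball 0 1) r" if X: "X \<in> cball 0 1" for X
  proof (cases "norm X < 1")
    case True
    have inv: "continuous_on (ball 0 1) (\<lambda>X :: 'v. X /\<^sub>R (1 - norm X))"
      by (intro continuous_intros) auto
    have "continuous_on (ball 0 1) (\<lambda>X. (1 - norm X) * (f (X /\<^sub>R (1 - norm X)) - G (X /\<^sub>R (1 - norm X))))"
      by (intro continuous_on_mult continuous_on_diff continuous_on_const continuous_on_norm continuous_on_id
          continuous_on_compose2[OF f inv] continuous_on_compose2[OF G inv]) auto
    then have "continuous_on (ball 0 1) r"
      by (rule continuous_on_eq) (auto simp: r_def)
    then have "continuous (at X) r"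
      using True by (simp add: continuous_on_eq_continuous_at)
    then show ?thesis by (rule continuous_at_imp_continuous_within)
  next
    case False
    then have X1: "norm X = 1" using X by simp
    have "((\<lambda>Y. (1 - norm Y) * M) \<longlongrightarrow> (1 - norm X) * M) (at X within cball 0 1)"
      by (intro tendsto_intros)
    then have "((\<lambda>Y. (1 - norm Y) * M) \<longlongrightarrow> 0) (at X within cball 0 1)" using X1 by simp
    moreover have "\<forall>\<^sub>F Y in at X within cball 0 1. norm (r Y) \<le> (1 - norm Y) * M"
      using r_bound by (auto simp: eventually_at_filter)
    ultimately have "(r \<longlongrightarrow> 0) (at X within cball 0 1)" by (rule Lim_null_comparison[rotated])
    moreover have "r X = 0" using False by (simp add: r_def)
    ultimately show ?thesis by (simp add: continuous_within)
  qed
  then have "continuous_on (cball 0 1) r" by (simp add: continuous_on_eq_continuous_within)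
  then have "continuous_on (cball 0 1) (\<lambda>X. G X + r X)"
    by (intro continuous_on_add continuous_on_subset[OF G]) auto
  moreover have "G X + r X = (1 - norm X) * f (X /\<^sub>R (1 - norm X))" if "X \<in> ball 0 1" for X
  proof -
    have "G (X /\<^sub>R (1 - norm X)) = G X / (1 - norm X)"
      using hom[of "inverse (1 - norm X)" X] that by (simp add: divide_inverse mult.commute)
    then show ?thesis using that by (simp add: r_def algebra_simps) (simp add: field_simps)
  qed
  ultimately show "f \<in> E_space" unfolding E_space_def using f by blast
  have "((\<lambda>t. f (t *\<^sub>R X) / t) \<longlongrightarrow> G X) at_top" for X
  proof -
    have "((\<lambda>t. M * inverse t) \<longlongrightarrow> M * 0) at_top"
      by (intro tendsto_mult tendsto_const tendsto_inverse_0_at_top filterlim_ident)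
    then have "((\<lambda>t. M * inverse t) \<longlongrightarrow> 0) at_top" by simp
    moreover have "\<forall>\<^sub>F t in at_top. norm (f (t *\<^sub>R X) / t - G X) \<le> M * inverse t"
      using eventually_gt_at_top[of "0 :: real"]
    proof eventually_elim
      case (elim t)
      then have "f (t *\<^sub>R X) / t - G X = (f (t *\<^sub>R X) - G (t *\<^sub>R X)) / t"
        by (simp add: hom field_simps)
      then show ?case using near[of "t *\<^sub>R X"] elim by (simp add: abs_divide field_simps)
    qed
    ultimately have "((\<lambda>t. f (t *\<^sub>R X) / t - G X) \<longlongrightarrow> 0) at_top" by (rule Lim_null_comparison[rotated])
    then show ?thesis by (simp add: LIM_zero_iff)
  qed
  then show "recession f = G"
    unfolding recession_def by (auto simp: fun_eq_iff intro!: tendsto_Lim)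
qed

text \<open>The admissible fields form a cone.\<close>

lemma (in lipschitz_integrand) env_homogeneous:
  assumes hom: "\<And>t X. t > 0 \<Longrightarrow> h (t *\<^sub>R X) = t * h X" and t: "t > 0"
  shows "env (t *\<^sub>R X) = t * env X"
proof -
  have le: "t * env X \<le> env (t *\<^sub>R X)" if t: "t > 0" for t X
  proof (rule env_greatest)
    fix w assume w: "w \<in> core_fields A k"
    then obtain K where K: "compact K" "K \<subseteq> box 0 (\<chi> i. 1)" "\<And>x. x \<notin> K \<Longrightarrow> w x = 0"
      and sw: "smooth w" and zw: "\<And>x. diff_op A k w x = 0" unfolding core_fields_def by blast
    have "(\<lambda>x. (1/t) *\<^sub>R w x) \<in> core_fields A k"
      unfolding core_fields_def using K
      by (auto simp: smooth_scaleR[OF sw] diff_op_scaleR[OF sw] zw intro!: exI[of _ K])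
    then have "t * env X \<le> t * integral unit_cube (\<lambda>x. h (X + (1/t) *\<^sub>R w x))"
      using env_le t by (intro mult_left_mono) auto
    also have "\<dots> = integral unit_cube (\<lambda>x. t * h (X + (1/t) *\<^sub>R w x))" by simp
    also have "\<dots> = integral unit_cube (\<lambda>x. h (t *\<^sub>R X + w x))"
      using t by (simp add: hom[symmetric] scaleR_add_right)
    finally show "t * env X \<le> integral unit_cube (\<lambda>x. h (t *\<^sub>R X + w x))" .
  qed
  have "(1/t) * env (t *\<^sub>R X) \<le> env ((1/t) *\<^sub>R (t *\<^sub>R X))" using le[of "1/t" "t *\<^sub>R X"] t by simp
  then have "env (t *\<^sub>R X) \<le> t * env X" using t by (simp add: field_simps)
  with le[OF t, of X] show ?thesis by (rule antisym[rotated])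
qed

section \<open>The weak-type constant bounds the envelope from below\<close>

definition line_dist :: "'v::euclidean_space \<Rightarrow> 'v \<Rightarrow> real" where
  "line_dist e X = norm (X - (X \<bullet> e) *\<^sub>R e)"

lemma line_dist_sq:
  assumes "norm e = 1"
  shows "(line_dist e X)\<^sup>2 = (norm X)\<^sup>2 - (X \<bullet> e)\<^sup>2"
proof -
  have "e \<bullet> e = 1" using assms by (simp add: dot_square_norm)
  then have "(X - (X \<bullet> e) *\<^sub>R e) \<bullet> (X - (X \<bullet> e) *\<^sub>R e) = X \<bullet> X - (X \<bullet> e) * (X \<bullet> e)"
    by (simp only: inner_diff_left inner_diff_right inner_scaleR_left inner_scaleR_right inner_commute[of e X])
       simp
  then show ?thesis
    by (simp only: line_dist_def power2_norm_eq_inner power2_eq_square[of "X \<bullet> e"])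
qed

lemma infdist_line:
  assumes e: "norm e = 1" and l: "l = range (\<lambda>t::real. t *\<^sub>R e)"
  shows "infdist X l = line_dist e X"
proof (rule antisym)
  show "infdist X l \<le> line_dist e X"
    unfolding line_dist_def dist_norm[symmetric] by (rule infdist_le) (unfold l, rule rangeI)
  have ee: "e \<bullet> e = 1" using e by (simp add: dot_square_norm)
  have "line_dist e X \<le> dist X y" if "y \<in> l" for y
  proof -
    from \<open>y \<in> l\<close> obtain s where y: "y = s *\<^sub>R e" unfolding l by auto
    have "(line_dist e X)\<^sup>2 \<le> (norm (X - s *\<^sub>R e))\<^sup>2"
    proof -
      have "(norm (X - s *\<^sub>R e))\<^sup>2 = (norm X)\<^sup>2 - 2 * s * (X \<bullet> e) + s\<^sup>2"
        unfolding power2_norm_eq_inner power2_eq_square[of s]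
        by (simp only: inner_diff_left inner_diff_right inner_scaleR_left inner_scaleR_right inner_commute[of e X] ee)
           (simp add: algebra_simps)
      moreover have "0 \<le> (s - X \<bullet> e)\<^sup>2" by simp
      ultimately show ?thesis
        unfolding line_dist_sq[OF e] by (simp add: power2_diff)
    qed
    then show ?thesis unfolding y dist_norm by (rule power2_le_imp_le) simp
  qed
  moreover have "l \<noteq> {}" by (simp add: l)
  ultimately show "line_dist e X \<le> infdist X l"
    by (auto simp: infdist_def intro!: cINF_greatest)
qed

lemma line_dist_lipschitz:
  assumes "norm e = 1"
  shows "\<bar>line_dist e X - line_dist e Y\<bar> \<le> norm (X - Y)"
proof -
  have "\<bar>line_dist e X - line_dist e Y\<bar> \<le> norm ((X - (X \<bullet> e) *\<^sub>R e) - (Y - (Y \<bullet> e) *\<^sub>R e))"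
    unfolding line_dist_def by (rule norm_triangle_ineq3)
  also have "(X - (X \<bullet> e) *\<^sub>R e) - (Y - (Y \<bullet> e) *\<^sub>R e) = (X - Y) - ((X - Y) \<bullet> e) *\<^sub>R e"
    by (simp add: inner_diff_left algebra_simps)
  also have "norm \<dots> \<le> norm (X - Y)"
  proof (rule power2_le_imp_le)
    show "(norm ((X - Y) - ((X - Y) \<bullet> e) *\<^sub>R e))\<^sup>2 \<le> (norm (X - Y))\<^sup>2"
      using line_dist_sq[OF assms, of "X - Y"] by (simp add: line_dist_def)
  qed simp
  finally show ?thesis .
qed

lemma line_dist_scale: "t > 0 \<Longrightarrow> line_dist e (t *\<^sub>R X) = t * line_dist e X"
proof -
  assume "t > 0"
  have "t *\<^sub>R X - (t *\<^sub>R X \<bullet> e) *\<^sub>R e = t *\<^sub>R (X - (X \<bullet> e) *\<^sub>R e)"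
    by (simp add: algebra_simps)
  then show ?thesis using \<open>t > 0\<close> by (simp add: line_dist_def)
qed

lemma line_dist_add:
  assumes "norm e = 1"
  shows "line_dist e (s *\<^sub>R e + X) = line_dist e X"
proof -
  have "e \<bullet> e = 1" using assms by (simp add: dot_square_norm)
  then have "s *\<^sub>R e + X - ((s *\<^sub>R e + X) \<bullet> e) *\<^sub>R e = X - (X \<bullet> e) *\<^sub>R e"
    by (simp add: inner_add_left algebra_simps)
  then show ?thesis unfolding line_dist_def by (simp only:)
qed

lemma emeasure_unit_cube: "emeasure lborel (unit_cube :: (real^'d::finite) set) = 1"
proof -
  have "emeasure lborel (unit_cube :: (real^'d) set) = ennreal (measure lborel (unit_cube :: (real^'d) set))"
    by (rule emeasure_eq_ennreal_measure) (simp add: emeasure_lborel_cbox_eq)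
  then show ?thesis by simp
qed

text \<open>The definition of the constant as a supremum of quotients, unfolded for one field.  If the
  denominator vanishes then so must the numerator, since the constant is finite.\<close>

lemma weak_type_core_field:
  fixes A :: "('d::finite \<Rightarrow> nat) \<Rightarrow> ('v::euclidean_space \<Rightarrow>\<^sub>L 'w::euclidean_space)"
  assumes om: "omega A k l = ennreal om" "0 \<le> om"
    and e: "norm e = 1" "l = range (\<lambda>t::real. t *\<^sub>R e)"
    and w: "w \<in> core_fields A k" and t: "t > 0"
  shows "t * measure lborel {x. t < norm (w x)} \<le> om * integral unit_cube (\<lambda>x. line_dist e (w x))"
    and "{x. t < norm (w x)} \<subseteq> unit_cube" "{x. t < norm (w x)} \<in> sets borel"
proof -
  obtain K where K: "compact K" "K \<subseteq> box 0 (\<chi> i. 1)" "\<And>x. x \<notin> K \<Longrightarrow> w x = 0"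
    and sw: "smooth w" and zw: "\<And>x. diff_op A k w x = 0" using w unfolding core_fields_def by blast
  have cw: "continuous_on UNIV w" by (rule smooth_continuous_on[OF sw])
  have supp: "x \<in> unit_cube" if "w x \<noteq> 0" for x
    using that K(2,3) box_subset_cbox by blast
  let ?S = "{x. t < norm (w x)}"
  show Sc: "?S \<subseteq> unit_cube" using supp t by force
  have "open ?S" by (intro open_Collect_less continuous_on_const continuous_on_norm cw)
  then show Sb: "?S \<in> sets borel" by simp
  have "emeasure lborel ?S \<le> emeasure lborel (unit_cube :: (real^'d) set)"
    by (rule emeasure_mono[OF Sc]) simp
  then have Sfin: "emeasure lborel ?S = ennreal (measure lborel ?S)"
    by (intro emeasure_eq_ennreal_measure) (auto simp: emeasure_unit_cube top_unique)
  have cld: "continuous_on UNIV (\<lambda>x. line_dist e (w x))"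
    unfolding line_dist_def
    by (intro continuous_on_norm continuous_on_diff continuous_on_scaleR continuous_on_inner continuous_on_const cw)
  have L1: "L1_dist w l = ennreal (integral unit_cube (\<lambda>x. line_dist e (w x)))"
  proof -
    have ind: "line_dist e (w x) = indicator unit_cube x *\<^sub>R line_dist e (w x)" for x
      using supp[of x] by (cases "w x = 0") (auto simp: line_dist_def)
    have int: "integrable lborel (\<lambda>x. indicator unit_cube x *\<^sub>R line_dist e (w x))"
      by (rule borel_integrable_compact[OF compact_cbox continuous_on_subset[OF cld]]) simp
    have "L1_dist w l = (\<integral>\<^sup>+x. ennreal (indicator unit_cube x *\<^sub>R line_dist e (w x)) \<partial>lborel)"
      unfolding L1_dist_def infdist_line[OF e] by (subst ind) simp
    also have "\<dots> = ennreal (LINT y:unit_cube|lborel. line_dist e (w y))"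
      unfolding set_lebesgue_integral_def
      by (rule nn_integral_eq_integral[OF int]) (simp add: line_dist_def)
    finally show ?thesis by (simp add: LINT_unit_cube[OF cld])
  qed
  let ?I = "integral unit_cube (\<lambda>x. line_dist e (w x))"
  have I0: "0 \<le> ?I"
    by (rule integral_nonneg[OF integrable_continuous[OF continuous_on_subset[OF cld]]]) (auto simp: line_dist_def)
  show "t * measure lborel ?S \<le> om * ?I"
  proof (cases "\<exists>x. w x \<noteq> 0")
    case False
    then have "?S = {}" using t by simp
    then show ?thesis using om(2) I0 by simp
  next
    case True
    have "closure {x. w x \<noteq> 0} \<subseteq> K"
      using K(1,3) by (intro closure_minimal) (auto intro: compact_imp_closed)
    then have "compact (closure {x. w x \<noteq> 0})"
      using compact_Int_closed[OF K(1) closed_closure[of "{x. w x \<noteq> 0}"]] by (simp add: Int_absorb1)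
    then have "w \<in> test_fields A k" using sw zw True by (simp add: test_fields_def)
    then have "weak_L1 w / L1_dist w l \<le> ennreal om"
      unfolding om(1)[symmetric] omega_def by (rule SUP_upper)
    then have q: "weak_L1 w / ennreal ?I \<le> ennreal om" by (simp only: L1)
    have "weak_L1 w \<le> ennreal om * ennreal ?I"
    proof (cases "?I = 0")
      case True
      then have "weak_L1 w = 0"
        using q ennreal_divide_eq_top_iff by (metis ennreal_0 ennreal_neq_top neq_top_trans ennreal_less_top)
      then show ?thesis by simp
    next
      case False
      then have "0 < ?I" using I0 by simp
      then have "weak_L1 w = weak_L1 w / ennreal ?I * ennreal ?I"
        by (simp add: ennreal_divide_times mult_divide_eq_ennreal)
      also have "\<dots> \<le> ennreal om * ennreal ?I" using q by (rule mult_right_mono) simp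
      finally show ?thesis .
    qed
    moreover have "ennreal t * emeasure lborel ?S \<le> weak_L1 w"
      unfolding weak_L1_def using t by (intro SUP_upper) simp
    ultimately have "ennreal t * ennreal (measure lborel ?S) \<le> ennreal om * ennreal ?I"
      unfolding Sfin by (rule order_trans[rotated])
    then show ?thesis
      using t om(2) I0 by (simp add: ennreal_mult[symmetric] ennreal_le_iff)
  qed
qed

lemma env_compare:
  assumes 1: "lipschitz_integrand h L" and 2: "lipschitz_integrand h' L'"
    and le: "\<And>X. h X \<le> h' X + c"
  shows "lipschitz_integrand.env A k h X \<le> lipschitz_integrand.env A k h' X + c"
proof -
  interpret H: lipschitz_integrand A k h L by (rule 1)
  interpret H': lipschitz_integrand A k h' L' by (rule 2)
  have "H.env X - c \<le> H'.env X"
  proof (rule H'.env_greatest)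
    fix w assume w: "w \<in> core_fields A k"
    have cw: "continuous_on UNIV w" by (rule H.core_continuous[OF w])
    have "H.env X \<le> integral unit_cube (\<lambda>x. h (X + w x))" by (rule H.env_le[OF w])
    also have "\<dots> \<le> integral unit_cube (\<lambda>x. h' (X + w x) + c)"
      by (intro integral_le lipschitz_field_integrable[OF H.lip] lipschitz_field_integrable[OF H'.lip] cw
          integrable_add integrable_const le)
    also have "\<dots> = integral unit_cube (\<lambda>x. h' (X + w x)) + c"
      by (subst HK_integral_add)
         (auto intro: lipschitz_field_integrable[OF H'.lip] cw)
    finally show "H.env X - c \<le> integral unit_cube (\<lambda>x. h' (X + w x))" by simp
  qed
  then show ?thesis by simp
qed

text \<open>Where a competitor stays near the base point the bump contributes; where it strays, on a set
  controlled by the weak-type inequality, the distance term makes up for the missing bump.\<close>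

lemma env_lower_bound:
  fixes A :: "('d::finite \<Rightarrow> nat) \<Rightarrow> ('v::euclidean_space \<Rightarrow>\<^sub>L 'w::euclidean_space)"
  assumes om: "omega A k l = ennreal om" "0 \<le> om"
    and e: "norm e = 1" "l = range (\<lambda>t::real. t *\<^sub>R e)" and t: "t > 0"
    and lip: "lipschitz_integrand h L"
    and far: "\<And>X. om * line_dist e X \<le> h X"
    and close: "\<And>X. norm (X - s *\<^sub>R e) \<le> t \<Longrightarrow> om * line_dist e X + t \<le> h X"
  shows "t \<le> lipschitz_integrand.env A k h (s *\<^sub>R e)"
proof -
  interpret lipschitz_integrand A k h L by (rule lip)
  show ?thesis
  proof (rule env_greatest)
    fix w assume w: "w \<in> core_fields A k"
    have cw: "continuous_on UNIV w" by (rule core_continuous[OF w])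
    let ?S = "{x. t < norm (w x)}"
    note weak = weak_type_core_field[OF om e w t]
    have "emeasure lborel ?S \<le> emeasure lborel (unit_cube :: (real^'d) set)"
      by (rule emeasure_mono[OF weak(2)]) simp
    then have "emeasure lborel ?S < \<infinity>"
      by (simp add: emeasure_unit_cube le_less_trans)
    then have "((\<lambda>x. 1) has_integral measure lborel ?S) ?S"
      using weak(3) by (intro has_integral_measure_lborel) auto
    then have "((\<lambda>x. if x \<in> ?S then 1 else 0) has_integral measure lborel ?S) unit_cube"
      using has_integral_restrict[OF weak(2), of "\<lambda>x. 1 :: real"] by simp
    then have i1: "((\<lambda>x. t * (if x \<in> ?S then 1 else 0)) has_integral t * measure lborel ?S) unit_cube"
      by (rule has_integral_mult_right)
    have "continuous_on unit_cube (\<lambda>x. line_dist e (w x))"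
      unfolding line_dist_def
      by (intro continuous_on_norm continuous_on_diff continuous_on_scaleR continuous_on_inner continuous_on_const
          continuous_on_subset[OF cw]) auto
    then have "((\<lambda>x. line_dist e (w x)) has_integral integral unit_cube (\<lambda>x. line_dist e (w x))) unit_cube"
      by (intro integrable_integral integrable_continuous)
    then have i2: "((\<lambda>x. om * line_dist e (w x)) has_integral om * integral unit_cube (\<lambda>x. line_dist e (w x))) unit_cube"
      by (rule has_integral_mult_right)
    have i3: "((\<lambda>x :: real^'d. t) has_integral t) unit_cube"
      using has_integral_const[of t 0 "(\<chi> i. 1) :: real^'d"] by simp
    have "om * integral unit_cube (\<lambda>x. line_dist e (w x)) + t - t * measure lborel ?S
      \<le> integral unit_cube (\<lambda>x. h (s *\<^sub>R e + w x))"
    proof (rule has_integral_le[OF has_integral_diff[OF has_integral_add[OF i2 i3] i1]])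
      show "((\<lambda>x. h (s *\<^sub>R e + w x)) has_integral integral unit_cube (\<lambda>x. h (s *\<^sub>R e + w x))) unit_cube"
        by (intro integrable_integral lipschitz_field_integrable[OF lip] cw)
      fix x :: "real^'d"
      show "om * line_dist e (w x) + t - t * (if x \<in> ?S then 1 else 0) \<le> h (s *\<^sub>R e + w x)"
        using far[of "s *\<^sub>R e + w x"] close[of "s *\<^sub>R e + w x"] by (simp add: line_dist_add[OF e(1)])
    qed
    then show "t \<le> integral unit_cube (\<lambda>x. h (s *\<^sub>R e + w x))" using weak(1) by linarith
  qed
qed

section \<open>Measures on the sphere\<close>

lemma sphere_prob_integrable:
  fixes f :: "'v::euclidean_space \<Rightarrow> 'b::euclidean_space"
  assumes \<nu>: "sphere_prob \<nu>" and f: "continuous_on UNIV f"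
  shows "integrable \<nu> f" "space \<nu> = sphere 0 1"
proof -
  have sets: "sets \<nu> = sets (restrict_space borel (sphere 0 1))" and p: "prob_space \<nu>"
    using \<nu> by (auto simp: sphere_prob_def)
  interpret prob_space \<nu> by (rule p)
  show sp: "space \<nu> = sphere 0 1"
    using sets_eq_imp_space_eq[OF sets] by (simp add: space_restrict_space)
  have "f \<in> borel_measurable (restrict_space borel (sphere 0 1))"
    by (rule measurable_restrict_space1[OF borel_measurable_continuous_onI[OF f]])
  then have m: "f \<in> borel_measurable \<nu>"
    by (simp only: measurable_cong_sets[OF sets refl])
  have "bounded (f ` sphere 0 1)"
    by (intro compact_imp_bounded compact_continuous_image continuous_on_subset[OF f]) auto
  then obtain B where "\<forall>y\<in>f ` sphere 0 1. norm y \<le> B" unfolding bounded_iff by blast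
  then have "AE x in \<nu>. norm (f x) \<le> B" by (intro AE_I2) (auto simp: sp)
  then show "integrable \<nu> f" using m by (rule integrable_const_bound)
qed

lemma (in prob_space) expectation_square_le:
  assumes "integrable M f" "integrable M (\<lambda>x. (f x)\<^sup>2)"
  shows "(expectation f)\<^sup>2 \<le> expectation (\<lambda>x. (f x :: real)\<^sup>2)"
  using variance_positive[of f] variance_eq[OF assms] by simp

lemma Var_eq:
  fixes \<nu> :: "'v::euclidean_space measure"
  assumes \<nu>: "sphere_prob \<nu>"
  shows "Var \<nu> = 1 - (norm (barycenter \<nu>))\<^sup>2"
proof -
  interpret prob_space \<nu> using \<nu> by (simp add: sphere_prob_def)
  note int = sphere_prob_integrable(1)[OF \<nu>]
  let ?X = "barycenter \<nu>"
  have "Var \<nu> = (LINT X|\<nu>. (1 + (norm ?X)\<^sup>2) - 2 * (X \<bullet> ?X))"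
    unfolding Var_def
  proof (rule Bochner_Integration.integral_cong[OF refl])
    fix X assume "X \<in> space \<nu>"
    then have "X \<bullet> X = 1" using sphere_prob_integrable(2)[OF \<nu> continuous_on_id] by (simp add: dot_square_norm)
    then show "(norm (X - ?X))\<^sup>2 = (1 + (norm ?X)\<^sup>2) - 2 * (X \<bullet> ?X)"
      by (simp only: power2_norm_eq_inner inner_diff_left inner_diff_right inner_commute[of ?X X])
  qed
  also have "\<dots> = (1 + (norm ?X)\<^sup>2) - 2 * (LINT X|\<nu>. X \<bullet> ?X)"
    using int[OF continuous_on_inner[OF continuous_on_id continuous_on_const], of ?X]
    by (subst Bochner_Integration.integral_diff) (simp_all add: prob_space)
  also have "(LINT X|\<nu>. X \<bullet> ?X) = ?X \<bullet> ?X"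
    using integral_inner_left[OF int[OF continuous_on_id], of ?X] by (simp add: barycenter_def)
  finally show ?thesis by (simp add: power2_norm_eq_inner)
qed

text \<open>On the unit sphere the squared distance to the line is \<open>1 - (X \<bullet> e)\<^sup>2\<close>, so two applications of
  Jensen's inequality give the bound.\<close>

lemma line_dist_expectation:
  fixes \<nu> :: "'v::euclidean_space measure"
  assumes \<nu>: "sphere_prob \<nu>" and e: "norm e = 1"
  shows "(LINT X|\<nu>. line_dist e X)\<^sup>2 \<le> 1 - (barycenter \<nu> \<bullet> e)\<^sup>2"
proof -
  interpret prob_space \<nu> using \<nu> by (simp add: sphere_prob_def)
  note int = sphere_prob_integrable(1)[OF \<nu>]
  have cl: "continuous_on UNIV (line_dist e)"
    unfolding line_dist_def[abs_def] by (intro continuous_intros)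
  have ci: "continuous_on UNIV (\<lambda>X. X \<bullet> e)" by (intro continuous_intros)
  have "(LINT X|\<nu>. line_dist e X)\<^sup>2 \<le> (LINT X|\<nu>. (line_dist e X)\<^sup>2)"
    by (intro expectation_square_le int continuous_on_power cl)
  also have "\<dots> = (LINT X|\<nu>. 1 - (X \<bullet> e)\<^sup>2)"
    by (rule Bochner_Integration.integral_cong[OF refl])
       (simp add: line_dist_sq[OF e] sphere_prob_integrable(2)[OF \<nu> continuous_on_id])
  also have "\<dots> = 1 - (LINT X|\<nu>. (X \<bullet> e)\<^sup>2)"
    using int[OF continuous_on_power[OF ci, of 2]]
    by (subst Bochner_Integration.integral_diff) (auto simp: prob_space)
  also have "\<dots> \<le> 1 - (LINT X|\<nu>. X \<bullet> e)\<^sup>2"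
    using expectation_square_le[OF int[OF ci] int[OF continuous_on_power[OF ci, of 2]]] by simp
  also have "(LINT X|\<nu>. X \<bullet> e) = barycenter \<nu> \<bullet> e"
    using integral_inner_left[OF int[OF continuous_on_id], of e] by (simp add: barycenter_def)
  finally show ?thesis .
qed

section \<open>The wave cone and the variance bound\<close>

lemma wave_cone_scale: "X \<in> wave_cone A k \<Longrightarrow> c *\<^sub>R X \<in> wave_cone A k"
  by (auto simp: wave_cone_def blinfun.scaleR_right)

lemma zero_wave_cone: "0 \<in> wave_cone (A :: ('d::finite \<Rightarrow> nat) \<Rightarrow> _) k"
proof -
  have "axis undefined 1 \<in> (sphere 0 1 :: (real^'d) set)" by simp
  then show ?thesis unfolding wave_cone_def by (rule UN_I) (simp add: blinfun.zero_right)
qed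

lemma closed_wave_cone: "closed (wave_cone (A :: ('d::finite \<Rightarrow> nat) \<Rightarrow> ('v::euclidean_space \<Rightarrow>\<^sub>L 'w::euclidean_space)) k)"
proof -
  let ?T = "{p :: (real^'d) \<times> 'v. blinfun_apply (symbol A k (fst p)) (snd p) = 0}"
  have "continuous_on UNIV (\<lambda>p :: (real^'d) \<times> 'v. symbol A k (fst p))"
    unfolding symbol_def by (intro continuous_intros)
  then have "continuous_on UNIV (\<lambda>p :: (real^'d) \<times> 'v. blinfun_apply (symbol A k (fst p)) (snd p))"
    by (intro bounded_bilinear.continuous_on[OF bounded_bilinear_blinfun_apply] continuous_on_snd continuous_on_id)
  then have "closed ?T" by (intro closed_Collect_eq continuous_on_const)
  then have "closed {y. \<exists>x. x \<in> sphere 0 1 \<and> (x, y) \<in> ?T}"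
    by (rule closed_compact_projection[OF compact_sphere])
  moreover have "{y. \<exists>x. x \<in> sphere 0 1 \<and> (x, y) \<in> ?T} = wave_cone A k"
    by (auto simp: wave_cone_def)
  ultimately show ?thesis by simp
qed

text \<open>A line meets the unit sphere in two points, neither of which lies in the closed cone.\<close>

lemma cone_dist_line:
  fixes e :: "'v::euclidean_space"
  assumes e: "norm e = 1" and \<Lambda>: "closed \<Lambda>" "\<Lambda> \<noteq> {}" "e \<notin> \<Lambda>" "- e \<notin> \<Lambda>"
    and l: "l = range (\<lambda>t::real. t *\<^sub>R e)"
  shows "0 < cone_dist l \<Lambda>" "cone_dist l \<Lambda> \<le> 1"
proof -
  have "l \<inter> sphere 0 1 \<subseteq> {e, - e}"
  proof
    fix X assume "X \<in> l \<inter> sphere 0 1"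
    then have "X \<in> l" "norm X = 1" by auto
    from this(1) obtain t where t: "X = t *\<^sub>R e" unfolding l by (rule rangeE)
    then have "\<bar>t\<bar> = 1" using e \<open>norm X = 1\<close> by simp
    then show "X \<in> {e, - e}" using t by (cases "t = 1") (auto simp: abs_if split: if_splits)
  qed
  then have fin: "finite (insert 1 ((\<lambda>X. infdist X \<Lambda>) ` (l \<inter> sphere 0 1)))"
    and pos: "\<And>x. x \<in> insert 1 ((\<lambda>X. infdist X \<Lambda>) ` (l \<inter> sphere 0 1)) \<Longrightarrow> 0 < x"
    using finite_subset[of "l \<inter> sphere 0 1" "{e, - e}"]
      infdist_pos_not_in_closed[OF \<Lambda>(1,2,3)] infdist_pos_not_in_closed[OF \<Lambda>(1,2,4)] by auto
  have eq: "cone_dist l \<Lambda> = Min (insert 1 ((\<lambda>X. infdist X \<Lambda>) ` (l \<inter> sphere 0 1)))"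
    unfolding cone_dist_def by (rule cInf_eq_Min[OF fin]) simp
  show "0 < cone_dist l \<Lambda>" unfolding eq by (intro pos Min_in fin) simp
  show "cone_dist l \<Lambda> \<le> 1" unfolding eq by (rule Min_le[OF fin]) simp
qed

lemma clamp_lipschitz: "\<bar>max 0 (min c x) - max 0 (min c y)\<bar> \<le> \<bar>x - y\<bar>" for c x y :: real
  by (auto simp: max_def min_def abs_if)

text \<open>Testing the hypothesis with envelopes of the distance to the line plus bumps of radius and
  height \<open>t < |X\<^sub>0|\<close> around the barycenter.\<close>

lemma barycenter_bound:
  fixes A :: "('d::finite \<Rightarrow> nat) \<Rightarrow> ('v::euclidean_space \<Rightarrow>\<^sub>L 'w::euclidean_space)"
  assumes cr: "constant_rank A k" and \<nu>: "sphere_prob \<nu>"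
    and om: "omega A k l = ennreal om" "0 \<le> om"
    and e: "norm e = 1" "l = range (\<lambda>t::real. t *\<^sub>R e)"
    and test: "\<And>f. f \<in> E_qc A k \<Longrightarrow> f (s *\<^sub>R e) \<le> f 0 + (LINT X|\<nu>. recession f X)"
    and t: "0 < t" "t < s"
  shows "t \<le> om * (LINT X|\<nu>. line_dist e X)"
proof -
  interpret prob_space \<nu> using \<nu> by (simp add: sphere_prob_def)
  define g where "g X = om * line_dist e X" for X
  define b where "b X = t / (s - t) * max 0 (min (s - t) (s - norm (X - s *\<^sub>R e)))" for X
  define h where "h X = g X + b X" for X
  have b_bounds: "0 \<le> b X" "b X \<le> t" for X
  proof -
    show "0 \<le> b X" using t by (simp add: b_def)
    have "b X \<le> t / (s - t) * (s - t)" unfolding b_def using t by (intro mult_left_mono) auto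
    then show "b X \<le> t" using t by simp
  qed
  have g_lip: "\<bar>g X - g Y\<bar> \<le> om * norm (X - Y)" for X Y
  proof -
    have "g X - g Y = om * (line_dist e X - line_dist e Y)" by (simp add: g_def algebra_simps)
    then show ?thesis using om(2) mult_left_mono[OF line_dist_lipschitz[OF e(1)] om(2)] by (simp add: abs_mult)
  qed
  have b_lip: "\<bar>b X - b Y\<bar> \<le> t / (s - t) * norm (X - Y)" for X Y
  proof -
    have "\<bar>(s - norm (X - s *\<^sub>R e)) - (s - norm (Y - s *\<^sub>R e))\<bar> \<le> norm (X - Y)"
      using norm_triangle_ineq3[of "Y - s *\<^sub>R e" "X - s *\<^sub>R e"] by (simp add: norm_minus_commute)
    then have "\<bar>max 0 (min (s - t) (s - norm (X - s *\<^sub>R e))) - max 0 (min (s - t) (s - norm (Y - s *\<^sub>R e)))\<bar> \<le> norm (X - Y)"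
      by (rule order_trans[OF clamp_lipschitz])
    then have "t / (s - t) * \<bar>max 0 (min (s - t) (s - norm (X - s *\<^sub>R e))) - max 0 (min (s - t) (s - norm (Y - s *\<^sub>R e)))\<bar>
      \<le> t / (s - t) * norm (X - Y)"
      using t by (intro mult_left_mono) auto
    moreover have "b X - b Y = t / (s - t) * (max 0 (min (s - t) (s - norm (X - s *\<^sub>R e))) - max 0 (min (s - t) (s - norm (Y - s *\<^sub>R e))))"
      unfolding b_def by (rule right_diff_distrib[symmetric])
    moreover have "0 \<le> t / (s - t)" using t by simp
    ultimately show ?thesis by (simp only: abs_mult abs_of_nonneg)
  qed
  have g0: "0 \<le> g X" for X using om(2) by (simp add: g_def line_dist_def)
  have lg: "lipschitz_integrand g om"
    by unfold_locales (use g_lip om(2) g0 in auto)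
  have lh: "lipschitz_integrand h (om + t / (s - t))"
  proof
    show "\<bar>h X - h Y\<bar> \<le> (om + t / (s - t)) * norm (X - Y)" for X Y
      using g_lip[of X Y] b_lip[of X Y] unfolding h_def distrib_right by linarith
    show "0 \<le> om + t / (s - t)" using om(2) t by simp
    show "0 \<le> h X" for X using g0 b_bounds(1) by (simp add: h_def)
  qed
  interpret G: lipschitz_integrand A k g om by (rule lg)
  interpret H: lipschitz_integrand A k h "om + t / (s - t)" by (rule lh)
  have cont: "continuous_on UNIV H.env" "continuous_on UNIV G.env"
    by (rule lipschitz_continuous[OF H.env_lipschitz], rule lipschitz_continuous[OF G.env_lipschitz])
  have hom: "G.env (r *\<^sub>R X) = r * G.env X" if "r > 0" for r X
    by (rule G.env_homogeneous[OF _ that]) (simp add: g_def line_dist_scale)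
  have near: "\<bar>H.env X - G.env X\<bar> \<le> t" for X
  proof -
    have "H.env X \<le> G.env X + t" by (rule env_compare[OF lh lg]) (simp add: h_def b_bounds)
    moreover have "G.env X \<le> H.env X + 0" by (rule env_compare[OF lg lh]) (simp add: h_def b_bounds)
    ultimately show ?thesis by linarith
  qed
  note rec = E_space_near_homogeneous[OF cont hom near]
  have "H.env \<in> E_qc A k" unfolding E_qc_def using rec(1) H.env_quasiconvex[OF cr] by simp
  from test[OF this] have ineq: "H.env (s *\<^sub>R e) \<le> H.env 0 + (LINT X|\<nu>. G.env X)" by (simp only: rec(2))
  have "t \<le> H.env (s *\<^sub>R e)"
  proof (rule env_lower_bound[OF om e t(1) lh])
    show "om * line_dist e X \<le> h X" for X using b_bounds(1)[of X] by (simp add: h_def g_def)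
    show "om * line_dist e X + t \<le> h X" if "norm (X - s *\<^sub>R e) \<le> t" for X
    proof -
      have "max 0 (min (s - t) (s - norm (X - s *\<^sub>R e))) = s - t" using that t by simp
      then have "b X = t" using t by (simp add: b_def)
      then show ?thesis by (simp add: h_def g_def)
    qed
  qed
  moreover have "H.env 0 \<le> 0"
  proof -
    have "norm (0 - s *\<^sub>R e) = s" using t e(1) by simp
    then have "h 0 = 0" by (simp add: h_def g_def b_def line_dist_def)
    then show ?thesis using H.env_le_self[of 0] by simp
  qed
  moreover have "(LINT X|\<nu>. G.env X) \<le> (LINT X|\<nu>. g X)"
    by (intro integral_mono sphere_prob_integrable(1)[OF \<nu>] cont(2) lipschitz_continuous[OF g_lip] G.env_le_self)
  moreover have "(LINT X|\<nu>. g X) = om * (LINT X|\<nu>. line_dist e X)" by (simp add: g_def)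
  ultimately show ?thesis using ineq by linarith
qed

theorem mainTheorem6:
  fixes A :: "('d::finite \<Rightarrow> nat) \<Rightarrow> ('v::euclidean_space \<Rightarrow>\<^sub>L 'w::euclidean_space)"
    and k :: nat
    and \<Lambda> :: "'v set"
    and varpi :: real
    and \<nu> :: "'v measure"
    and X\<^sub>0 :: 'v
    and l :: "'v set"
  assumes "k \<ge> 1"
    and "constant_rank A k"
    and "\<Lambda> = wave_cone A k"
    and "varpi \<ge> 1"
    and "\<And>V. subspace V \<Longrightarrow> V \<inter> \<Lambda> = {0} \<Longrightarrow>
           omega A k V \<le> ennreal varpi / ennreal (cone_dist V \<Lambda>) ^ (CARD('d) div 2 + 2)"
    and "sphere_prob \<nu>"
    and "AE X in \<nu>. X \<in> span \<Lambda>"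
    and "X\<^sub>0 = barycenter \<nu>"
    and "X\<^sub>0 \<notin> \<Lambda>"
    and "\<And>f. f \<in> E_qc A k \<Longrightarrow> f X\<^sub>0 \<le> f 0 + (LINT X|\<nu>. recession f X)"
    and "l = range (\<lambda>t::real. t *\<^sub>R X\<^sub>0)"
  shows "Var \<nu> = 1 - (norm X\<^sub>0)\<^sup>2
    \<and> ennreal (Var \<nu>) \<ge> 1 / (1 + (omega A k l)\<^sup>2)
    \<and> 1 / (1 + (omega A k l)\<^sup>2) > 0
    \<and> Var \<nu> \<ge> cone_dist l \<Lambda> ^ (2 * (CARD('d) div 2 + 2)) / (1 + varpi\<^sup>2)"
proof -
  let ?m = "CARD('d) div 2 + 2"
  have zero: "0 \<in> \<Lambda>" and closed: "closed \<Lambda>"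
    unfolding assms(3) by (rule zero_wave_cone, rule closed_wave_cone)
  have X0: "X\<^sub>0 \<noteq> 0" using zero assms(9) by auto
  define s where "s = norm X\<^sub>0"
  define e where "e = (1 / s) *\<^sub>R X\<^sub>0"
  have s: "s > 0" using X0 by (simp add: s_def)
  have e1: "norm e = 1" and se: "s *\<^sub>R e = X\<^sub>0" using s by (simp_all add: e_def s_def)
  have l: "l = range (\<lambda>t::real. t *\<^sub>R e)"
  proof -
    have "t *\<^sub>R X\<^sub>0 = (t * s) *\<^sub>R e" for t
      by (simp only: se scaleR_scaleR[symmetric])
    moreover have "t *\<^sub>R e = (t / s) *\<^sub>R X\<^sub>0" for t
      by (simp add: e_def)
    ultimately show ?thesis unfolding assms(11) by blast
  qed
  have notin: "c *\<^sub>R e \<notin> \<Lambda>" if "c \<noteq> 0" for c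
  proof
    assume "c *\<^sub>R e \<in> \<Lambda>"
    then have "(s / c) *\<^sub>R (c *\<^sub>R e) \<in> \<Lambda>" unfolding assms(3) by (rule wave_cone_scale)
    then show False using that se assms(9) by simp
  qed
  define \<delta> where "\<delta> = cone_dist l \<Lambda>"
  have \<delta>: "0 < \<delta>" "\<delta> \<le> 1"
    unfolding \<delta>_def using cone_dist_line[OF e1 closed _ _ _ l] zero notin[of 1] notin[of "- 1"] by auto
  have "subspace l" unfolding l
    by (auto simp: subspace_def image_iff scaleR_add_left[symmetric] intro: exI[of _ 0])
  moreover have "l \<inter> \<Lambda> = {0}"
  proof -
    have "X = 0" if "X \<in> l" "X \<in> \<Lambda>" for X
    proof -
      from \<open>X \<in> l\<close> obtain c where c: "X = c *\<^sub>R e" unfolding l by (rule rangeE)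
      then have "c = 0" using notin[of c] \<open>X \<in> \<Lambda>\<close> by auto
      then show ?thesis using c by simp
    qed
    moreover have "0 \<in> l" unfolding l by (rule range_eqI[of _ _ 0]) simp
    ultimately show ?thesis using zero by auto
  qed
  ultimately have "omega A k l \<le> ennreal varpi / ennreal \<delta> ^ ?m" unfolding \<delta>_def by (rule assms(5))
  also have "\<dots> = ennreal (varpi / \<delta> ^ ?m)"
    using \<delta> assms(4) by (simp only: ennreal_power divide_ennreal zero_less_power less_imp_le)
  finally have om_le: "omega A k l \<le> ennreal (varpi / \<delta> ^ ?m)" .
  define om where "om = enn2real (omega A k l)"
  have om: "omega A k l = ennreal om" "0 \<le> om"
    using le_less_trans[OF om_le ennreal_less_top] unfolding om_def by (simp_all add: ennreal_enn2real)
  have om_bound: "om \<le> varpi / \<delta> ^ ?m"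
    using om_le \<delta> assms(4) unfolding om(1) by (subst (asm) ennreal_le_iff) auto
  define J where "J = (LINT X|\<nu>. line_dist e X)"
  have "s \<le> om * J"
  proof (rule dense_le_bounded[OF s])
    fix t assume t: "0 < t" "t < s"
    show "t \<le> om * J"
      unfolding J_def
      by (rule barycenter_bound[OF assms(2,6) om e1 l _ t]) (simp add: se assms(10))
  qed
  then have "s\<^sup>2 \<le> (om * J)\<^sup>2" using s by (intro power_mono) auto
  also have "\<dots> \<le> om\<^sup>2 * (1 - s\<^sup>2)"
  proof -
    have "barycenter \<nu> \<bullet> e = s"
    proof -
      have "s *\<^sub>R e \<bullet> e = s" using e1 by (simp add: dot_square_norm)
      then show ?thesis by (simp only: se assms(8)[symmetric])
    qed
    then have "J\<^sup>2 \<le> 1 - s\<^sup>2" using line_dist_expectation[OF assms(6) e1] by (simp add: J_def)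
    then show ?thesis by (simp add: power_mult_distrib mult_left_mono)
  qed
  finally have "1 \<le> (1 - s\<^sup>2) * (1 + om\<^sup>2)" by (simp add: algebra_simps)
  moreover have pos: "0 < 1 + om\<^sup>2" by (simp add: add_pos_nonneg)
  ultimately have key: "1 / (1 + om\<^sup>2) \<le> 1 - s\<^sup>2" by (simp only: pos_divide_le_eq)
  have Var: "Var \<nu> = 1 - s\<^sup>2" using Var_eq[OF assms(6)] by (simp only: assms(8) s_def)
  have enn: "1 / (1 + (omega A k l)\<^sup>2) = ennreal (1 / (1 + om\<^sup>2))"
  proof -
    have "1 + (omega A k l)\<^sup>2 = ennreal (1 + om\<^sup>2)"
      using om(2) by (simp add: om(1) ennreal_power ennreal_plus[symmetric] del: ennreal_plus flip: ennreal_1)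
    then show ?thesis using pos divide_ennreal[of 1 "1 + om\<^sup>2"] by simp
  qed
  have "\<delta> ^ (2 * ?m) / (1 + varpi\<^sup>2) \<le> 1 / (1 + om\<^sup>2)"
  proof -
    have "\<delta> ^ ?m * om \<le> varpi" using om_bound \<delta> by (simp add: field_simps)
    then have "(\<delta> ^ ?m * om)\<^sup>2 \<le> varpi\<^sup>2" using om(2) \<delta> by (intro power_mono) auto
    then have "\<delta> ^ (2 * ?m) * om\<^sup>2 \<le> varpi\<^sup>2"
      by (simp only: power_mult_distrib power_mult[symmetric] mult.commute[of 2])
    moreover have "\<delta> ^ (2 * ?m) \<le> 1" using \<delta> by (intro power_le_one) auto
    ultimately have "\<delta> ^ (2 * ?m) * (1 + om\<^sup>2) \<le> 1 + varpi\<^sup>2" unfolding distrib_left by linarith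
    then show ?thesis using pos by (simp add: field_simps add_pos_nonneg)
  qed
  then have "\<delta> ^ (2 * ?m) / (1 + varpi\<^sup>2) \<le> Var \<nu>" using key Var by linarith
  moreover have "1 / (1 + (omega A k l)\<^sup>2) \<le> ennreal (Var \<nu>)"
    unfolding enn Var using key by (rule ennreal_leI)
  moreover have "0 < 1 / (1 + (omega A k l)\<^sup>2)" unfolding enn using pos by simp
  ultimately show ?thesis using Var unfolding \<delta>_def s_def by blast
qed

end
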